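(* Let $d=3$. Consider a solution $(\tilde u_h^n,u_h^n,P_h^n)$ of the EMAC-BE-PROJ algorithm (written out in the context), and assume that the data and the solution vanish on a strip along the boundary: $f$, $\tilde u_h^n$, $u_h^n$, $P_h^n$ all vanish on $\Omega_s$, the part of $\Omega$ covered by the strip of mesh elements along $\partial\Omega$. Let $\psi_i$ be the $i$-th standard basis vector of $\mathbb R^3$, $\phi_i=x\times\psi_i$, and set $(M_X)_i^n=(u_h^n,\phi_i)$ and $(\tilde M_X)_i^n=(\tilde u_h^n,\phi_i)$. Then the method has the angular momentum balance in which the nonlinear term does not contribute: for every $i=1,2,3$ and $n=0,1,\dots,M-1$, $$(\tilde M_X)_i^{n+1}-(\tilde M_X)_i^n=(M_X)_i^{n+1}-(M_X)_i^n=\Delta t\,(f(t^{n+1}),\phi_i).$$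
   Context: Domain and spaces. $\Omega\subseteq\mathbb R^3$ is convex polygonal (or has smooth boundary); $(\cdot,\cdot)$ is the $L^2(\Omega)$ inner product (also used for the duality pairing with $f$). Velocity-type functions are $\mathbb R^3$-valued. $X=\{v\in H^1(\Omega): v|_{\partial\Omega}=0\}$, $Q=\{q\in L^2(\Omega):\int_\Omega q\,dx=0\}$, $Y=\{v\in L^2(\Omega):\nabla\cdot v\in L^2(\Omega),\ v\cdot\hat n|_{\partial\Omega}=0\}$. Discretization. $\tau_h$ is a regular conforming triangulation of $\Omega$; $P_k(\tau_h)$ denotes piecewise polynomials of degree $k$. $X_h=X\cap P_k(\tau_h)$, $Q_h=Q\cap P_{k-1}(\tau_h)\cap C^0(\Omega)$, $Y_h=Y\cap P_k(\tau_h)\supset X_h$, $V_h=\{v_h\in X_h:(\nabla\cdot v_h,q_h)=0\ \forall q_h\in Q_h\}$. It is assumed that there is $\beta>0$ independent of $h$ with $\beta\|\nabla q\|\le\sup_{0\ne v\in X_h}\frac{(\nabla q,v)}{\|v\|}$ for all $q\in Q_h$. Since $f$ vanishes on $\Omega_s$, the pairing of $f(t^{n+1})$ with $\phi_i$ is well defined and equals its pairing with any $\phi_{i,h}\in X_h$ that equals $\phi_i$ on $\Omega\setminus\Omega_s$. Angular momentum of a velocity $u$ is $M_X=\int_\Omega u\times x\,dx$, whose $i$-th component is $(u,\phi_i)$. Nonlinear form. With $D(u)=\frac12(\nabla u+\nabla u^T)$, $c(u,v,w)=(2D(u)v,w)+((\nabla\cdot u)v,w)$. EMAC-BE-PROJ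 algorithm. Given viscosity $\nu>0$, $f\in L^\infty(0,T;H^{-1}(\Omega))$, a solenoidal initial condition $u^0\in L^2(\Omega)$ satisfying no-slip boundary conditions, $u_h^0=\tilde u_h^0$ the $L^2$ projection of $u^0$ into $V_h$, end time $T$ and number of time steps $M$, set $\Delta t=T/M$, $t^n=n\Delta t$. For $n=0,1,\dots,M-1$: Step 1: find $\tilde u_h^{n+1}\in X_h$ with $$\frac1{\Delta t}(\tilde u_h^{n+1}-u_h^n,\chi_h)+c(\tilde u_h^{n+1},\tilde u_h^{n+1},\chi_h)+\nu(\nabla\tilde u_h^{n+1},\nabla\chi_h)=(f(t^{n+1}),\chi_h)\quad\forall\chi_h\in X_h.$$ Step 2: find $(u_h^{n+1},P_h^{n+1})\in Y_h\times Q_h$ with $$\frac1{\Delta t}(u_h^{n+1},w_h)-(P_h^{n+1},\nabla\cdot w_h)=\frac1{\Delta t}(\tilde u_h^{n+1},w_h),\qquad(\nabla\cdot u_h^{n+1},q_h)=0\quad\forall(w_h,q_h)\in Y_h\times Q_h.$$ *)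

theory Defs
  imports "HOL-Analysis.Analysis"
begin

section \<open>Square-integrable functions\<close>

text \<open>
  Functions on \<open>\<Omega>\<close> are represented by total functions on \<open>real^3\<close>; only their values almost
  everywhere on \<open>\<Omega>\<close> matter.
\<close>

definition L2 :: "(real^3) set \<Rightarrow> (real^3 \<Rightarrow> 'b::euclidean_space) set" where
  "L2 \<Omega> = {v. v \<in> borel_measurable (lebesgue_on \<Omega>) \<and>
              integrable (lebesgue_on \<Omega>) (\<lambda>x. (norm (v x))\<^sup>2)}"

definition ip :: "(real^3) set \<Rightarrow> (real^3 \<Rightarrow> 'b::euclidean_space) \<Rightarrow> (real^3 \<Rightarrow> 'b) \<Rightarrow> real" where
  "ip \<Omega> u v = (LINT x|lebesgue_on \<Omega>. u x \<bullet> v x)"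

definition L2norm :: "(real^3) set \<Rightarrow> (real^3 \<Rightarrow> 'b::euclidean_space) \<Rightarrow> real" where
  "L2norm \<Omega> v = sqrt (ip \<Omega> v v)"

definition vanishes_on :: "(real^3) set \<Rightarrow> (real^3 \<Rightarrow> 'b::euclidean_space) \<Rightarrow> bool" where
  "vanishes_on S v \<longleftrightarrow> (AE x in lebesgue_on S. v x = 0)"


section \<open>Weak derivatives\<close>

definition partial :: "3 \<Rightarrow> (real^3 \<Rightarrow> real) \<Rightarrow> real^3 \<Rightarrow> real" where
  "partial j \<psi> x = frechet_derivative \<psi> (at x) (axis j 1)"

definition C1c :: "(real^3) set \<Rightarrow> (real^3 \<Rightarrow> real) set" where
  "C1c \<Omega> = {\<psi>. (\<forall>x. \<psi> differentiable (at x)) \<and>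
               (\<forall>j. continuous_on UNIV (partial j \<psi>)) \<and>
               compact (closure {x. \<psi> x \<noteq> 0}) \<and> closure {x. \<psi> x \<noteq> 0} \<subseteq> \<Omega>}"

text \<open>
  As usual for first-order derivatives, compactly supported \<open>C\<^sup>1\<close> test functions are used; by
  mollification they give the same weak derivatives (and the same closure in \<open>H\<^sup>1\<close>) as
  compactly supported smooth ones.
\<close>

definition has_wpartial ::
    "(real^3) set \<Rightarrow> 3 \<Rightarrow> (real^3 \<Rightarrow> real) \<Rightarrow> (real^3 \<Rightarrow> real) \<Rightarrow> bool" where
  "has_wpartial \<Omega> j u g \<longleftrightarrow> (\<forall>\<psi>\<in>C1c \<Omega>. ip \<Omega> u (partial j \<psi>) = - ip \<Omega> g \<psi>)"

definition has_wdiv :: "(real^3) set \<Rightarrow> (real^3 \<Rightarrow> real^3) \<Rightarrow> (real^3 \<Rightarrow> real) \<Rightarrow> bool" where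
  "has_wdiv \<Omega> v d \<longleftrightarrow>
     (\<forall>\<psi>\<in>C1c \<Omega>. ip \<Omega> v (\<lambda>x. \<chi> j. partial j \<psi> x) = - ip \<Omega> d \<psi>)"

text \<open>Weak derivatives are unique only up to null sets; a representative is chosen.\<close>

definition wpartial :: "(real^3) set \<Rightarrow> 3 \<Rightarrow> (real^3 \<Rightarrow> real) \<Rightarrow> real^3 \<Rightarrow> real" where
  "wpartial \<Omega> j u = (SOME g. g \<in> L2 \<Omega> \<and> has_wpartial \<Omega> j u g)"

definition wgrad :: "(real^3) set \<Rightarrow> (real^3 \<Rightarrow> real) \<Rightarrow> real^3 \<Rightarrow> real^3" where
  "wgrad \<Omega> q x = (\<chi> j. wpartial \<Omega> j q x)"

definition wjac :: "(real^3) set \<Rightarrow> (real^3 \<Rightarrow> real^3) \<Rightarrow> real^3 \<Rightarrow> real^3^3" where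
  "wjac \<Omega> v x = (\<chi> i j. wpartial \<Omega> j (\<lambda>y. v y $ i) x)"

definition wdiv :: "(real^3) set \<Rightarrow> (real^3 \<Rightarrow> real^3) \<Rightarrow> real^3 \<Rightarrow> real" where
  "wdiv \<Omega> v = (SOME d. d \<in> L2 \<Omega> \<and> has_wdiv \<Omega> v d)"


section \<open>Function spaces\<close>

definition H1 :: "(real^3) set \<Rightarrow> (real^3 \<Rightarrow> real) set" where
  "H1 \<Omega> = {u \<in> L2 \<Omega>. \<forall>j. \<exists>g\<in>L2 \<Omega>. has_wpartial \<Omega> j u g}"

definition H1vec :: "(real^3) set \<Rightarrow> (real^3 \<Rightarrow> real^3) set" where
  "H1vec \<Omega> = {v. \<forall>i. (\<lambda>x. v x $ i) \<in> H1 \<Omega>}"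

definition H1norm :: "(real^3) set \<Rightarrow> (real^3 \<Rightarrow> real^3) \<Rightarrow> real" where
  "H1norm \<Omega> v = sqrt ((L2norm \<Omega> v)\<^sup>2 + (L2norm \<Omega> (wjac \<Omega> v))\<^sup>2)"

text \<open>
  \<open>H\<^sup>1\<close> fields with zero boundary values: the \<open>H\<^sup>1\<close>-closure of the compactly supported fields.
\<close>

definition Xsp :: "(real^3) set \<Rightarrow> (real^3 \<Rightarrow> real^3) set" where
  "Xsp \<Omega> = {v \<in> H1vec \<Omega>. \<forall>\<epsilon>>0. \<exists>w. (\<forall>i. (\<lambda>x. w x $ i) \<in> C1c \<Omega>) \<and>
                              H1norm \<Omega> (\<lambda>x. v x - w x) < \<epsilon>}"

definition Qsp :: "(real^3) set \<Rightarrow> (real^3 \<Rightarrow> real) set" where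
  "Qsp \<Omega> = {q \<in> L2 \<Omega>. (LINT x|lebesgue_on \<Omega>. q x) = 0}"

text \<open>
  The normal trace of \<open>v\<close> is the functional \<open>q \<mapsto> (v, \<nabla>q) + (\<nabla>\<cdot>v, q)\<close> on \<open>H\<^sup>1\<close>.
\<close>

definition zero_normal_trace :: "(real^3) set \<Rightarrow> (real^3 \<Rightarrow> real^3) \<Rightarrow> bool" where
  "zero_normal_trace \<Omega> v \<longleftrightarrow> (\<forall>q\<in>H1 \<Omega>. ip \<Omega> v (wgrad \<Omega> q) + ip \<Omega> (wdiv \<Omega> v) q = 0)"

definition Ysp :: "(real^3) set \<Rightarrow> (real^3 \<Rightarrow> real^3) set" where
  "Ysp \<Omega> = {v \<in> L2 \<Omega>. (\<exists>d\<in>L2 \<Omega>. has_wdiv \<Omega> v d) \<and> zero_normal_trace \<Omega> v}"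


section \<open>The dual space of \<open>X\<close>\<close>

type_synonym functional = "(real^3 \<Rightarrow> real^3) \<Rightarrow> real"

definition Hm1 :: "(real^3) set \<Rightarrow> functional set" where
  "Hm1 \<Omega> = {F. (\<forall>u\<in>Xsp \<Omega>. \<forall>v\<in>Xsp \<Omega>. F (\<lambda>x. u x + v x) = F u + F v) \<and>
               (\<forall>c. \<forall>v\<in>Xsp \<Omega>. F (\<lambda>x. c *\<^sub>R v x) = c * F v) \<and>
               (\<exists>C. \<forall>v\<in>Xsp \<Omega>. \<bar>F v\<bar> \<le> C * H1norm \<Omega> v)}"

text \<open>
  \<open>L\<^sup>\<infinity>(0,T;H\<^sup>-\<^sup>1)\<close>, for a representative defined at every time (the scheme uses point values
  \<open>f(t\<^sup>n)\<close>). Since \<open>H\<^sup>-\<^sup>1\<close> is separable and reflexive, weak measurability suffices.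
\<close>

definition Linf_Hm1 :: "(real^3) set \<Rightarrow> real \<Rightarrow> (real \<Rightarrow> functional) \<Rightarrow> bool" where
  "Linf_Hm1 \<Omega> Tend f \<longleftrightarrow>
     (\<forall>t\<in>{0<..Tend}. f t \<in> Hm1 \<Omega>) \<and>
     (\<forall>v\<in>Xsp \<Omega>. (\<lambda>t. f t v) \<in> borel_measurable (lebesgue_on {0<..<Tend})) \<and>
     (\<exists>C. AE t in lebesgue_on {0<..<Tend}. \<forall>v\<in>Xsp \<Omega>. \<bar>f t v\<bar> \<le> C * H1norm \<Omega> v)"

definition functional_vanishes_on :: "(real^3) set \<Rightarrow> (real^3) set \<Rightarrow> functional \<Rightarrow> bool" where
  "functional_vanishes_on \<Omega> S F \<longleftrightarrow> (\<forall>v\<in>Xsp \<Omega>. vanishes_on (\<Omega> - S) v \<longrightarrow> F v = 0)"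

text \<open>
  Pairing of a functional that vanishes on \<open>S\<close> with a field \<open>\<phi>\<close> which need not lie in \<open>X\<close>: the
  common value of \<open>F\<close> on the elements of \<open>X\<close> that equal \<open>\<phi>\<close> on \<open>\<Omega> - S\<close>.
\<close>

definition pairing_off :: "(real^3) set \<Rightarrow> (real^3) set \<Rightarrow> functional \<Rightarrow> (real^3 \<Rightarrow> real^3) \<Rightarrow> real" where
  "pairing_off \<Omega> S F \<phi> =
     (THE c. \<exists>v\<in>Xsp \<Omega>. (AE x in lebesgue_on (\<Omega> - S). v x = \<phi> x) \<and> F v = c)"


section \<open>Meshes and finite element spaces\<close>

definition conforming_mesh :: "(real^3) set \<Rightarrow> (real^3) set set \<Rightarrow> bool" where
  "conforming_mesh \<Omega> \<T> \<longleftrightarrow>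
     triangulation \<T> \<and> (\<forall>K\<in>\<T>. 3 simplex K) \<and> \<Union>\<T> = closure \<Omega>"

definition inradius :: "(real^3) set \<Rightarrow> real" where
  "inradius K = Sup {r. \<exists>x. 0 \<le> r \<and> cball x r \<subseteq> K}"

definition regular_mesh_family ::
    "(real^3) set \<Rightarrow> real set \<Rightarrow> (real \<Rightarrow> (real^3) set set) \<Rightarrow> bool" where
  "regular_mesh_family \<Omega> H \<T> \<longleftrightarrow>
     (\<forall>h\<in>H. conforming_mesh \<Omega> (\<T> h) \<and> h = Max (diameter ` \<T> h)) \<and>
     (\<exists>\<sigma>>0. \<forall>h\<in>H. \<forall>K\<in>\<T> h. diameter K \<le> \<sigma> * inradius K)"

text \<open>
  A bounded domain lying on one side of its boundary. Together with an exact simplicial mesh this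
  makes \<open>\<Omega>\<close> polyhedral; convexity is not required.
\<close>

definition regular_domain :: "(real^3) set \<Rightarrow> bool" where
  "regular_domain \<Omega> \<longleftrightarrow>
     open \<Omega> \<and> connected \<Omega> \<and> bounded \<Omega> \<and> \<Omega> \<noteq> {} \<and> interior (closure \<Omega>) = \<Omega>"

text \<open>Polynomial functions of total degree at most \<open>k\<close>; \<open>\<alpha>\<close> ranges over multi-indices.\<close>

definition poly_fun :: "nat \<Rightarrow> (real^3 \<Rightarrow> real) set" where
  "poly_fun k = range (\<lambda>c x. \<Sum>\<alpha> | (\<Sum>i\<in>(UNIV::3 set). \<alpha> i) \<le> k.
                                c \<alpha> * (\<Prod>i\<in>(UNIV::3 set). (x $ i) ^ \<alpha> i))"

definition Pk :: "(real^3) set set \<Rightarrow> nat \<Rightarrow> (real^3 \<Rightarrow> real) set" where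
  "Pk \<T> k = {q. \<forall>K\<in>\<T>. \<exists>p\<in>poly_fun k. AE x in lebesgue_on K. q x = p x}"

definition Pkvec :: "(real^3) set set \<Rightarrow> nat \<Rightarrow> (real^3 \<Rightarrow> real^3) set" where
  "Pkvec \<T> k = {v. \<forall>i. (\<lambda>x. v x $ i) \<in> Pk \<T> k}"

definition Xh :: "(real^3) set \<Rightarrow> (real^3) set set \<Rightarrow> nat \<Rightarrow> (real^3 \<Rightarrow> real^3) set" where
  "Xh \<Omega> \<T> k = Xsp \<Omega> \<inter> Pkvec \<T> k"

definition Qh :: "(real^3) set \<Rightarrow> (real^3) set set \<Rightarrow> nat \<Rightarrow> (real^3 \<Rightarrow> real) set" where
  "Qh \<Omega> \<T> k = Qsp \<Omega> \<inter> Pk \<T> (k - 1) \<inter> {q. continuous_on \<Omega> q}"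

definition Yh :: "(real^3) set \<Rightarrow> (real^3) set set \<Rightarrow> nat \<Rightarrow> (real^3 \<Rightarrow> real^3) set" where
  "Yh \<Omega> \<T> k = Ysp \<Omega> \<inter> Pkvec \<T> k"

definition Vh :: "(real^3) set \<Rightarrow> (real^3) set set \<Rightarrow> nat \<Rightarrow> (real^3 \<Rightarrow> real^3) set" where
  "Vh \<Omega> \<T> k = {v \<in> Xh \<Omega> \<T> k. \<forall>q\<in>Qh \<Omega> \<T> k. ip \<Omega> (wdiv \<Omega> v) q = 0}"

definition inf_sup ::
    "(real^3) set \<Rightarrow> (real^3) set set \<Rightarrow> nat \<Rightarrow> real \<Rightarrow> bool" where
  "inf_sup \<Omega> \<T> k \<beta> \<longleftrightarrow>
     (\<forall>q\<in>Qh \<Omega> \<T> k. ereal (\<beta> * L2norm \<Omega> (wgrad \<Omega> q)) \<le>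
        (SUP v\<in>{v \<in> Xh \<Omega> \<T> k. L2norm \<Omega> v \<noteq> 0}. ereal (ip \<Omega> (wgrad \<Omega> q) v / L2norm \<Omega> v)))"

definition boundary_strip :: "(real^3) set \<Rightarrow> (real^3) set set \<Rightarrow> (real^3) set" where
  "boundary_strip \<Omega> \<T> = \<Omega> \<inter> \<Union>{K \<in> \<T>. K \<inter> frontier \<Omega> \<noteq> {}}"


section \<open>The EMAC-BE-PROJ algorithm\<close>

definition sym_grad :: "(real^3) set \<Rightarrow> (real^3 \<Rightarrow> real^3) \<Rightarrow> real^3 \<Rightarrow> real^3^3" where
  "sym_grad \<Omega> u x = (1/2) *\<^sub>R (wjac \<Omega> u x + transpose (wjac \<Omega> u x))"

definition emac ::
    "(real^3) set \<Rightarrow> (real^3 \<Rightarrow> real^3) \<Rightarrow> (real^3 \<Rightarrow> real^3) \<Rightarrow> (real^3 \<Rightarrow> real^3) \<Rightarrow> real" where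
  "emac \<Omega> u v w = ip \<Omega> (\<lambda>x. 2 *\<^sub>R (sym_grad \<Omega> u x *v v x)) w
                 + ip \<Omega> (\<lambda>x. wdiv \<Omega> u x *\<^sub>R v x) w"

definition is_L2_projection ::
    "(real^3) set \<Rightarrow> (real^3 \<Rightarrow> real^3) set \<Rightarrow> (real^3 \<Rightarrow> real^3) \<Rightarrow> (real^3 \<Rightarrow> real^3) \<Rightarrow> bool" where
  "is_L2_projection \<Omega> V u p \<longleftrightarrow> p \<in> V \<and> (\<forall>v\<in>V. ip \<Omega> p v = ip \<Omega> u v)"

text \<open>
  For a solenoidal field that is only in \<open>L\<^sup>2\<close>, the boundary condition is meaningful for the
  normal component only.
\<close>

definition admissible_initial :: "(real^3) set \<Rightarrow> (real^3 \<Rightarrow> real^3) \<Rightarrow> bool" where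
  "admissible_initial \<Omega> u0 \<longleftrightarrow> u0 \<in> Ysp \<Omega> \<and> has_wdiv \<Omega> u0 (\<lambda>_. 0)"

text \<open>
  \<open>ut n\<close>, \<open>u n\<close>, \<open>P n\<close> are the intermediate velocity, the projected velocity and the pressure at
  time \<open>n \<cdot> dt\<close>; \<open>P 0\<close> is not used.
\<close>

definition emac_be_proj ::
    "(real^3) set \<Rightarrow> (real^3) set set \<Rightarrow> nat \<Rightarrow> real \<Rightarrow> real \<Rightarrow> nat \<Rightarrow> (real \<Rightarrow> functional) \<Rightarrow>
     (real^3 \<Rightarrow> real^3) \<Rightarrow> (nat \<Rightarrow> real^3 \<Rightarrow> real^3) \<Rightarrow> (nat \<Rightarrow> real^3 \<Rightarrow> real^3) \<Rightarrow>
     (nat \<Rightarrow> real^3 \<Rightarrow> real) \<Rightarrow> bool" where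
  "emac_be_proj \<Omega> \<T> k \<nu> dt M f u0 ut u P \<longleftrightarrow>
     is_L2_projection \<Omega> (Vh \<Omega> \<T> k) u0 (u 0) \<and> ut 0 = u 0 \<and>
     (\<forall>n<M.
        ut (Suc n) \<in> Xh \<Omega> \<T> k \<and>
        (\<forall>z\<in>Xh \<Omega> \<T> k.
           (1 / dt) * ip \<Omega> (\<lambda>x. ut (Suc n) x - u n x) z
           + emac \<Omega> (ut (Suc n)) (ut (Suc n)) z
           + \<nu> * ip \<Omega> (wjac \<Omega> (ut (Suc n))) (wjac \<Omega> z)
           = f (real (Suc n) * dt) z) \<and>
        u (Suc n) \<in> Yh \<Omega> \<T> k \<and> P (Suc n) \<in> Qh \<Omega> \<T> k \<and>
        (\<forall>w\<in>Yh \<Omega> \<T> k.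
           (1 / dt) * ip \<Omega> (u (Suc n)) w - ip \<Omega> (P (Suc n)) (wdiv \<Omega> w)
           = (1 / dt) * ip \<Omega> (ut (Suc n)) w) \<and>
        (\<forall>q\<in>Qh \<Omega> \<T> k. ip \<Omega> (wdiv \<Omega> (u (Suc n))) q = 0))"


section \<open>Angular momentum\<close>

text \<open>
  \<open>x \<times> e\<^sub>i\<close>; by the scalar triple product, \<open>(u, rot_field i)\<close> is the \<open>i\<close>-th component of the
  angular momentum \<open>\<integral> u \<times> x\<close>.
\<close>

definition rot_field :: "3 \<Rightarrow> real^3 \<Rightarrow> real^3" where
  "rot_field i x = cross3 x (axis i 1)"

definition ang_mom :: "(real^3) set \<Rightarrow> (real^3 \<Rightarrow> real^3) \<Rightarrow> 3 \<Rightarrow> real" where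
  "ang_mom \<Omega> u i = ip \<Omega> u (rot_field i)"

end

theory Submission
  imports Defs
begin

text \<open>
  Write \<open>\<phi>\<^sub>i\<close> for the field \<open>x \<times> e\<^sub>i\<close>, so that the \<open>i\<close>-th angular momentum of \<open>u\<close> is
  \<open>(u, \<phi>\<^sub>i)\<close>. If \<open>\<phi>\<^sub>i\<close> were an admissible test function, the balance would follow by testing both
  steps of the scheme with it: \<open>\<phi>\<^sub>i\<close> is affine with a skew-symmetric gradient, hence it is
  divergence free and the pressure drops out; the viscous term is a combination of integrals of first
  derivatives of a field with zero boundary values; and the nonlinear form vanishes
  (\<open>emac_rot_integral\<close>), because integrating by parts moves all derivatives onto \<open>\<phi>\<^sub>i\<close> and leaves
  the symmetric matrix \<open>u\<^sub>a u\<^sub>b\<close> paired with the skew-symmetric one.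

  The field \<open>\<phi>\<^sub>i\<close> does not vanish on the boundary, and here the strip enters. Interpolate \<open>\<phi>\<^sub>i\<close>
  linearly at the mesh vertices inside \<open>\<Omega>\<close>, with value zero at the vertices on the boundary
  (\<open>rot_interp\<close>). Since \<open>\<phi>\<^sub>i\<close> is affine, the interpolant equals \<open>\<phi>\<^sub>i\<close> on every element that does
  not touch the boundary, and on the remaining elements the velocities, the pressure and the force
  vanish, so the computation above goes through with the interpolant in place of \<open>\<phi>\<^sub>i\<close>.

  What remains is that the interpolant belongs to the discrete velocity space, that is, that the hat
  function of an interior vertex lies in the \<open>H\<^sup>1\<close>-closure of the compactly supported \<open>C\<^sup>1\<close> functions.
  It vanishes on the boundary by a scaling argument at its vertex (\<open>hat_positive_interior\<close>), so
  cutting it off at a small height and mollifying yields test functions inside \<open>\<Omega>\<close>; their gradients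
  are bounded by the Lipschitz constant and are eventually constant at every interior point of an
  element, so dominated convergence applies (\<open>H10_piecewise_affine\<close>).

  Weak derivatives enter the statement through a choice of representatives, so every computation
  with them rests on their uniqueness almost everywhere (\<open>AE_eq_if_test_eq\<close>) and on their locality
  (\<open>wpartial_local\<close>).
\<close>

section \<open>Square-integrable functions\<close>

lemma L2_integrable_mult:
  fixes u v :: "real^3 \<Rightarrow> real"
  assumes "u \<in> L2 \<Omega>" "v \<in> L2 \<Omega>"
  shows "integrable (lebesgue_on \<Omega>) (\<lambda>x. u x * v x)"
proof (rule Bochner_Integration.integrable_bound)
  show "integrable (lebesgue_on \<Omega>) (\<lambda>x. (norm (u x))\<^sup>2 + (norm (v x))\<^sup>2)"
    using assms by (auto simp: L2_def)
  show "(\<lambda>x. u x * v x) \<in> borel_measurable (lebesgue_on \<Omega>)"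
    using assms by (auto simp: L2_def)
  have "\<bar>a * b\<bar> \<le> a\<^sup>2 + b\<^sup>2" for a b :: real
  proof -
    have "0 \<le> \<bar>a\<bar> * \<bar>b\<bar>" by simp
    then show ?thesis
      using sum_squares_bound[of "\<bar>a\<bar>" "\<bar>b\<bar>"] unfolding abs_mult power2_abs by linarith
  qed
  then show "AE x in lebesgue_on \<Omega>. norm (u x * v x) \<le> norm ((norm (u x))\<^sup>2 + (norm (v x))\<^sup>2)"
    by auto
qed

lemma L2_iff_integrable_square:
  fixes u :: "real^3 \<Rightarrow> real"
  shows "u \<in> L2 \<Omega> \<longleftrightarrow> u \<in> borel_measurable (lebesgue_on \<Omega>) \<and> integrable (lebesgue_on \<Omega>) (\<lambda>x. u x * u x)"
  by (simp add: L2_def power2_eq_square)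

lemma L2_measurable: "u \<in> L2 \<Omega> \<Longrightarrow> u \<in> borel_measurable (lebesgue_on \<Omega>)"
  by (simp add: L2_def)

lemma L2_zero: "(\<lambda>_. 0) \<in> L2 \<Omega>"
  by (simp add: L2_def)

lemma L2_scale:
  fixes u :: "real^3 \<Rightarrow> real"
  assumes "u \<in> L2 \<Omega>" shows "(\<lambda>x. c * u x) \<in> L2 \<Omega>"
proof -
  have "integrable (lebesgue_on \<Omega>) (\<lambda>x. (c * c) * (u x * u x))"
    using L2_integrable_mult[OF assms assms] by simp
  moreover have "(\<lambda>x. c * u x) \<in> borel_measurable (lebesgue_on \<Omega>)"
    by (intro borel_measurable_times borel_measurable_const L2_measurable assms)
  ultimately show ?thesis
    by (simp add: L2_iff_integrable_square ac_simps)
qed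

lemma L2_add:
  fixes u v :: "real^3 \<Rightarrow> real"
  assumes "u \<in> L2 \<Omega>" "v \<in> L2 \<Omega>" shows "(\<lambda>x. u x + v x) \<in> L2 \<Omega>"
proof -
  have "integrable (lebesgue_on \<Omega>) (\<lambda>x. u x * u x + v x * v x + (u x * v x + u x * v x))"
    using assms by (intro Bochner_Integration.integrable_add L2_integrable_mult)
  moreover have "(\<lambda>x. u x + v x) \<in> borel_measurable (lebesgue_on \<Omega>)"
    by (intro borel_measurable_add L2_measurable assms)
  ultimately show ?thesis
    by (simp add: L2_iff_integrable_square algebra_simps)
qed

lemma L2_diff:
  fixes u v :: "real^3 \<Rightarrow> real"
  assumes "u \<in> L2 \<Omega>" "v \<in> L2 \<Omega>" shows "(\<lambda>x. u x - v x) \<in> L2 \<Omega>"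
  using L2_add[OF assms(1) L2_scale[OF assms(2), of "-1"]] by simp

lemma L2_sum:
  fixes u :: "'i \<Rightarrow> real^3 \<Rightarrow> real"
  assumes "\<And>i. i \<in> I \<Longrightarrow> u i \<in> L2 \<Omega>" shows "(\<lambda>x. \<Sum>i\<in>I. u i x) \<in> L2 \<Omega>"
  using assms by (induction I rule: infinite_finite_induct) (auto intro: L2_add L2_zero)

lemma L2_mult_bounded:
  fixes u p :: "real^3 \<Rightarrow> real"
  assumes "u \<in> L2 \<Omega>" "p \<in> borel_measurable (lebesgue_on \<Omega>)"
    and "\<And>x. x \<in> \<Omega> \<Longrightarrow> \<bar>p x\<bar> \<le> C"
  shows "(\<lambda>x. u x * p x) \<in> L2 \<Omega>"
  unfolding L2_iff_integrable_square
proof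
  show meas: "(\<lambda>x. u x * p x) \<in> borel_measurable (lebesgue_on \<Omega>)"
    by (intro borel_measurable_times L2_measurable assms)
  show "integrable (lebesgue_on \<Omega>) (\<lambda>x. u x * p x * (u x * p x))"
  proof (rule Bochner_Integration.integrable_bound)
    show "integrable (lebesgue_on \<Omega>) (\<lambda>x. C\<^sup>2 * (u x * u x))"
      using L2_integrable_mult[OF assms(1) assms(1)] by simp
    show "(\<lambda>x. u x * p x * (u x * p x)) \<in> borel_measurable (lebesgue_on \<Omega>)"
      by (intro borel_measurable_times meas)
    have "\<bar>u x * p x * (u x * p x)\<bar> \<le> C\<^sup>2 * (u x * u x)" if "x \<in> \<Omega>" for x
    proof -
      have "(p x)\<^sup>2 \<le> C\<^sup>2"
        using assms(3)[OF that] by (meson abs_ge_zero order_trans power2_le_iff_abs_le)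
      then have "(p x)\<^sup>2 * (u x * u x) \<le> C\<^sup>2 * (u x * u x)"
        by (intro mult_right_mono) auto
      then show ?thesis
        by (simp add: power2_eq_square abs_mult ac_simps)
    qed
    then show "AE x in lebesgue_on \<Omega>. norm (u x * p x * (u x * p x)) \<le> norm (C\<^sup>2 * (u x * u x))"
      by (intro AE_I2) (auto simp: space_restrict_space)
  qed
qed

lemma L2_bounded:
  fixes p :: "real^3 \<Rightarrow> real"
  assumes "\<Omega> \<in> lmeasurable" "p \<in> borel_measurable (lebesgue_on \<Omega>)"
    and "\<And>x. x \<in> \<Omega> \<Longrightarrow> \<bar>p x\<bar> \<le> C"
  shows "p \<in> L2 \<Omega>"
proof -
  have "(\<lambda>_. 1) \<in> L2 \<Omega>"
    using assms(1) by (auto simp: L2_def finite_measure_lebesgue_on intro!: finite_measure.integrable_const)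
  from L2_mult_bounded[OF this assms(2,3)] show ?thesis by simp
qed

lemma L2_imp_integrable:
  fixes u :: "real^3 \<Rightarrow> real"
  assumes "\<Omega> \<in> lmeasurable" "u \<in> L2 \<Omega>"
  shows "integrable (lebesgue_on \<Omega>) u"
  using L2_integrable_mult[OF assms(2) L2_bounded[OF assms(1), of "\<lambda>_. 1" 1]] by simp

lemma L2_Cauchy_Schwarz:
  fixes u v :: "real^3 \<Rightarrow> real"
  assumes "u \<in> L2 \<Omega>" "v \<in> L2 \<Omega>"
  shows "\<bar>ip \<Omega> u v\<bar> \<le> sqrt (ip \<Omega> u u) * sqrt (ip \<Omega> v v)"
proof -
  define a b c where "a = ip \<Omega> u u" and "b = ip \<Omega> u v" and "c = ip \<Omega> v v"
  have ints: "integrable (lebesgue_on \<Omega>) (\<lambda>x. u x * u x)" "integrable (lebesgue_on \<Omega>) (\<lambda>x. u x * v x)"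
    "integrable (lebesgue_on \<Omega>) (\<lambda>x. v x * v x)"
    using assms by (auto intro: L2_integrable_mult)
  have quad: "0 \<le> a * s\<^sup>2 + 2 * b * s * t + c * t\<^sup>2" for s t
  proof -
    have "0 \<le> (LINT x|lebesgue_on \<Omega>. (s * u x + t * v x) * (s * u x + t * v x))"
      by (intro Bochner_Integration.integral_nonneg) auto
    also have "\<dots> = (LINT x|lebesgue_on \<Omega>. s\<^sup>2 * (u x * u x) + (2 * s * t) * (u x * v x) + t\<^sup>2 * (v x * v x))"
      by (intro Bochner_Integration.integral_cong) (auto simp: power2_eq_square algebra_simps)
    also have "\<dots> = a * s\<^sup>2 + 2 * b * s * t + c * t\<^sup>2"
      using ints by (simp add: a_def b_def c_def ip_def)
    finally show ?thesis .
  qed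
  have nn: "0 \<le> a" "0 \<le> c"
    by (auto simp: a_def c_def ip_def intro!: Bochner_Integration.integral_nonneg)
  have "b\<^sup>2 \<le> a * c"
  proof (cases "c = 0")
    case True
    have "b = 0"
    proof (rule ccontr)
      assume "b \<noteq> 0"
      have "0 \<le> a * 1\<^sup>2 + 2 * b * 1 * (- (a + 1) / (2 * b)) + c * (- (a + 1) / (2 * b))\<^sup>2"
        by (rule quad)
      then show False using True \<open>b \<noteq> 0\<close> by simp
    qed
    then show ?thesis using nn by simp
  next
    case False
    then have "0 < c" using nn by simp
    have "0 \<le> c * (a * c - b\<^sup>2)"
      using quad[of c "- b"] by (simp add: power2_eq_square algebra_simps)
    then show ?thesis using \<open>0 < c\<close> by (simp add: zero_le_mult_iff)
  qed
  then have "sqrt (b\<^sup>2) \<le> sqrt (a * c)" by (rule real_sqrt_le_mono)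
  then show ?thesis by (simp add: a_def b_def c_def real_sqrt_mult)
qed

section \<open>Continuously differentiable functions and test functions\<close>

definition C1 :: "(real^3 \<Rightarrow> real) set" where
  "C1 = {p. (\<forall>x. p differentiable (at x)) \<and> (\<forall>j. continuous_on UNIV (partial j p))}"

lemma C1c_iff: "\<psi> \<in> C1c \<Omega> \<longleftrightarrow>
   \<psi> \<in> C1 \<and> bounded {x. \<psi> x \<noteq> 0} \<and> closure {x. \<psi> x \<noteq> 0} \<subseteq> \<Omega>"
  by (auto simp: C1c_def C1_def)

lemma partial_eq:
  assumes "(\<psi> has_derivative D) (at x)" shows "partial j \<psi> x = D (axis j 1)"
  using frechet_derivative_at[OF assms] by (simp add: partial_def)

lemma has_derivative_partial:
  assumes "p \<in> C1"
  shows "(p has_derivative (\<lambda>h. \<Sum>j\<in>UNIV. h $ j * partial j p x)) (at x)"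
proof -
  obtain D where D: "(p has_derivative D) (at x)"
    using assms by (auto simp: C1_def differentiable_def)
  interpret D: bounded_linear D using D by (rule has_derivative_bounded_linear)
  have "D h = (\<Sum>j\<in>UNIV. h $ j * partial j p x)" for h
  proof -
    have "D h = D (\<Sum>j\<in>UNIV. h $ j *\<^sub>R axis j 1)"
      using basis_expansion[of h] by (simp add: scalar_mult_eq_scaleR)
    also have "\<dots> = (\<Sum>j\<in>UNIV. h $ j * D (axis j 1))"
      by (simp add: D.sum D.scaleR)
    finally show ?thesis by (simp add: partial_eq[OF D])
  qed
  then have "D = (\<lambda>h. \<Sum>j\<in>UNIV. h $ j * partial j p x)" by auto
  with D show ?thesis by simp
qed

lemma C1_I:
  assumes "\<And>x. (p has_derivative D x) (at x)" "\<And>j. continuous_on UNIV (\<lambda>x. D x (axis j 1))"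
  shows "p \<in> C1"
proof -
  have "partial j p = (\<lambda>x. D x (axis j 1))" for j
    using partial_eq[OF assms(1)] by auto
  then show ?thesis using assms by (auto simp: C1_def differentiable_def)
qed

lemma C1_continuous: "p \<in> C1 \<Longrightarrow> continuous_on S p"
  by (auto simp: C1_def intro!: continuous_at_imp_continuous_on differentiable_imp_continuous_within)

lemma C1_partial_continuous: "p \<in> C1 \<Longrightarrow> continuous_on S (partial j p)"
  by (auto simp: C1_def intro: continuous_on_subset)

lemma
  assumes "p \<in> C1" "q \<in> C1"
  shows C1_mult: "(\<lambda>x. p x * q x) \<in> C1"
    and partial_mult: "partial j (\<lambda>x. p x * q x) x = p x * partial j q x + partial j p x * q x"
    and C1_add: "(\<lambda>x. p x + q x) \<in> C1"
proof -
  note D = has_derivative_partial[OF assms(1)] has_derivative_partial[OF assms(2)]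
  note cont = C1_continuous[OF assms(1)] C1_continuous[OF assms(2)]
    C1_partial_continuous[OF assms(1)] C1_partial_continuous[OF assms(2)]
  show "(\<lambda>x. p x * q x) \<in> C1"
    by (rule C1_I[OF has_derivative_mult[OF D]]) (intro continuous_intros cont)
  show "(\<lambda>x. p x + q x) \<in> C1"
    by (rule C1_I[OF has_derivative_add[OF D]]) (intro continuous_intros cont)
  have pd: "partial j p x = (\<Sum>k\<in>UNIV. axis j 1 $ k * partial k p x)"
    "partial j q x = (\<Sum>k\<in>UNIV. axis j 1 $ k * partial k q x)"
    using partial_eq[OF D(1)] partial_eq[OF D(2)] by blast+
  show "partial j (\<lambda>x. p x * q x) x = p x * partial j q x + partial j p x * q x"
    by (subst partial_eq[OF has_derivative_mult[OF D]]) (simp add: pd[symmetric])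
qed

lemma partial_const: "partial j (\<lambda>_. c) x = 0"
  using partial_eq[OF has_derivative_const[of c "at x"]] by simp

lemma C1_const: "(\<lambda>_. c) \<in> C1"
  by (rule C1_I[OF has_derivative_const]) simp

lemma
  fixes a :: "real^3"
  shows C1_affine: "(\<lambda>x. a \<bullet> x + b) \<in> C1"
    and partial_affine: "partial j (\<lambda>x. a \<bullet> x + b) x = a $ j"
proof -
  have D: "((\<lambda>x. a \<bullet> x + b) has_derivative (\<lambda>h. a \<bullet> h)) (at x)" for x
    by (auto intro!: derivative_eq_intros)
  show "(\<lambda>x. a \<bullet> x + b) \<in> C1" by (rule C1_I[OF D]) simp
  show "partial j (\<lambda>x. a \<bullet> x + b) x = a $ j"
    by (simp add: partial_eq[OF D] cart_eq_inner_axis)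
qed

lemma C1c_C1: "\<psi> \<in> C1c \<Omega> \<Longrightarrow> \<psi> \<in> C1" by (simp add: C1c_iff)

lemma C1c_subset:
  assumes "\<phi> \<in> C1c \<Omega>" "\<psi> \<in> C1" "\<And>x. \<psi> x \<noteq> 0 \<Longrightarrow> \<phi> x \<noteq> 0"
  shows "\<psi> \<in> C1c \<Omega>"
proof -
  have "{x. \<psi> x \<noteq> 0} \<subseteq> {x. \<phi> x \<noteq> 0}" using assms(3) by auto
  then show ?thesis using assms(1,2) closure_mono[of "{x. \<psi> x \<noteq> 0}" "{x. \<phi> x \<noteq> 0}"]
    by (auto simp: C1c_iff intro: bounded_subset)
qed

lemma C1c_mult: "\<lbrakk>\<phi> \<in> C1c \<Omega>; p \<in> C1\<rbrakk> \<Longrightarrow> (\<lambda>x. p x * \<phi> x) \<in> C1c \<Omega>"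
  by (rule C1c_subset[of \<phi>]) (auto intro: C1_mult C1c_C1)

lemma C1c_zero: "(\<lambda>_. 0) \<in> C1c \<Omega>"
  by (auto simp: C1c_iff C1_const)

lemma C1c_scale: "\<phi> \<in> C1c \<Omega> \<Longrightarrow> (\<lambda>x. c * \<phi> x) \<in> C1c \<Omega>"
  by (rule C1c_mult[OF _ C1_const])

lemma C1c_add:
  assumes "\<phi> \<in> C1c \<Omega>" "\<psi> \<in> C1c \<Omega>" shows "(\<lambda>x. \<phi> x + \<psi> x) \<in> C1c \<Omega>"
proof -
  have sub: "{x. \<phi> x + \<psi> x \<noteq> 0} \<subseteq> {x. \<phi> x \<noteq> 0} \<union> {x. \<psi> x \<noteq> 0}" by auto
  from closure_mono[OF this] have "closure {x. \<phi> x + \<psi> x \<noteq> 0} \<subseteq> \<Omega>"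
    using assms by (auto simp: C1c_iff)
  moreover have "bounded {x. \<phi> x + \<psi> x \<noteq> 0}"
    using sub assms by (auto simp: C1c_iff intro: bounded_subset[OF bounded_Un[THEN iffD2]])
  ultimately show ?thesis using assms by (auto simp: C1c_iff intro: C1_add)
qed

lemma partial_eq_on_open:
  assumes "open U" "x \<in> U" "\<And>y. y \<in> U \<Longrightarrow> \<phi> y = \<psi> y" "\<psi> differentiable (at x)"
  shows "partial j \<phi> x = partial j \<psi> x"
proof -
  obtain D where D: "(\<psi> has_derivative D) (at x)" using assms(4) by (auto simp: differentiable_def)
  have "(\<phi> has_derivative D) (at x)"
    by (rule has_derivative_transform_within_open[OF D assms(1,2)]) (simp add: assms(3))
  then show ?thesis using D by (simp add: partial_eq)
qed

lemma C1c_partial_zero_outside: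
  assumes "x \<notin> closure {x. \<psi> x \<noteq> 0}" shows "partial j \<psi> x = 0"
proof -
  have "partial j \<psi> x = partial j (\<lambda>_. 0) x"
  proof (rule partial_eq_on_open[of "- closure {x. \<psi> x \<noteq> 0}"])
    show "\<psi> y = 0" if "y \<in> - closure {x. \<psi> x \<noteq> 0}" for y
      using that closure_subset[of "{x. \<psi> x \<noteq> 0}"] by auto
  qed (use assms in auto)
  then show ?thesis by (simp add: partial_const)
qed

lemma C1c_bounded:
  assumes "\<psi> \<in> C1c \<Omega>"
  shows "\<exists>C. \<forall>x. \<bar>\<psi> x\<bar> \<le> C" "\<exists>C. \<forall>x. \<bar>partial j \<psi> x\<bar> \<le> C"
proof -
  let ?S = "closure {x. \<psi> x \<noteq> 0}"
  have S: "compact ?S" using assms by (auto simp: C1c_def)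
  have *: "\<exists>C. \<forall>x. \<bar>g x\<bar> \<le> C" if "continuous_on UNIV g" "\<And>x. x \<notin> ?S \<Longrightarrow> g x = 0" for g :: "real^3 \<Rightarrow> real"
  proof -
    have "bounded (g ` ?S)"
      by (intro compact_imp_bounded compact_continuous_image S continuous_on_subset[OF that(1)]) auto
    then obtain C where "\<And>x. x \<in> ?S \<Longrightarrow> \<bar>g x\<bar> \<le> C" by (auto simp: bounded_iff)
    then have "\<bar>g x\<bar> \<le> max C 0" for x using that(2)[of x] by (cases "x \<in> ?S") fastforce+
    then show ?thesis by blast
  qed
  show "\<exists>C. \<forall>x. \<bar>\<psi> x\<bar> \<le> C"
    using closure_subset[of "{x. \<psi> x \<noteq> 0}"] by (intro * C1_continuous C1c_C1[OF assms]) auto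
  show "\<exists>C. \<forall>x. \<bar>partial j \<psi> x\<bar> \<le> C"
    using C1c_partial_zero_outside
    by (intro * C1_partial_continuous C1c_C1[OF assms]) blast
qed

section \<open>Integration by parts against a test function\<close>

lemma C1_line_derivative:
  assumes "p \<in> C1"
  shows "((\<lambda>t. p (x + t *\<^sub>R axis j 1)) has_real_derivative partial j p (x + t *\<^sub>R axis j 1)) (at t)"
proof -
  have line: "((\<lambda>t. x + t *\<^sub>R axis j 1) has_derivative (\<lambda>s. s *\<^sub>R axis j 1)) (at t)"
    by (auto intro!: derivative_eq_intros)
  have eq: "(\<Sum>k\<in>UNIV. (s *\<^sub>R axis j 1) $ k * partial k p y) = s * partial j p y" for s y
  proof -
    have "(\<Sum>k\<in>UNIV. (s *\<^sub>R axis j 1) $ k * partial k p y) = (\<Sum>k\<in>UNIV. if k = j then s * partial k p y else 0)"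
      by (intro sum.cong) (auto simp: axis_def)
    then show ?thesis by simp
  qed
  show ?thesis
    using has_derivative_compose[OF line has_derivative_partial[OF assms]]
    unfolding has_field_derivative_def eq by (simp add: mult.commute[of _ "partial j p _"])
qed

lemma integrable_continuous_bounded_support:
  fixes f :: "real^3 \<Rightarrow> real"
  assumes "continuous_on UNIV f" "bounded {x. f x \<noteq> 0}"
  shows "integrable lborel f"
proof -
  have "integrable lborel (\<lambda>x. indicator (closure {x. f x \<noteq> 0}) x *\<^sub>R f x)"
    using assms by (intro borel_integrable_compact) (auto intro: continuous_on_subset)
  moreover have "(\<lambda>x. indicator (closure {x. f x \<noteq> 0}) x *\<^sub>R f x) = f"
    using closure_subset[of "{x. f x \<noteq> 0}"] by (auto simp: indicator_def fun_eq_iff)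
  ultimately show ?thesis by simp
qed

lemma lborel_integral_translate:
  fixes f :: "real^3 \<Rightarrow> real"
  assumes "f \<in> borel_measurable borel"
  shows "(LINT x|lborel. f (c + x)) = (LINT x|lborel. f x)"
proof -
  have "(LINT x|lborel. f x) = (LINT x|distr lborel borel ((+) c). f x)"
    by (simp add: lborel_distr_plus)
  also have "\<dots> = (LINT x|lborel. f (c + x))"
    using assms by (subst integral_distr) auto
  finally show ?thesis ..
qed

text \<open>
  A difference quotient of \<open>\<psi>\<close> has integral zero because Lebesgue measure is translation invariant;
  the quotients are bounded by a constant on one fixed ball, so the limit passes under the integral.
\<close>

lemma integral_partial_C1c:
  assumes "\<psi> \<in> C1c \<Omega>"
  shows "(LINT x|lebesgue. partial j \<psi> x) = 0"
proof -
  let ?e = "axis j 1 :: real^3"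
  note C1 = C1c_C1[OF assms]
  obtain C where C: "\<And>x. \<bar>partial j \<psi> x\<bar> \<le> C" using C1c_bounded(2)[OF assms] by blast
  obtain R where R: "\<And>x. \<psi> x \<noteq> 0 \<Longrightarrow> norm x \<le> R"
    using assms by (auto simp: C1c_iff bounded_iff)
  define f where "f n x = (\<psi> (x + (1 / Suc n) *\<^sub>R ?e) - \<psi> x) * Suc n" for n :: nat and x
  have bcont: "\<psi> \<in> borel_measurable borel" "partial j \<psi> \<in> borel_measurable borel"
    using C1_continuous[OF C1] C1_partial_continuous[OF C1] by (auto intro: borel_measurable_continuous_onI)
  have int: "integrable lborel \<psi>"
    using assms by (intro integrable_continuous_bounded_support C1_continuous C1) (auto simp: C1c_iff)
  have "(\<lambda>n. LINT x|lborel. f n x) \<longlonglongrightarrow> (LINT x|lborel. partial j \<psi> x)"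
  proof (rule integral_dominated_convergence)
    show "integrable lborel (\<lambda>x. indicat_real (cball 0 (R + 1)) x *\<^sub>R C)"
      by (rule borel_integrable_compact) auto
    show "AE x in lborel. (\<lambda>n. f n x) \<longlonglongrightarrow> partial j \<psi> x"
    proof (intro AE_I2)
      fix x
      have "((\<lambda>h. (\<psi> (x + (0 + h) *\<^sub>R ?e) - \<psi> (x + 0 *\<^sub>R ?e)) / h) \<longlongrightarrow> partial j \<psi> (x + 0 *\<^sub>R ?e)) (at 0)"
        using C1_line_derivative[OF C1, of x j 0] unfolding DERIV_def .
      then have *: "((\<lambda>h. (\<psi> (x + h *\<^sub>R ?e) - \<psi> x) / h) \<longlongrightarrow> partial j \<psi> x) (at 0)" by simp
      have "filterlim (\<lambda>n. 1 / real (Suc n)) (at 0) sequentially"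
        using LIMSEQ_inverse_real_of_nat by (auto simp: filterlim_at inverse_eq_divide)
      from filterlim_compose[OF * this]
      show "(\<lambda>n. f n x) \<longlonglongrightarrow> partial j \<psi> x"
        by (simp add: f_def)
    qed
    show "AE x in lborel. norm (f n x) \<le> indicat_real (cball 0 (R + 1)) x *\<^sub>R C" for n
    proof (intro AE_I2)
      fix x
      define s where "s = 1 / real (Suc n)"
      have s: "0 < s" "s \<le> 1" by (auto simp: s_def)
      show "norm (f n x) \<le> indicat_real (cball 0 (R + 1)) x *\<^sub>R C"
      proof (cases "x \<in> cball 0 (R + 1)")
        case True
        obtain z where "0 < z" "z < s" and
          "\<psi> (x + s *\<^sub>R ?e) - \<psi> (x + 0 *\<^sub>R ?e) = (s - 0) * partial j \<psi> (x + z *\<^sub>R ?e)"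
          using MVT2[OF s(1), of "\<lambda>t. \<psi> (x + t *\<^sub>R ?e)" "\<lambda>t. partial j \<psi> (x + t *\<^sub>R ?e)"]
            C1_line_derivative[OF C1] by blast
        then have "f n x = partial j \<psi> (x + z *\<^sub>R ?e)"
          by (simp add: f_def s_def[symmetric]) (simp add: s_def)
        then show ?thesis using True C by simp
      next
        case False
        have "norm x \<le> norm (x + s *\<^sub>R ?e) + norm (s *\<^sub>R ?e)"
          by (metis add_diff_cancel_right' norm_triangle_ineq4)
        then have "norm x \<le> norm (x + s *\<^sub>R ?e) + 1" using s by simp
        then have "\<psi> (x + s *\<^sub>R ?e) = 0" "\<psi> x = 0"
          using False R[of x] R[of "x + s *\<^sub>R ?e"] by auto
        then show ?thesis using False by (simp add: f_def s_def)
      qed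
    qed
    show "f n \<in> borel_measurable lborel" for n
      unfolding f_def using bcont by measurable
    show "partial j \<psi> \<in> borel_measurable lborel" using bcont by simp
  qed
  moreover have "(LINT x|lborel. f n x) = 0" for n
  proof -
    let ?c = "(1 / Suc n) *\<^sub>R ?e"
    have tr: "(LINT x|lborel. \<psi> (x + ?c)) = (LINT x|lborel. \<psi> x)"
      using lborel_integral_translate[OF bcont(1), of ?c] by (simp add: add.commute)
    have "integrable lborel (\<lambda>x. \<psi> (x + ?c))"
    proof (intro integrable_continuous_bounded_support)
      show "continuous_on UNIV (\<lambda>x. \<psi> (x + ?c))"
        by (intro continuous_on_compose2[OF C1_continuous[OF C1, of UNIV]] continuous_intros) auto
      have "norm x \<le> R + norm ?c" if "\<psi> (x + ?c) \<noteq> 0" for x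
        using R[OF that] norm_triangle_ineq4[of "x + ?c" ?c] by simp
      then show "bounded {x. \<psi> (x + ?c) \<noteq> 0}" unfolding bounded_iff by blast
    qed
    then show ?thesis using int tr unfolding f_def by simp
  qed
  ultimately have "(\<lambda>n. 0) \<longlonglongrightarrow> (LINT x|lborel. partial j \<psi> x)" by simp
  then have "(LINT x|lborel. partial j \<psi> x) = 0"
    by (simp add: LIMSEQ_const_iff)
  then show ?thesis using bcont by (simp add: integral_completion)
qed

locale bounded_open =
  fixes \<Omega> :: "(real^3) set"
  assumes open_dom: "open \<Omega>" and bounded_dom: "bounded \<Omega>"
begin

lemma dom_lmeasurable: "\<Omega> \<in> lmeasurable"
  using open_dom bounded_dom lmeasurable_open by blast

lemma dom_sets: "\<Omega> \<in> sets lebesgue"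
  using dom_lmeasurable by blast

lemma continuous_measurable:
  fixes f :: "real^3 \<Rightarrow> real"
  shows "continuous_on UNIV f \<Longrightarrow> f \<in> borel_measurable (lebesgue_on \<Omega>)"
  using continuous_imp_measurable_on_sets_lebesgue[OF _ dom_sets] continuous_on_subset by blast

lemma continuous_bounded:
  fixes f :: "real^3 \<Rightarrow> real"
  assumes "continuous_on UNIV f" shows "\<exists>C. \<forall>x\<in>\<Omega>. \<bar>f x\<bar> \<le> C"
proof -
  have "bounded (f ` closure \<Omega>)"
    using bounded_dom assms
    by (intro compact_imp_bounded compact_continuous_image) (auto intro: continuous_on_subset)
  then show ?thesis using closure_subset by (fastforce simp: bounded_iff)
qed

lemma L2_mult_continuous:
  fixes f u :: "real^3 \<Rightarrow> real"
  assumes "u \<in> L2 \<Omega>" "continuous_on UNIV f" shows "(\<lambda>x. u x * f x) \<in> L2 \<Omega>"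
  using continuous_bounded[OF assms(2)] L2_mult_bounded[OF assms(1) continuous_measurable[OF assms(2)]] by blast

lemma continuous_L2:
  fixes f :: "real^3 \<Rightarrow> real"
  assumes "continuous_on UNIV f" shows "f \<in> L2 \<Omega>"
  using continuous_bounded[OF assms] L2_bounded[OF dom_lmeasurable continuous_measurable[OF assms]] by blast

lemma C1_L2: "p \<in> C1 \<Longrightarrow> p \<in> L2 \<Omega>" "p \<in> C1 \<Longrightarrow> partial j p \<in> L2 \<Omega>"
  using C1_continuous C1_partial_continuous continuous_L2 by blast+

lemma integral_C1c_partial:
  assumes "\<psi> \<in> C1c \<Omega>" shows "(LINT x|lebesgue_on \<Omega>. partial j \<psi> x) = 0"
proof -
  have "partial j \<psi> x = 0" if "x \<notin> \<Omega>" for x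
    using assms that by (intro C1c_partial_zero_outside) (auto simp: C1c_iff)
  then have "(\<lambda>x. if x \<in> \<Omega> then partial j \<psi> x else 0) = partial j \<psi>" by auto
  then show ?thesis
    using integral_partial_C1c[OF assms, of j] Lebesgue_Measure.integral_restrict_UNIV[OF dom_sets, of "partial j \<psi>"] by simp
qed

text \<open>
  The test function localises: \<open>p \<psi>\<close> is itself a test function whatever \<open>p\<close> does at the boundary.
\<close>

lemma C1_has_wpartial:
  assumes "p \<in> C1" shows "has_wpartial \<Omega> j p (partial j p)"
  unfolding has_wpartial_def
proof
  fix \<psi> assume \<psi>: "\<psi> \<in> C1c \<Omega>"
  note ints = L2_integrable_mult[OF C1_L2(1)[OF assms] C1_L2(2)[OF C1c_C1[OF \<psi>]]]
    L2_integrable_mult[OF C1_L2(2)[OF assms] C1_L2(1)[OF C1c_C1[OF \<psi>]]]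
  have "0 = (LINT x|lebesgue_on \<Omega>. partial j (\<lambda>x. p x * \<psi> x) x)"
    using integral_C1c_partial[OF C1c_mult[OF \<psi> assms], of j] by simp
  also have "\<dots> = (LINT x|lebesgue_on \<Omega>. p x * partial j \<psi> x + partial j p x * \<psi> x)"
    by (simp add: partial_mult[OF assms C1c_C1[OF \<psi>]])
  also have "\<dots> = ip \<Omega> p (partial j \<psi>) + ip \<Omega> (partial j p) \<psi>"
    using ints by (simp add: ip_def)
  finally show "ip \<Omega> p (partial j \<psi>) = - ip \<Omega> (partial j p) \<psi>" by simp
qed

end

section \<open>Mollification\<close>

lemma has_derivative_max_square:
  "((\<lambda>r::real. (max 0 r)\<^sup>2) has_real_derivative 2 * max 0 r) (at r)"
proof (cases r "0::real" rule: linorder_cases)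
  case less
  have "((\<lambda>r::real. 0) has_real_derivative 2 * max 0 r) (at r)" using less by simp
  then show ?thesis
    by (rule has_field_derivative_transform_within_open[where S="{..<0}"]) (use less in auto)
next
  case equal
  have "((\<lambda>h::real. (max 0 h)\<^sup>2 / h) \<longlongrightarrow> 0) (at 0)"
  proof (rule Lim_null_comparison)
    show "\<forall>\<^sub>F h in at 0. norm ((max 0 h)\<^sup>2 / h) \<le> norm (h::real)"
      by (intro always_eventually allI) (auto simp: max_def power2_eq_square)
    show "((\<lambda>h::real. norm h) \<longlongrightarrow> 0) (at 0)" by (auto intro!: tendsto_eq_intros)
  qed
  then show ?thesis using equal by (simp add: DERIV_def)
next
  case greater
  have "((\<lambda>r::real. r\<^sup>2) has_real_derivative 2 * max 0 r) (at r)"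
    using greater by (auto intro!: derivative_eq_intros)
  then show ?thesis
    by (rule has_field_derivative_transform_within_open[where S="{0<..}"]) (use greater in auto)
qed

text \<open>
  The kernel is a normalised \<open>(max 0 (\<delta>\<^sup>2 - \<bar>y\<bar>\<^sup>2))\<^sup>2\<close>. The square makes it \<open>C\<^sup>1\<close> across the sphere of
  radius \<open>\<delta>\<close>, and one derivative is all that mollification into \<open>C\<^sup>1\<close> requires.
\<close>

lemma bump_exists:
  fixes \<delta> :: real
  assumes "\<delta> > 0"
  obtains \<eta> :: "real^3 \<Rightarrow> real" and G :: "real^3 \<Rightarrow> real^3" where
    "\<And>y. 0 \<le> \<eta> y" "\<And>y. \<eta> y \<noteq> 0 \<Longrightarrow> norm y < \<delta>" "(LINT y|lborel. \<eta> y) = 1"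
    "\<And>y. (\<eta> has_derivative (\<lambda>h. G y \<bullet> h)) (at y)" "continuous_on UNIV G"
proof -
  define \<theta> where "\<theta> y = (max 0 (\<delta>\<^sup>2 - y \<bullet> y))\<^sup>2" for y :: "real^3"
  define G where "G y = - (4 * max 0 (\<delta>\<^sup>2 - y \<bullet> y)) *\<^sub>R y" for y :: "real^3"
  have D: "(\<theta> has_derivative (\<lambda>h. G y \<bullet> h)) (at y)" for y
  proof -
    have 1: "((\<lambda>y. \<delta>\<^sup>2 - y \<bullet> y) has_derivative (\<lambda>h. - (2 * (y \<bullet> h)))) (at y)"
      by (auto intro!: derivative_eq_intros simp: inner_commute)
    show ?thesis
      using has_derivative_compose[OF 1 has_derivative_max_square[unfolded has_field_derivative_def]]
      by (simp add: \<theta>_def[abs_def] G_def mult.assoc)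
  qed
  have cont: "continuous_on UNIV \<theta>"
    unfolding \<theta>_def by (intro continuous_intros)
  have supp: "norm y < \<delta>" if "\<theta> y \<noteq> 0" for y
  proof -
    have "y \<bullet> y < \<delta>\<^sup>2" using that by (auto simp: \<theta>_def max_def split: if_splits)
    then show ?thesis
      using assms by (simp add: power2_norm_eq_inner[symmetric] power2_less_imp_less)
  qed
  have int: "integrable lborel \<theta>"
    using supp by (intro integrable_continuous_bounded_support[OF cont]) (auto simp: bounded_iff intro: less_imp_le)
  define c where "c = (LINT y|lborel. \<theta> y)"
  have "c > 0"
  proof -
    have "c \<noteq> 0"
    proof
      assume "c = 0"
      then have "AE y in lborel. \<theta> y = 0"
        unfolding c_def using int by (subst (asm) integral_nonneg_eq_0_iff_AE) (auto simp: \<theta>_def)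
      then have "AE y in lborel. y \<notin> ball (0::real^3) \<delta>"
      proof eventually_elim
        case (elim y)
        show ?case
        proof
          assume "y \<in> ball 0 \<delta>"
          then have "(norm y)\<^sup>2 < \<delta>\<^sup>2" using assms by (intro power_strict_mono) auto
          then show False using elim by (simp add: \<theta>_def power2_norm_eq_inner)
        qed
      qed
      then have "emeasure lborel (ball (0::real^3) \<delta>) = 0"
        by (subst (asm) AE_iff_measurable[OF _ refl]) (auto simp: ball_def)
      then have "negligible (ball (0::real^3) \<delta>)"
        by (simp add: negligible_iff_null_sets null_sets_def)
      then show False using assms by (simp add: open_not_negligible)
    qed
    moreover have "c \<ge> 0" unfolding c_def by (intro Bochner_Integration.integral_nonneg) (simp add: \<theta>_def)
    ultimately show ?thesis by simp
  qed
  show ?thesis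
  proof (rule that[of "\<lambda>y. \<theta> y / c" "\<lambda>y. (1 / c) *\<^sub>R G y"])
    show "0 \<le> \<theta> y / c" for y using \<open>c > 0\<close> by (simp add: \<theta>_def)
    show "norm y < \<delta>" if "\<theta> y / c \<noteq> 0" for y using supp that by auto
    show "(LINT y|lborel. \<theta> y / c) = 1" using \<open>c > 0\<close> by (simp add: c_def[symmetric])
    show "((\<lambda>y. \<theta> y / c) has_derivative (\<lambda>h. (1 / c) *\<^sub>R G y \<bullet> h)) (at y)" for y
      using has_derivative_scaleR_right[OF D, of "1/c"] by simp
    show "continuous_on UNIV (\<lambda>y. (1 / c) *\<^sub>R G y)"
      unfolding G_def by (intro continuous_intros)
  qed
qed

lemma C1_partial_lipschitz_bound:
  assumes w: "w \<in> C1" and L: "L-lipschitz_on UNIV w"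
  shows "\<bar>partial j w x\<bar> \<le> L"
proof -
  let ?e = "axis j 1 :: real^3"
  have "((\<lambda>h. (w (x + (0 + h) *\<^sub>R ?e) - w (x + 0 *\<^sub>R ?e)) / h) \<longlongrightarrow> partial j w (x + 0 *\<^sub>R ?e)) (at 0)"
    using C1_line_derivative[OF w, of x j 0] unfolding DERIV_def .
  then have *: "((\<lambda>h. (w (x + h *\<^sub>R ?e) - w x) / h) \<longlongrightarrow> partial j w x) (at 0)" by simp
  have "norm ((w (x + h *\<^sub>R ?e) - w x) / h) \<le> L" if "h \<noteq> 0" for h
  proof -
    have "\<bar>w (x + h *\<^sub>R ?e) - w x\<bar> \<le> L * \<bar>h\<bar>"
      using lipschitz_onD[OF L, of "x + h *\<^sub>R ?e" x] by (simp add: dist_norm)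
    then show ?thesis using that by (simp add: field_simps)
  qed
  then have "\<forall>\<^sub>F h in at 0. norm ((w (x + h *\<^sub>R ?e) - w x) / h) \<le> L"
    by (auto simp: eventually_at_filter)
  from Lim_norm_ubound[OF _ * this] show ?thesis by simp
qed

lemma integral_lborel_cbox:
  fixes f :: "real^3 \<Rightarrow> real"
  assumes "continuous_on UNIV f" "\<And>x. f x \<noteq> 0 \<Longrightarrow> x \<in> cbox a b"
  shows "(LINT x|lborel. f x) = integral (cbox a b) f"
proof -
  have "integrable lborel f"
    by (intro integrable_continuous_bounded_support[OF assms(1)] bounded_subset[OF bounded_cbox[of a b]])
       (use assms(2) in auto)
  then have "(f has_integral (LINT x|lborel. f x)) UNIV" by (rule has_integral_integral_lborel)
  moreover have "(\<lambda>x. if x \<in> cbox a b then f x else 0) = f" using assms(2) by (auto simp: fun_eq_iff)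
  ultimately have "(f has_integral (LINT x|lborel. f x)) (cbox a b)"
    using has_integral_restrict_UNIV[of "cbox a b" f] by simp
  then show ?thesis by (simp add: integral_unique)
qed

text \<open>
  Convolution with the kernel, in two guises. Written as \<open>\<integral> u (x + y) \<eta> y dy\<close> it is an average of
  translates of \<open>u\<close>, so it inherits the Lipschitz constant, which bounds its derivatives, and it
  reproduces the slope of \<open>u\<close> wherever \<open>u\<close> is affine on a ball larger than the kernel. Written as
  \<open>\<integral> u t \<eta> (t - x) dt\<close> it can be differentiated in \<open>x\<close> under the integral.
\<close>

lemma mollify:
  fixes u :: "real^3 \<Rightarrow> real"
  assumes L: "L-lipschitz_on UNIV u" and supp: "bounded {x. u x \<noteq> 0}" and "\<delta> > 0"
  obtains w where "w \<in> C1" "\<And>x. \<bar>w x - u x\<bar> \<le> L * \<delta>" "\<And>x j. \<bar>partial j w x\<bar> \<le> L"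
    "\<And>x g r j. \<lbrakk>\<delta> < r; \<And>y. y \<in> ball x r \<Longrightarrow> u y = u x + g \<bullet> (y - x)\<rbrakk> \<Longrightarrow> partial j w x = g $ j"
    "\<And>x. w x \<noteq> 0 \<Longrightarrow> \<exists>y\<in>ball x \<delta>. u y \<noteq> 0"
proof -
  have cont: "continuous_on UNIV u" using lipschitz_on_continuous_on[OF L] .
  obtain \<eta> :: "real^3 \<Rightarrow> real" and G where \<eta>: "\<And>y. 0 \<le> \<eta> y" "\<And>y. \<eta> y \<noteq> 0 \<Longrightarrow> norm y < \<delta>" "(LINT y|lborel. \<eta> y) = 1"
    "\<And>y. (\<eta> has_derivative (\<lambda>h. G y \<bullet> h)) (at y)" "continuous_on UNIV G"
    by (rule bump_exists[OF \<open>\<delta> > 0\<close>]) (rule that)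
  have \<eta>_cont: "continuous_on UNIV \<eta>"
    using \<eta>(4) by (meson continuous_at_imp_continuous_on has_derivative_continuous)
  have \<eta>_bdd: "bounded {y. f y * \<eta> y \<noteq> 0}" for f :: "real^3 \<Rightarrow> real"
    by (rule bounded_subset[of "ball 0 \<delta>"]) (use \<eta>(2) in auto)
  have int\<eta>: "integrable lborel (\<lambda>y. f y * \<eta> y)" if "continuous_on UNIV f" for f
    by (rule integrable_continuous_bounded_support[OF _ \<eta>_bdd]) (intro continuous_intros that \<eta>_cont)
  have shift_cont: "continuous_on UNIV (\<lambda>y. u (x + y))" for x
    by (intro continuous_on_compose2[OF cont] continuous_intros) auto
  define w where "w x = (LINT y|lborel. u (x + y) * \<eta> y)" for x
  have w_bound: "\<bar>w x - c\<bar> \<le> K" if "\<And>y. \<eta> y \<noteq> 0 \<Longrightarrow> \<bar>u (x + y) - c\<bar> \<le> K" for x c K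
  proof -
    have "w x - c = (LINT y|lborel. u (x + y) * \<eta> y - c * \<eta> y)"
      using int\<eta>[OF shift_cont] int\<eta>[of "\<lambda>_. c"] \<eta>(3) by (simp add: w_def)
    also have "\<dots> = (LINT y|lborel. (u (x + y) - c) * \<eta> y)" by (simp add: algebra_simps)
    also have "\<bar>\<dots>\<bar> \<le> (LINT y|lborel. K * \<eta> y)"
      unfolding real_norm_def[symmetric]
    proof (rule Bochner_Integration.integral_norm_bound_integral)
      show "integrable lborel (\<lambda>y. (u (x + y) - c) * \<eta> y)"
        by (intro int\<eta> continuous_intros shift_cont)
      show "integrable lborel (\<lambda>y. K * \<eta> y)" by (intro int\<eta> continuous_intros)
      show "norm ((u (x + y) - c) * \<eta> y) \<le> K * \<eta> y" for y
        using that[of y] \<eta>(1)[of y] by (cases "\<eta> y = 0") (auto simp: abs_mult intro: mult_right_mono)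
    qed
    also have "\<dots> = K" using \<eta>(3) by simp
    finally show ?thesis .
  qed
  have close: "\<bar>w x - u x\<bar> \<le> L * \<delta>" for x
  proof (rule w_bound)
    fix y assume "\<eta> y \<noteq> 0"
    then have "norm y \<le> \<delta>" using \<eta>(2) by (auto intro: less_imp_le)
    moreover have "\<bar>u (x + y) - u x\<bar> \<le> L * norm y"
      using lipschitz_onD[OF L, of "x + y" x] by (simp add: dist_norm)
    ultimately show "\<bar>u (x + y) - u x\<bar> \<le> L * \<delta>"
      using lipschitz_on_nonneg[OF L] by (meson mult_left_mono order_trans)
  qed
  have lip: "L-lipschitz_on UNIV w"
  proof (rule lipschitz_onI)
    fix x x' :: "real^3"
    have "w x - w x' = (LINT y|lborel. u (x + y) * \<eta> y - u (x' + y) * \<eta> y)"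
      using int\<eta>[OF shift_cont] by (simp add: w_def)
    also have "\<dots> = (LINT y|lborel. (u (x + y) - u (x' + y)) * \<eta> y)" by (simp add: algebra_simps)
    also have "\<bar>\<dots>\<bar> \<le> (LINT y|lborel. (L * dist x x') * \<eta> y)"
      unfolding real_norm_def[symmetric]
    proof (rule Bochner_Integration.integral_norm_bound_integral)
      show "integrable lborel (\<lambda>y. (u (x + y) - u (x' + y)) * \<eta> y)"
        by (intro int\<eta> continuous_intros shift_cont)
      show "integrable lborel (\<lambda>y. (L * dist x x') * \<eta> y)" by (intro int\<eta> continuous_intros)
      show "norm ((u (x + y) - u (x' + y)) * \<eta> y) \<le> (L * dist x x') * \<eta> y" for y
      proof -
        have "\<bar>u (x + y) - u (x' + y)\<bar> \<le> L * dist x x'"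
          using lipschitz_onD[OF L, of "x + y" "x' + y"] by (simp add: dist_norm)
        then show ?thesis using \<eta>(1)[of y] by (auto simp: abs_mult intro: mult_right_mono)
      qed
    qed
    also have "\<dots> = L * dist x x'" using \<eta>(3) by simp
    finally show "dist (w x) (w x') \<le> L * dist x x'" by (simp add: dist_real_def)
  qed (rule lipschitz_on_nonneg[OF L])
  have C1: "w \<in> C1"
  proof -
    obtain a b where ab: "{x. u x \<noteq> 0} \<subseteq> cbox a b"
      using bounded_subset_cbox_symmetric[OF supp] by blast
    define F where "F x t = u t *\<^sub>R blinfun_inner_right (- G (t - x))" for x t
    have \<eta>shift: "continuous_on UNIV (\<lambda>t. \<eta> (t - x))" for x
      by (intro continuous_on_compose2[OF \<eta>_cont] continuous_intros) auto
    have w_eq: "w x = integral (cbox a b) (\<lambda>t. u t * \<eta> (t - x))" for x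
    proof -
      have c: "continuous_on UNIV (\<lambda>t. u t * \<eta> (t - x))" by (intro continuous_intros cont \<eta>shift)
      have "w x = (LINT t|lborel. u t * \<eta> (t - x))"
        using lborel_integral_translate[OF borel_measurable_continuous_onI[OF c], of x] by (simp add: w_def)
      also have "\<dots> = integral (cbox a b) (\<lambda>t. u t * \<eta> (t - x))"
        using ab by (intro integral_lborel_cbox[OF c]) auto
      finally show ?thesis .
    qed
    have contF: "continuous_on (UNIV \<times> cbox a b) (\<lambda>(x, t). F x t)"
    proof -
      have "continuous_on (UNIV \<times> cbox a b) (\<lambda>z. G (snd z - fst z))"
        by (intro continuous_on_compose2[OF \<eta>(5)] continuous_intros) auto
      moreover have "continuous_on (UNIV \<times> cbox a b) (\<lambda>z. u (snd z))"
        by (intro continuous_on_compose2[OF cont] continuous_intros) auto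
      ultimately show ?thesis
        unfolding F_def case_prod_beta by (intro continuous_intros)
    qed
    have "(w has_derivative blinfun_apply (integral (cbox a b) (F x))) (at x)" for x
    proof -
      have "((\<lambda>x. integral (cbox a b) (\<lambda>t. u t * \<eta> (t - x))) has_derivative
          blinfun_apply (integral (cbox a b) (F x))) (at x within UNIV)"
      proof (rule leibniz_rule)
        fix x t :: "real^3"
        have "((\<lambda>x. t - x) has_derivative (\<lambda>h. - h)) (at x)" by (auto intro!: derivative_eq_intros)
        from has_derivative_compose[OF this \<eta>(4)]
        have "((\<lambda>x. u t * \<eta> (t - x)) has_derivative (\<lambda>h. u t * (G (t - x) \<bullet> (- h)))) (at x)"
          by (rule has_derivative_mult_right)
        moreover have "blinfun_apply (F x t) = (\<lambda>h. u t * (G (t - x) \<bullet> (- h)))"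
          by (auto simp: F_def blinfun.scaleR_left fun_eq_iff)
        ultimately show "((\<lambda>x. u t * \<eta> (t - x)) has_derivative blinfun_apply (F x t)) (at x within UNIV)"
          by simp
        show "(\<lambda>t. u t * \<eta> (t - x)) integrable_on cbox a b"
          by (intro integrable_continuous continuous_intros continuous_on_subset[OF cont]
              continuous_on_subset[OF \<eta>shift]) auto
      qed (use contF in auto)
      then show ?thesis by (simp add: w_eq[abs_def])
    qed
    moreover have "continuous_on UNIV (\<lambda>x. integral (cbox a b) (F x))"
      by (rule integral_continuous_on_param[OF contF])
    ultimately show ?thesis
      by (intro C1_I) (auto intro!: continuous_intros)
  qed
  show ?thesis
  proof (rule that[OF C1 close])
    show "\<bar>partial j w x\<bar> \<le> L" for x j by (rule C1_partial_lipschitz_bound[OF C1 lip])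
    show "\<exists>y\<in>ball x \<delta>. u y \<noteq> 0" if "w x \<noteq> 0" for x
    proof (rule ccontr)
      assume *: "\<not> (\<exists>y\<in>ball x \<delta>. u y \<noteq> 0)"
      have "\<bar>w x - 0\<bar> \<le> 0"
      proof (rule w_bound)
        fix y assume "\<eta> y \<noteq> 0"
        then have "x + y \<in> ball x \<delta>" using \<eta>(2) by (simp add: dist_norm)
        then show "\<bar>u (x + y) - 0\<bar> \<le> 0" using * by auto
      qed
      then show False using that by simp
    qed
    show "partial j w x = g $ j"
      if "\<delta> < r" and aff: "\<And>y. y \<in> ball x r \<Longrightarrow> u y = u x + g \<bullet> (y - x)" for x g r j
    proof -
      define c where "c = (LINT y|lborel. (g \<bullet> y) * \<eta> y)"
      have "w x' = g \<bullet> x' + (u x - g \<bullet> x + c)" if x': "x' \<in> ball x (r - \<delta>)" for x'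
      proof -
        have "u (x' + y) * \<eta> y = (u x + g \<bullet> (x' - x)) * \<eta> y + (g \<bullet> y) * \<eta> y" for y
        proof (cases "\<eta> y = 0")
          case False
          then have "norm y < \<delta>" using \<eta>(2) by blast
          then have "x' + y \<in> ball x r"
            using x' norm_triangle_ineq[of "x' - x" y] by (simp add: dist_norm norm_minus_commute algebra_simps)
          then show ?thesis by (simp add: aff algebra_simps inner_add_right inner_diff_right)
        qed simp
        then have "w x' = (LINT y|lborel. (u x + g \<bullet> (x' - x)) * \<eta> y + (g \<bullet> y) * \<eta> y)"
          unfolding w_def by presburger
        also have "\<dots> = u x + g \<bullet> (x' - x) + c"
        proof -
          have "integrable lborel (\<lambda>y. (g \<bullet> y) * \<eta> y)" "integrable lborel (\<lambda>y. (u x + g \<bullet> (x' - x)) * \<eta> y)"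
            by (intro int\<eta> continuous_intros)+
          then show ?thesis using \<eta>(3) by (simp add: c_def)
        qed
        finally show ?thesis by (simp add: inner_diff_right)
      qed
      then have "partial j w x = partial j (\<lambda>x'. g \<bullet> x' + (u x - g \<bullet> x + c)) x"
        using \<open>\<delta> < r\<close> C1_affine[of g] by (intro partial_eq_on_open[of "ball x (r - \<delta>)"]) (auto simp: C1_def)
      then show ?thesis by (simp add: partial_affine)
    qed
  qed
qed

section \<open>Uniqueness of weak derivatives\<close>

text \<open>
  Mollified cut-offs \<open>max 0 (1 - m dist(x, K))\<close> with \<open>m \<rightarrow> \<infinity>\<close>. The kernel radius \<open>1 / m\<^sup>2\<close> keeps the
  mollification error below \<open>1 / m\<close>, the Lipschitz constant being \<open>m\<close>.
\<close>

lemma compact_test_functions: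
  fixes K U :: "(real^3) set"
  assumes K: "compact K" and U: "open U" "K \<subseteq> U"
  obtains \<psi> :: "nat \<Rightarrow> real^3 \<Rightarrow> real" where
    "\<And>n. \<psi> n \<in> C1c U" "\<And>n x. \<bar>\<psi> n x\<bar> \<le> 2" "\<And>x. (\<lambda>n. \<psi> n x) \<longlonglongrightarrow> indicator K x"
proof (cases "K = {}")
  case True
  show ?thesis by (rule that[of "\<lambda>_ _. 0"]) (auto simp: C1c_zero True)
next
  case False
  obtain e where e: "e > 0" "{x. infdist x K \<le> e} \<subseteq> U"
    using compact_in_open_separated[OF False K U] .
  \<comment> \<open>the summand \<open>2 / e\<close> keeps the support, of width \<open>2 / m\<close> around \<open>K\<close>, inside \<open>U\<close>\<close>
  define m where "m n = real n + 1 + 2 / e" for n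
  have m12: "1 \<le> m n" "real n \<le> m n" for n
    using e(1) by (auto simp: m_def field_simps)
  have m_pos: "0 < m n" for n using m12(1)[of n] by linarith
  have m: "1 \<le> m n" "real n \<le> m n" "2 / m n \<le> e" for n
  proof -
    have "2 \<le> e * m n" using e(1) by (simp add: m_def distrib_left)
    then show "2 / m n \<le> e" using m_pos[of n] by (simp add: divide_le_eq)
  qed (rule m12)+
  define q where "q n x = max 0 (1 - m n * infdist x K)" for n and x :: "real^3"
  have ex: "\<exists>w. w \<in> C1c U \<and> (\<forall>x. \<bar>w x - q n x\<bar> \<le> 1 / m n)" for n
  proof -
    have lip: "(m n)-lipschitz_on UNIV (q n)"
    proof (rule lipschitz_onI)
      fix x y :: "real^3"
      have "\<bar>q n x - q n y\<bar> \<le> \<bar>m n * infdist x K - m n * infdist y K\<bar>"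
        by (auto simp: q_def)
      also have "\<dots> = m n * \<bar>infdist x K - infdist y K\<bar>"
        using m_pos[of n] by (simp add: right_diff_distrib[symmetric] abs_mult)
      also have "\<dots> \<le> m n * dist x y"
        using m_pos[of n] infdist_triangle_abs[of x K y] by simp
      finally show "dist (q n x) (q n y) \<le> m n * dist x y" by (simp add: dist_real_def)
    qed (use m_pos[of n] in simp)
    have bdd: "bounded {x. infdist x K \<le> r}" for r
    proof -
      obtain B where B: "\<And>a. a \<in> K \<Longrightarrow> norm a \<le> B"
        using compact_imp_bounded[OF K] by (auto simp: bounded_iff)
      have "norm x \<le> B + r" if "infdist x K \<le> r" for x
      proof -
        obtain a where "a \<in> K" "infdist x K = dist x a"
          using infdist_attains_inf[OF compact_imp_closed[OF K] False] by blast
        then show ?thesis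
          using B[of a] that norm_triangle_ineq[of a "x - a"] by (simp add: dist_norm)
      qed
      then show ?thesis unfolding bounded_iff by blast
    qed
    have q0: "q n x \<noteq> 0 \<Longrightarrow> infdist x K \<le> 1 / m n" for x
      using m_pos[of n] by (auto simp: q_def field_simps max_def split: if_splits)
    have bq: "bounded {x. q n x \<noteq> 0}"
      by (rule bounded_subset[OF bdd[of "1 / m n"]]) (use q0 in auto)
    have dpos: "0 < 1 / (m n)\<^sup>2" using m_pos[of n] by simp
    obtain w where w: "w \<in> C1" "\<And>x. \<bar>w x - q n x\<bar> \<le> m n * (1 / (m n)\<^sup>2)"
      "\<And>x. w x \<noteq> 0 \<Longrightarrow> \<exists>y\<in>ball x (1 / (m n)\<^sup>2). q n y \<noteq> 0"
      by (rule mollify[OF lip bq dpos]) (rule that)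
    have w0: "infdist x K \<le> 2 / m n" if "w x \<noteq> 0" for x
    proof -
      obtain y where y: "dist x y < 1 / (m n)\<^sup>2" "q n y \<noteq> 0" using w(3)[OF \<open>w x \<noteq> 0\<close>] by auto
      have "1 / (m n)\<^sup>2 \<le> 1 / m n"
        using m(1)[of n] m_pos[of n] by (simp add: field_simps power2_eq_square)
      then show ?thesis using infdist_triangle[of x K y] y(1) q0[OF y(2)] by simp
    qed
    have sub: "{x. w x \<noteq> 0} \<subseteq> {x. infdist x K \<le> e}"
      using w0 m(3)[of n] by (auto intro: order_trans)
    have "closed {x. infdist x K \<le> e}"
      by (intro closed_Collect_le continuous_intros)
    then have "closure {x. w x \<noteq> 0} \<subseteq> U"
      using sub e(2) closure_minimal[of _ "{x. infdist x K \<le> e}"] by blast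
    then have "w \<in> C1c U"
      using w(1) bounded_subset[OF bdd sub] by (simp add: C1c_iff)
    moreover have "m n * (1 / (m n)\<^sup>2) = 1 / m n"
      using m_pos[of n] by (simp add: power2_eq_square)
    ultimately show ?thesis using w(2) by auto
  qed
  define \<psi> where "\<psi> n = (SOME w. w \<in> C1c U \<and> (\<forall>x. \<bar>w x - q n x\<bar> \<le> 1 / m n))" for n
  have \<psi>: "\<psi> n \<in> C1c U" "\<bar>\<psi> n x - q n x\<bar> \<le> 1 / m n" for n x
    using someI_ex[OF ex[of n]] unfolding \<psi>_def by blast+
  show ?thesis
  proof (rule that[of \<psi>])
    show "\<psi> n \<in> C1c U" for n by (rule \<psi>)
    show "\<bar>\<psi> n x\<bar> \<le> 2" for n x
    proof -
      have "0 \<le> q n x" "q n x \<le> 1" using m_pos[of n] infdist_nonneg[of x K] by (auto simp: q_def)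
      moreover have "1 / m n \<le> 1" using m(1)[of n] by simp
      ultimately show ?thesis using \<psi>(2)[of n x] by linarith
    qed
    show "(\<lambda>n. \<psi> n x) \<longlonglongrightarrow> indicator K x" for x
    proof -
      have minf: "filterlim m at_top sequentially"
        by (rule filterlim_at_top_mono[OF filterlim_real_sequentially]) (use m(2) in auto)
      have "(\<lambda>n. 1 / m n) \<longlonglongrightarrow> 0"
        by (rule tendsto_divide_0[OF tendsto_const filterlim_at_top_imp_at_infinity[OF minf]])
      then have "(\<lambda>n. \<psi> n x - q n x) \<longlonglongrightarrow> 0"
        by (rule Lim_null_comparison[rotated]) (use \<psi>(2) in auto)
      moreover have "(\<lambda>n. q n x) \<longlonglongrightarrow> indicator K x"
      proof (cases "x \<in> K")
        case True
        then show ?thesis by (simp add: q_def)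
      next
        case False
        then have pos: "0 < infdist x K"
          using \<open>K \<noteq> {}\<close> infdist_pos_not_in_closed[OF compact_imp_closed[OF K]] by blast
        have "\<forall>\<^sub>F n in sequentially. 1 / infdist x K \<le> m n"
          using minf by (simp add: filterlim_at_top)
        then have "\<forall>\<^sub>F n in sequentially. q n x = 0"
          by eventually_elim (use pos in \<open>auto simp: q_def field_simps\<close>)
        then show ?thesis using False by (simp add: tendsto_eventually)
      qed
      ultimately have "(\<lambda>n. \<psi> n x - q n x + q n x) \<longlonglongrightarrow> 0 + indicator K x" by (rule tendsto_add)
      then show ?thesis by simp
    qed
  qed
qed

context bounded_open begin

lemma AE_dom_iff: "(AE x in lebesgue_on \<Omega>. P x) \<longleftrightarrow> (AE x in lebesgue. x \<in> \<Omega> \<longrightarrow> P x)"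
  using dom_sets by (subst AE_restrict_space_iff) auto

lemma integral_compact_zero:
  fixes g :: "real^3 \<Rightarrow> real"
  assumes g: "g \<in> L2 \<Omega>" and U: "open U" "U \<subseteq> \<Omega>"
    and test: "\<And>\<psi>. \<psi> \<in> C1c U \<Longrightarrow> ip \<Omega> g \<psi> = 0"
    and K: "compact K" "K \<subseteq> U"
  shows "(LINT x|lebesgue_on \<Omega>. g x * indicator K x) = 0"
proof -
  obtain \<psi> where \<psi>: "\<And>n. \<psi> n \<in> C1c U" "\<And>n x. \<bar>\<psi> n x\<bar> \<le> 2"
    "\<And>x. (\<lambda>n. \<psi> n x) \<longlonglongrightarrow> (indicator K x :: real)"
    by (rule compact_test_functions[OF K(1) U(1) K(2)]) (rule that)
  have gm: "g \<in> borel_measurable (lebesgue_on \<Omega>)" by (rule L2_measurable[OF g])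
  have "(\<lambda>n. LINT x|lebesgue_on \<Omega>. g x * \<psi> n x) \<longlonglongrightarrow> (LINT x|lebesgue_on \<Omega>. g x * indicator K x)"
  proof (rule integral_dominated_convergence)
    show "integrable (lebesgue_on \<Omega>) (\<lambda>x. 2 * \<bar>g x\<bar>)"
      using L2_imp_integrable[OF dom_lmeasurable g] by simp
    have "K \<in> sets lebesgue" using K(1) by (simp add: borel_compact)
    then have "indicator K \<in> borel_measurable (lebesgue_on \<Omega>)"
      by (intro borel_measurable_indicator) (use K U in \<open>auto simp: sets_restrict_space_iff dom_sets\<close>)
    then show "(\<lambda>x. g x * indicator K x) \<in> borel_measurable (lebesgue_on \<Omega>)"
      by (intro borel_measurable_times gm)
    show "(\<lambda>x. g x * \<psi> n x) \<in> borel_measurable (lebesgue_on \<Omega>)" for n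
      by (intro borel_measurable_times gm continuous_measurable C1_continuous C1c_C1[OF \<psi>(1)])
    show "AE x in lebesgue_on \<Omega>. (\<lambda>n. g x * \<psi> n x) \<longlonglongrightarrow> g x * indicator K x"
      by (intro AE_I2 tendsto_mult_left \<psi>(3))
    show "AE x in lebesgue_on \<Omega>. norm (g x * \<psi> n x) \<le> 2 * \<bar>g x\<bar>" for n
      using \<psi>(2)[of n] by (intro AE_I2) (simp add: abs_mult mult.commute mult_left_mono)
  qed
  moreover have "(LINT x|lebesgue_on \<Omega>. g x * \<psi> n x) = 0" for n
    using test[OF \<psi>(1)] by (simp add: ip_def)
  ultimately show ?thesis by (simp add: LIMSEQ_const_iff)
qed

text \<open>
  If \<open>g\<close> were positive on a set of positive measure in \<open>U\<close>, that set would contain a compact set of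
  positive measure, on which the integral of \<open>g\<close> vanishes by approximation of its indicator by test
  functions.
\<close>

lemma fundamental_lemma_pos:
  fixes g :: "real^3 \<Rightarrow> real"
  assumes g: "g \<in> L2 \<Omega>" and U: "open U" "U \<subseteq> \<Omega>"
    and test: "\<And>\<psi>. \<psi> \<in> C1c U \<Longrightarrow> ip \<Omega> g \<psi> = 0"
  shows "AE x in lebesgue. x \<in> U \<longrightarrow> g x \<le> 0"
proof -
  define A where "A = {x \<in> \<Omega>. g x > 0} \<inter> U"
  have gm: "g \<in> borel_measurable (lebesgue_on \<Omega>)" by (rule L2_measurable[OF g])
  then have "{x \<in> space (lebesgue_on \<Omega>). g x > 0} \<in> sets (lebesgue_on \<Omega>)"
    by (rule borel_measurable_less[OF borel_measurable_const])
  then have "{x \<in> \<Omega>. g x > 0} \<in> sets lebesgue"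
    using dom_sets by (simp add: sets_restrict_space_iff)
  then have A: "A \<in> sets lebesgue"
    using U(1) unfolding A_def by (intro sets.Int) (auto simp: borel_open)
  have "A \<in> lmeasurable"
    by (rule bounded_set_imp_lmeasurable[OF bounded_subset[OF bounded_dom] A]) (auto simp: A_def)
  then have em: "emeasure lebesgue A = ennreal (measure lebesgue A)"
    by (intro emeasure_eq_measure2)
  have "measure lebesgue A = 0"
  proof (rule ccontr)
    assume "measure lebesgue A \<noteq> 0"
    then have "measure lebesgue A > 0" by (simp add: zero_less_measure_iff)
    then obtain T where T: "closed T" "T \<subseteq> A" "emeasure lebesgue (A - T) < emeasure lebesgue A"
      using sets_lebesgue_inner_closed[OF A, of "measure lebesgue A"] em by metis
    have "bounded T" using T(2) bounded_dom by (auto simp: A_def intro: bounded_subset)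
    then have "compact T" using T(1) by (simp add: compact_eq_bounded_closed)
    then have "(LINT x|lebesgue_on \<Omega>. g x * indicator T x) = 0"
      using T(2) by (intro integral_compact_zero[OF g U test]) (auto simp: A_def)
    moreover have "integrable (lebesgue_on \<Omega>) (\<lambda>x. g x * indicator T x)"
    proof (rule integrable_real_mult_indicator)
      show "T \<in> sets (lebesgue_on \<Omega>)"
        using T by (auto simp: sets_restrict_space_iff dom_sets A_def borel_closed)
    qed (rule L2_imp_integrable[OF dom_lmeasurable g])
    ultimately have "AE x in lebesgue_on \<Omega>. g x * indicator T x = 0"
      using T(2) by (subst (asm) integral_nonneg_eq_0_iff_AE) (auto simp: A_def indicator_def intro!: AE_I2)
    then have "AE x in lebesgue. x \<notin> T"
      unfolding AE_dom_iff using T(2) by (auto elim!: eventually_mono simp: A_def subset_iff)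
    then have "T \<in> null_sets lebesgue"
      using T(1) by (subst (asm) AE_iff_null_sets[symmetric]) (auto simp: borel_closed)
    then show False
      using T(3) by (simp add: emeasure_Diff_null_set[OF _ A])
  qed
  then have "A \<in> null_sets lebesgue" using em A by (simp add: null_sets_def)
  from AE_not_in[OF this] show ?thesis
    by eventually_elim (use U(2) in \<open>auto simp: A_def not_le[symmetric]\<close>)
qed

lemma fundamental_lemma:
  fixes g :: "real^3 \<Rightarrow> real"
  assumes g: "g \<in> L2 \<Omega>" and U: "open U" "U \<subseteq> \<Omega>"
    and test: "\<And>\<psi>. \<psi> \<in> C1c U \<Longrightarrow> ip \<Omega> g \<psi> = 0"
  shows "AE x in lebesgue. x \<in> U \<longrightarrow> g x = 0"
proof -
  have "ip \<Omega> (\<lambda>x. - 1 * g x) \<psi> = 0" if "\<psi> \<in> C1c U" for \<psi>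
    using test[OF that] by (simp add: ip_def)
  then have "AE x in lebesgue. x \<in> U \<longrightarrow> - 1 * g x \<le> 0"
    by (rule fundamental_lemma_pos[OF L2_scale[OF g] U])
  moreover have "AE x in lebesgue. x \<in> U \<longrightarrow> g x \<le> 0"
    by (rule fundamental_lemma_pos[OF g U test])
  ultimately show ?thesis by eventually_elim auto
qed

lemma ip_diff_left:
  fixes g h :: "real^3 \<Rightarrow> real"
  assumes "g \<in> L2 \<Omega>" "h \<in> L2 \<Omega>" "\<psi> \<in> L2 \<Omega>"
  shows "ip \<Omega> (\<lambda>x. g x - h x) \<psi> = ip \<Omega> g \<psi> - ip \<Omega> h \<psi>"
  using L2_integrable_mult[OF assms(1,3)] L2_integrable_mult[OF assms(2,3)]
  by (simp add: ip_def left_diff_distrib)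

lemma ip_add_left:
  fixes g h :: "real^3 \<Rightarrow> real"
  assumes "g \<in> L2 \<Omega>" "h \<in> L2 \<Omega>" "\<psi> \<in> L2 \<Omega>"
  shows "ip \<Omega> (\<lambda>x. g x + h x) \<psi> = ip \<Omega> g \<psi> + ip \<Omega> h \<psi>"
  using L2_integrable_mult[OF assms(1,3)] L2_integrable_mult[OF assms(2,3)]
  by (simp add: ip_def distrib_right)

lemma AE_eq_if_test_eq:
  fixes g h :: "real^3 \<Rightarrow> real"
  assumes gh: "g \<in> L2 \<Omega>" "h \<in> L2 \<Omega>" and U: "open U" "U \<subseteq> \<Omega>"
    and "\<And>\<psi>. \<psi> \<in> C1c U \<Longrightarrow> ip \<Omega> g \<psi> = ip \<Omega> h \<psi>"
  shows "AE x in lebesgue. x \<in> U \<longrightarrow> g x = h x"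
proof -
  have "ip \<Omega> (\<lambda>x. g x - h x) \<psi> = 0" if "\<psi> \<in> C1c U" for \<psi>
    using assms(5)[OF that] ip_diff_left[OF gh C1_L2(1)[OF C1c_C1[OF that]]] by simp
  then have "AE x in lebesgue. x \<in> U \<longrightarrow> g x - h x = 0"
    by (rule fundamental_lemma[OF L2_diff[OF gh] U])
  then show ?thesis by simp
qed

lemma has_wpartial_unique:
  assumes "g \<in> L2 \<Omega>" "has_wpartial \<Omega> j u g" "h \<in> L2 \<Omega>" "has_wpartial \<Omega> j u h"
  shows "AE x in lebesgue_on \<Omega>. g x = h x"
  unfolding AE_dom_iff
  using assms by (intro AE_eq_if_test_eq open_dom) (auto simp: has_wpartial_def)

lemma has_wdiv_unique:
  assumes "g \<in> L2 \<Omega>" "has_wdiv \<Omega> v g" "h \<in> L2 \<Omega>" "has_wdiv \<Omega> v h"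
  shows "AE x in lebesgue_on \<Omega>. g x = h x"
  unfolding AE_dom_iff
  using assms by (intro AE_eq_if_test_eq open_dom) (auto simp: has_wdiv_def)

lemma
  assumes "u \<in> H1 \<Omega>"
  shows wpartial_L2: "wpartial \<Omega> j u \<in> L2 \<Omega>"
    and has_wpartial_wpartial: "has_wpartial \<Omega> j u (wpartial \<Omega> j u)"
    and H1_L2: "u \<in> L2 \<Omega>"
proof -
  have "\<exists>g. g \<in> L2 \<Omega> \<and> has_wpartial \<Omega> j u g" using assms by (auto simp: H1_def)
  from someI_ex[OF this] show "wpartial \<Omega> j u \<in> L2 \<Omega>" "has_wpartial \<Omega> j u (wpartial \<Omega> j u)"
    unfolding wpartial_def by blast+
  show "u \<in> L2 \<Omega>" using assms by (simp add: H1_def)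
qed

lemma wpartial_AE_eq:
  assumes "u \<in> H1 \<Omega>" "g \<in> L2 \<Omega>" "has_wpartial \<Omega> j u g"
  shows "AE x in lebesgue_on \<Omega>. wpartial \<Omega> j u x = g x"
  by (rule has_wpartial_unique[OF wpartial_L2[OF assms(1)] has_wpartial_wpartial[OF assms(1)] assms(2,3)])

lemma C1_H1:
  assumes "p \<in> C1" shows "p \<in> H1 \<Omega>"
proof -
  have "\<exists>g\<in>L2 \<Omega>. has_wpartial \<Omega> j p g" for j
    using C1_has_wpartial[OF assms] C1_L2(2)[OF assms] by blast
  then show ?thesis using C1_L2(1)[OF assms] by (simp add: H1_def)
qed

lemma wpartial_C1:
  assumes "p \<in> C1" shows "AE x in lebesgue_on \<Omega>. wpartial \<Omega> j p x = partial j p x"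
  by (intro wpartial_AE_eq C1_H1 C1_L2 C1_has_wpartial assms)

lemma has_wpartial_add:
  assumes "u \<in> L2 \<Omega>" "v \<in> L2 \<Omega>" "g \<in> L2 \<Omega>" "h \<in> L2 \<Omega>"
    and "has_wpartial \<Omega> j u g" "has_wpartial \<Omega> j v h"
  shows "has_wpartial \<Omega> j (\<lambda>x. u x + v x) (\<lambda>x. g x + h x)"
  using assms by (auto simp: has_wpartial_def ip_add_left C1_L2 C1c_C1)

lemma has_wpartial_scale:
  assumes "has_wpartial \<Omega> j u g"
  shows "has_wpartial \<Omega> j (\<lambda>x. c * u x) (\<lambda>x. c * g x)"
  using assms by (auto simp: has_wpartial_def ip_def mult.assoc)

lemma
  assumes "u \<in> H1 \<Omega>" "v \<in> H1 \<Omega>"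
  shows H1_add: "(\<lambda>x. u x + v x) \<in> H1 \<Omega>"
    and wpartial_add: "AE x in lebesgue_on \<Omega>. wpartial \<Omega> j (\<lambda>x. u x + v x) x = wpartial \<Omega> j u x + wpartial \<Omega> j v x"
proof -
  have *: "(\<lambda>x. wpartial \<Omega> j u x + wpartial \<Omega> j v x) \<in> L2 \<Omega>"
    "has_wpartial \<Omega> j (\<lambda>x. u x + v x) (\<lambda>x. wpartial \<Omega> j u x + wpartial \<Omega> j v x)" for j
    by (rule L2_add[OF wpartial_L2[OF assms(1)] wpartial_L2[OF assms(2)]])
       (rule has_wpartial_add[OF H1_L2[OF assms(1)] H1_L2[OF assms(2)] wpartial_L2[OF assms(1)]
          wpartial_L2[OF assms(2)] has_wpartial_wpartial[OF assms(1)] has_wpartial_wpartial[OF assms(2)]])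
  then show H1: "(\<lambda>x. u x + v x) \<in> H1 \<Omega>"
    using L2_add[OF H1_L2[OF assms(1)] H1_L2[OF assms(2)]] unfolding H1_def by blast
  show "AE x in lebesgue_on \<Omega>. wpartial \<Omega> j (\<lambda>x. u x + v x) x = wpartial \<Omega> j u x + wpartial \<Omega> j v x"
    by (rule wpartial_AE_eq[OF H1 *])
qed

lemma
  assumes "u \<in> H1 \<Omega>"
  shows H1_scale: "(\<lambda>x. c * u x) \<in> H1 \<Omega>"
    and wpartial_scale: "AE x in lebesgue_on \<Omega>. wpartial \<Omega> j (\<lambda>x. c * u x) x = c * wpartial \<Omega> j u x"
proof -
  have *: "(\<lambda>x. c * wpartial \<Omega> j u x) \<in> L2 \<Omega>"
    "has_wpartial \<Omega> j (\<lambda>x. c * u x) (\<lambda>x. c * wpartial \<Omega> j u x)" for j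
    by (rule L2_scale[OF wpartial_L2[OF assms]])
       (rule has_wpartial_scale[OF has_wpartial_wpartial[OF assms]])
  then show H1: "(\<lambda>x. c * u x) \<in> H1 \<Omega>"
    using L2_scale[OF H1_L2[OF assms]] unfolding H1_def by blast
  show "AE x in lebesgue_on \<Omega>. wpartial \<Omega> j (\<lambda>x. c * u x) x = c * wpartial \<Omega> j u x"
    by (rule wpartial_AE_eq[OF H1 *])
qed

lemma
  assumes "u \<in> H1 \<Omega>" "v \<in> H1 \<Omega>"
  shows H1_diff: "(\<lambda>x. u x - v x) \<in> H1 \<Omega>"
    and wpartial_diff: "AE x in lebesgue_on \<Omega>. wpartial \<Omega> j (\<lambda>x. u x - v x) x = wpartial \<Omega> j u x - wpartial \<Omega> j v x"
proof -
  have v: "(\<lambda>x. -1 * v x) \<in> H1 \<Omega>" by (rule H1_scale[OF assms(2)])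
  show "(\<lambda>x. u x - v x) \<in> H1 \<Omega>" using H1_add[OF assms(1) v] by simp
  show "AE x in lebesgue_on \<Omega>. wpartial \<Omega> j (\<lambda>x. u x - v x) x = wpartial \<Omega> j u x - wpartial \<Omega> j v x"
    using wpartial_add[OF assms(1) v, of j] wpartial_scale[OF assms(2), of j "-1"]
    by eventually_elim simp
qed

text \<open>
  Test functions supported in \<open>U\<close> see only the values of \<open>u\<close> there, so on \<open>U\<close> the weak derivative of
  \<open>u\<close> satisfies the same test equations as the derivative of \<open>p\<close>.
\<close>

lemma wpartial_local:
  assumes u: "u \<in> H1 \<Omega>" and p: "p \<in> C1" and U: "open U" "U \<subseteq> \<Omega>"
    and eq: "AE x in lebesgue. x \<in> U \<longrightarrow> u x = p x"
  shows "AE x in lebesgue. x \<in> U \<longrightarrow> wpartial \<Omega> j u x = partial j p x"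
proof (rule AE_eq_if_test_eq[OF wpartial_L2[OF u] C1_L2(2)[OF p] U])
  fix \<psi> assume \<psi>: "\<psi> \<in> C1c U"
  then have \<psi>\<Omega>: "\<psi> \<in> C1c \<Omega>" using U by (auto simp: C1c_def)
  have "ip \<Omega> u (partial j \<psi>) = ip \<Omega> p (partial j \<psi>)"
    unfolding ip_def
  proof (rule integral_cong_AE)
    have "partial j \<psi> x = 0" if "x \<notin> U" for x
      using \<psi> that by (intro C1c_partial_zero_outside) (auto simp: C1c_iff)
    then show "AE x in lebesgue_on \<Omega>. u x \<bullet> partial j \<psi> x = p x \<bullet> partial j \<psi> x"
      unfolding AE_dom_iff using eq by (auto elim!: eventually_mono)
    show "(\<lambda>x. u x \<bullet> partial j \<psi> x) \<in> borel_measurable (lebesgue_on \<Omega>)"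
      "(\<lambda>x. p x \<bullet> partial j \<psi> x) \<in> borel_measurable (lebesgue_on \<Omega>)"
      by (intro borel_measurable_inner L2_measurable H1_L2[OF u] C1_L2 p C1c_C1[OF \<psi>])+
  qed
  then show "ip \<Omega> (wpartial \<Omega> j u) \<psi> = ip \<Omega> (partial j p) \<psi>"
    using \<psi>\<Omega> has_wpartial_wpartial[OF u, of j] C1_has_wpartial[OF p, of j]
    by (simp add: has_wpartial_def)
qed

lemma
  fixes v :: "real^3 \<Rightarrow> real^3"
  assumes "v \<in> H1vec \<Omega>"
  shows has_wdiv_trace: "has_wdiv \<Omega> v (\<lambda>x. \<Sum>j\<in>UNIV. wpartial \<Omega> j (\<lambda>y. v y $ j) x)"
    and wdiv_trace: "AE x in lebesgue_on \<Omega>. wdiv \<Omega> v x = (\<Sum>j\<in>UNIV. wpartial \<Omega> j (\<lambda>y. v y $ j) x)"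
    and wdiv_L2: "wdiv \<Omega> v \<in> L2 \<Omega>"
proof -
  let ?d = "\<lambda>x. \<Sum>j\<in>UNIV. wpartial \<Omega> j (\<lambda>y. v y $ j) x"
  have H1: "(\<lambda>y. v y $ j) \<in> H1 \<Omega>" for j using assms by (simp add: H1vec_def)
  have L2: "?d \<in> L2 \<Omega>" by (intro L2_sum wpartial_L2 H1)
  show tr: "has_wdiv \<Omega> v ?d"
    unfolding has_wdiv_def
  proof
    fix \<psi> assume \<psi>: "\<psi> \<in> C1c \<Omega>"
    note \<psi>L2 = C1_L2[OF C1c_C1[OF \<psi>]]
    have "ip \<Omega> v (\<lambda>x. \<chi> j. partial j \<psi> x) = (\<Sum>j\<in>UNIV. ip \<Omega> (\<lambda>y. v y $ j) (partial j \<psi>))"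
      unfolding ip_def inner_vec_def
      by (subst Bochner_Integration.integral_sum[symmetric])
         (auto intro!: L2_integrable_mult H1_L2 H1 \<psi>L2)
    also have "\<dots> = - (\<Sum>j\<in>UNIV. ip \<Omega> (wpartial \<Omega> j (\<lambda>y. v y $ j)) \<psi>)"
      using has_wpartial_wpartial[OF H1] \<psi> by (simp add: has_wpartial_def sum_negf)
    also have "(\<Sum>j\<in>UNIV. ip \<Omega> (wpartial \<Omega> j (\<lambda>y. v y $ j)) \<psi>) = ip \<Omega> ?d \<psi>"
      unfolding ip_def inner_real_def sum_distrib_right
      by (subst Bochner_Integration.integral_sum[symmetric])
         (auto intro!: L2_integrable_mult wpartial_L2 H1 \<psi>L2)
    finally show "ip \<Omega> v (\<lambda>x. \<chi> j. partial j \<psi> x) = - ip \<Omega> ?d \<psi>" .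
  qed
  have "\<exists>d. d \<in> L2 \<Omega> \<and> has_wdiv \<Omega> v d" using tr L2 by blast
  from someI_ex[OF this] have w: "wdiv \<Omega> v \<in> L2 \<Omega>" "has_wdiv \<Omega> v (wdiv \<Omega> v)"
    unfolding wdiv_def by blast+
  then show "wdiv \<Omega> v \<in> L2 \<Omega>" by simp
  show "AE x in lebesgue_on \<Omega>. wdiv \<Omega> v x = ?d x"
    by (rule has_wdiv_unique[OF w L2 tr])
qed

end

section \<open>Zero boundary values, component by component\<close>

text \<open>
  The square of the \<open>H\<^sup>1\<close> norm of a scalar function; summed over the components of a field it gives the
  square of the norm of the field.
\<close>

definition h1sq :: "(real^3) set \<Rightarrow> (real^3 \<Rightarrow> real) \<Rightarrow> real" where
  "h1sq \<Omega> u = ip \<Omega> u u + (\<Sum>j\<in>UNIV. ip \<Omega> (wpartial \<Omega> j u) (wpartial \<Omega> j u))"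

text \<open>
  The scalar space \<open>H\<^sup>1\<^sub>0\<close>; a field lies in the velocity space exactly if its components lie in \<open>H\<^sup>1\<^sub>0\<close>
  (\<open>Xsp_iff\<close>).
\<close>

definition H10 :: "(real^3) set \<Rightarrow> (real^3 \<Rightarrow> real) set" where
  "H10 \<Omega> = {u \<in> H1 \<Omega>. \<forall>\<epsilon>>0. \<exists>w\<in>C1c \<Omega>. h1sq \<Omega> (\<lambda>x. u x - w x) < \<epsilon>}"

lemma ip_self_nonneg:
  fixes u :: "real^3 \<Rightarrow> 'b::euclidean_space"
  shows "0 \<le> ip \<Omega> u u"
  unfolding ip_def by (intro Bochner_Integration.integral_nonneg) auto

lemma h1sq_ge:
  shows "ip \<Omega> u u \<le> h1sq \<Omega> u" "ip \<Omega> (wpartial \<Omega> j u) (wpartial \<Omega> j u) \<le> h1sq \<Omega> u" "0 \<le> h1sq \<Omega> u"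
proof -
  have "ip \<Omega> (wpartial \<Omega> j u) (wpartial \<Omega> j u) \<le> (\<Sum>j\<in>UNIV. ip \<Omega> (wpartial \<Omega> j u) (wpartial \<Omega> j u))"
    by (rule member_le_sum) (auto intro: ip_self_nonneg)
  moreover have "0 \<le> (\<Sum>j\<in>UNIV. ip \<Omega> (wpartial \<Omega> j u) (wpartial \<Omega> j u))"
    by (intro sum_nonneg ip_self_nonneg)
  ultimately show "ip \<Omega> u u \<le> h1sq \<Omega> u" "ip \<Omega> (wpartial \<Omega> j u) (wpartial \<Omega> j u) \<le> h1sq \<Omega> u" "0 \<le> h1sq \<Omega> u"
    using ip_self_nonneg[of \<Omega> u] by (auto simp: h1sq_def)
qed

context bounded_open begin

lemma ip_cong_AE:
  fixes f g f' g' :: "real^3 \<Rightarrow> real"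
  assumes "f \<in> L2 \<Omega>" "g \<in> L2 \<Omega>" "f' \<in> L2 \<Omega>" "g' \<in> L2 \<Omega>"
    and "AE x in lebesgue_on \<Omega>. f x = f' x" "AE x in lebesgue_on \<Omega>. g x = g' x"
  shows "ip \<Omega> f g = ip \<Omega> f' g'"
  unfolding ip_def
proof (rule integral_cong_AE)
  show "(\<lambda>x. f x \<bullet> g x) \<in> borel_measurable (lebesgue_on \<Omega>)" "(\<lambda>x. f' x \<bullet> g' x) \<in> borel_measurable (lebesgue_on \<Omega>)"
    by (intro borel_measurable_inner L2_measurable assms)+
  show "AE x in lebesgue_on \<Omega>. f x \<bullet> g x = f' x \<bullet> g' x"
    using assms(5,6) by eventually_elim simp
qed

lemma ip_add_self_le:
  fixes f g :: "real^3 \<Rightarrow> real"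
  assumes "f \<in> L2 \<Omega>" "g \<in> L2 \<Omega>"
  shows "ip \<Omega> (\<lambda>x. f x + g x) (\<lambda>x. f x + g x) \<le> 2 * ip \<Omega> f f + 2 * ip \<Omega> g g"
proof -
  note ints = L2_integrable_mult[OF assms(1) assms(1)] L2_integrable_mult[OF assms(2) assms(2)]
  have "ip \<Omega> (\<lambda>x. f x + g x) (\<lambda>x. f x + g x) \<le> (LINT x|lebesgue_on \<Omega>. 2 * (f x * f x) + 2 * (g x * g x))"
    unfolding ip_def
  proof (rule integral_mono)
    show "integrable (lebesgue_on \<Omega>) (\<lambda>x. (f x + g x) \<bullet> (f x + g x))"
      using L2_integrable_mult[OF L2_add[OF assms] L2_add[OF assms]] by simp
    show "integrable (lebesgue_on \<Omega>) (\<lambda>x. 2 * (f x * f x) + 2 * (g x * g x))"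
      using ints by simp
    show "(f x + g x) \<bullet> (f x + g x) \<le> 2 * (f x * f x) + 2 * (g x * g x)" for x
      using sum_squares_bound[of "f x" "g x"] by (simp add: algebra_simps power2_eq_square)
  qed
  also have "\<dots> = 2 * ip \<Omega> f f + 2 * ip \<Omega> g g" using ints by (simp add: ip_def)
  finally show ?thesis .
qed

lemma h1sq_add_le:
  assumes "u \<in> H1 \<Omega>" "v \<in> H1 \<Omega>"
  shows "h1sq \<Omega> (\<lambda>x. u x + v x) \<le> 2 * h1sq \<Omega> u + 2 * h1sq \<Omega> v"
proof -
  have "ip \<Omega> (wpartial \<Omega> j (\<lambda>x. u x + v x)) (wpartial \<Omega> j (\<lambda>x. u x + v x))
      \<le> 2 * ip \<Omega> (wpartial \<Omega> j u) (wpartial \<Omega> j u) + 2 * ip \<Omega> (wpartial \<Omega> j v) (wpartial \<Omega> j v)" for j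
  proof -
    note g = wpartial_L2[OF assms(1), of j] wpartial_L2[OF assms(2), of j]
    have "ip \<Omega> (wpartial \<Omega> j (\<lambda>x. u x + v x)) (wpartial \<Omega> j (\<lambda>x. u x + v x))
      = ip \<Omega> (\<lambda>x. wpartial \<Omega> j u x + wpartial \<Omega> j v x) (\<lambda>x. wpartial \<Omega> j u x + wpartial \<Omega> j v x)"
      by (intro ip_cong_AE wpartial_L2 H1_add assms L2_add wpartial_add)
    also have "\<dots> \<le> 2 * ip \<Omega> (wpartial \<Omega> j u) (wpartial \<Omega> j u) + 2 * ip \<Omega> (wpartial \<Omega> j v) (wpartial \<Omega> j v)"
      by (rule ip_add_self_le[OF g])
    finally show ?thesis .
  qed
  then have "(\<Sum>j\<in>UNIV. ip \<Omega> (wpartial \<Omega> j (\<lambda>x. u x + v x)) (wpartial \<Omega> j (\<lambda>x. u x + v x)))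
      \<le> (\<Sum>j\<in>UNIV. 2 * ip \<Omega> (wpartial \<Omega> j u) (wpartial \<Omega> j u) + 2 * ip \<Omega> (wpartial \<Omega> j v) (wpartial \<Omega> j v))"
    by (intro sum_mono)
  then show ?thesis
    using ip_add_self_le[OF H1_L2[OF assms(1)] H1_L2[OF assms(2)]]
    by (simp add: h1sq_def sum.distrib sum_distrib_left distrib_left)
qed

lemma h1sq_scale:
  assumes "u \<in> H1 \<Omega>" shows "h1sq \<Omega> (\<lambda>x. c * u x) = c\<^sup>2 * h1sq \<Omega> u"
proof -
  have sc: "ip \<Omega> (\<lambda>x. c * f x) (\<lambda>x. c * f x) = c\<^sup>2 * ip \<Omega> f f" for f :: "real^3 \<Rightarrow> real"
  proof -
    have "ip \<Omega> (\<lambda>x. c * f x) (\<lambda>x. c * f x) = (LINT x|lebesgue_on \<Omega>. c\<^sup>2 * (f x * f x))"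
      unfolding ip_def by (intro Bochner_Integration.integral_cong) (auto simp: power2_eq_square)
    then show ?thesis by (simp add: ip_def)
  qed
  have "ip \<Omega> (wpartial \<Omega> j (\<lambda>x. c * u x)) (wpartial \<Omega> j (\<lambda>x. c * u x))
      = ip \<Omega> (\<lambda>x. c * wpartial \<Omega> j u x) (\<lambda>x. c * wpartial \<Omega> j u x)" for j
    by (intro ip_cong_AE wpartial_L2 H1_scale assms L2_scale wpartial_scale)
  then show ?thesis by (simp add: h1sq_def sc sum_distrib_left distrib_left)
qed

lemma H10_H1: "u \<in> H10 \<Omega> \<Longrightarrow> u \<in> H1 \<Omega>" by (simp add: H10_def)

lemma H10_zero: "(\<lambda>_. 0) \<in> H10 \<Omega>"
proof -
  have "h1sq \<Omega> (\<lambda>x. 0 * (0::real)) = 0\<^sup>2 * h1sq \<Omega> (\<lambda>_. 0)"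
    by (rule h1sq_scale[OF C1_H1[OF C1_const]])
  then show ?thesis
    by (auto simp: H10_def C1_H1 C1_const intro!: bexI[of _ "\<lambda>_. 0"] C1c_zero)
qed

lemma H10_add:
  assumes "u \<in> H10 \<Omega>" "v \<in> H10 \<Omega>" shows "(\<lambda>x. u x + v x) \<in> H10 \<Omega>"
  unfolding H10_def
proof (intro CollectI conjI allI impI)
  show "(\<lambda>x. u x + v x) \<in> H1 \<Omega>" by (intro H1_add H10_H1 assms)
  fix \<epsilon> :: real assume "\<epsilon> > 0"
  then have "\<epsilon> / 4 > 0" by simp
  then obtain w z where wz: "w \<in> C1c \<Omega>" "h1sq \<Omega> (\<lambda>x. u x - w x) < \<epsilon> / 4"
    "z \<in> C1c \<Omega>" "h1sq \<Omega> (\<lambda>x. v x - z x) < \<epsilon> / 4"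
    using assms unfolding H10_def by blast
  have "h1sq \<Omega> (\<lambda>x. (u x - w x) + (v x - z x)) \<le> 2 * h1sq \<Omega> (\<lambda>x. u x - w x) + 2 * h1sq \<Omega> (\<lambda>x. v x - z x)"
    by (intro h1sq_add_le H1_diff H10_H1 assms C1_H1 C1c_C1[OF wz(1)] C1c_C1[OF wz(3)])
  then have "h1sq \<Omega> (\<lambda>x. (u x + v x) - (w x + z x)) < \<epsilon>"
    using wz by (simp add: algebra_simps)
  then show "\<exists>w\<in>C1c \<Omega>. h1sq \<Omega> (\<lambda>x. u x + v x - w x) < \<epsilon>"
    by (rule bexI[of _ "\<lambda>x. w x + z x"]) (rule C1c_add[OF wz(1,3)])
qed

lemma H10_scale:
  assumes "u \<in> H10 \<Omega>" shows "(\<lambda>x. c * u x) \<in> H10 \<Omega>"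
  unfolding H10_def
proof (intro CollectI conjI allI impI)
  show "(\<lambda>x. c * u x) \<in> H1 \<Omega>" by (intro H1_scale H10_H1 assms)
  fix \<epsilon> :: real assume "\<epsilon> > 0"
  have pos: "0 < c\<^sup>2 + 1" by (simp add: add_nonneg_pos)
  then have "\<epsilon> / (c\<^sup>2 + 1) > 0" using \<open>\<epsilon> > 0\<close> by simp
  then obtain w where w: "w \<in> C1c \<Omega>" "h1sq \<Omega> (\<lambda>x. u x - w x) < \<epsilon> / (c\<^sup>2 + 1)"
    using assms unfolding H10_def by blast
  have "h1sq \<Omega> (\<lambda>x. c * (u x - w x)) = c\<^sup>2 * h1sq \<Omega> (\<lambda>x. u x - w x)"
    by (intro h1sq_scale H1_diff H10_H1 assms C1_H1 C1c_C1[OF w(1)])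
  also have "\<dots> \<le> (c\<^sup>2 + 1) * h1sq \<Omega> (\<lambda>x. u x - w x)"
    by (intro mult_right_mono h1sq_ge) simp
  also have "\<dots> < \<epsilon>" using w(2) pos by (simp add: field_simps)
  finally have "h1sq \<Omega> (\<lambda>x. c * u x - c * w x) < \<epsilon>" by (simp add: right_diff_distrib)
  then show "\<exists>w\<in>C1c \<Omega>. h1sq \<Omega> (\<lambda>x. c * u x - w x) < \<epsilon>"
    by (rule bexI[of _ "\<lambda>x. c * w x"]) (rule C1c_scale[OF w(1)])
qed

lemma H10_sum:
  assumes "\<And>i. i \<in> I \<Longrightarrow> u i \<in> H10 \<Omega>" shows "(\<lambda>x. \<Sum>i\<in>I. u i x) \<in> H10 \<Omega>"
  using assms by (induction I rule: infinite_finite_induct) (auto intro: H10_add H10_zero)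

lemma L2_vector_component:
  fixes v :: "real^3 \<Rightarrow> real^3"
  assumes "\<And>i. (\<lambda>x. v x $ i) \<in> L2 \<Omega>"
  shows "v \<in> L2 \<Omega>"
proof -
  have meas: "v \<in> borel_measurable (lebesgue_on \<Omega>)"
    by (subst borel_measurable_euclidean_space)
       (auto simp: Basis_vec_def inner_axis intro!: L2_measurable assms)
  have "integrable (lebesgue_on \<Omega>) (\<lambda>x. \<Sum>i\<in>UNIV. v x $ i * v x $ i)"
    by (intro Bochner_Integration.integrable_sum L2_integrable_mult assms)
  then show ?thesis using meas by (simp add: L2_def power2_norm_eq_inner inner_vec_def)
qed

lemma H1norm_square:
  assumes "v \<in> H1vec \<Omega>"
  shows "(H1norm \<Omega> v)\<^sup>2 = (\<Sum>i\<in>UNIV. h1sq \<Omega> (\<lambda>x. v x $ i))"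
proof -
  have H1: "(\<lambda>x. v x $ i) \<in> H1 \<Omega>" for i using assms by (simp add: H1vec_def)
  have a: "ip \<Omega> v v = (\<Sum>i\<in>UNIV. ip \<Omega> (\<lambda>x. v x $ i) (\<lambda>x. v x $ i))"
    unfolding ip_def inner_vec_def
    by (subst Bochner_Integration.integral_sum) (auto intro!: L2_integrable_mult H1_L2 H1)
  have b: "ip \<Omega> (wjac \<Omega> v) (wjac \<Omega> v) =
      (\<Sum>i\<in>UNIV. \<Sum>j\<in>UNIV. ip \<Omega> (wpartial \<Omega> j (\<lambda>x. v x $ i)) (wpartial \<Omega> j (\<lambda>x. v x $ i)))"
  proof -
    have i: "integrable (lebesgue_on \<Omega>) (\<lambda>x. wpartial \<Omega> j (\<lambda>x. v x $ i) x * wpartial \<Omega> j (\<lambda>x. v x $ i) x)" for i j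
      by (intro L2_integrable_mult wpartial_L2 H1)
    show ?thesis
      unfolding ip_def inner_vec_def wjac_def using i by simp
  qed
  show ?thesis
    unfolding H1norm_def L2norm_def h1sq_def
    by (simp add: ip_self_nonneg a[symmetric] b[symmetric] sum.distrib)
qed

lemma Xsp_iff: "v \<in> Xsp \<Omega> \<longleftrightarrow> (\<forall>i. (\<lambda>x. v x $ i) \<in> H10 \<Omega>)"
proof
  assume v: "v \<in> Xsp \<Omega>"
  then have vH: "v \<in> H1vec \<Omega>" by (simp add: Xsp_def)
  show "\<forall>i. (\<lambda>x. v x $ i) \<in> H10 \<Omega>"
    unfolding H10_def
  proof (intro allI CollectI conjI impI)
    fix i show H1i: "(\<lambda>x. v x $ i) \<in> H1 \<Omega>" using vH by (simp add: H1vec_def)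
    fix \<epsilon> :: real assume "\<epsilon> > 0"
    then have "sqrt \<epsilon> > 0" by simp
    then obtain w where w: "\<And>i. (\<lambda>x. w x $ i) \<in> C1c \<Omega>" "H1norm \<Omega> (\<lambda>x. v x - w x) < sqrt \<epsilon>"
      using v unfolding Xsp_def by blast
    have vw: "(\<lambda>x. v x - w x) \<in> H1vec \<Omega>"
      using vH H1_diff[OF _ C1_H1[OF C1c_C1[OF w(1)]]] by (simp add: H1vec_def)
    have "h1sq \<Omega> (\<lambda>x. (v x - w x) $ i) \<le> (\<Sum>i\<in>UNIV. h1sq \<Omega> (\<lambda>x. (v x - w x) $ i))"
      by (rule member_le_sum) (auto intro: h1sq_ge)
    also have "\<dots> = (H1norm \<Omega> (\<lambda>x. v x - w x))\<^sup>2" by (rule H1norm_square[OF vw, symmetric])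
    also have "\<dots> < (sqrt \<epsilon>)\<^sup>2"
      using w(2) by (intro power_strict_mono) (auto simp: H1norm_def)
    finally show "\<exists>w\<in>C1c \<Omega>. h1sq \<Omega> (\<lambda>x. v x $ i - w x) < \<epsilon>"
      using w(1)[of i] \<open>\<epsilon> > 0\<close> by (auto intro!: bexI[of _ "\<lambda>x. w x $ i"])
  qed
next
  assume v: "\<forall>i. (\<lambda>x. v x $ i) \<in> H10 \<Omega>"
  then have vH: "v \<in> H1vec \<Omega>" by (auto simp: H1vec_def H10_H1)
  show "v \<in> Xsp \<Omega>"
    unfolding Xsp_def
  proof (intro CollectI conjI allI impI vH)
    fix \<epsilon> :: real assume "\<epsilon> > 0"
    then have "\<epsilon>\<^sup>2 / 3 > 0" by simp
    then have "\<forall>i. \<exists>w. w \<in> C1c \<Omega> \<and> h1sq \<Omega> (\<lambda>x. v x $ i - w x) < \<epsilon>\<^sup>2 / 3"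
      using v unfolding H10_def by blast
    then obtain w where w: "\<And>i. w i \<in> C1c \<Omega>" "\<And>i. h1sq \<Omega> (\<lambda>x. v x $ i - w i x) < \<epsilon>\<^sup>2 / 3"
      by metis
    define z where "z x = (\<chi> i. w i x)" for x
    have z: "(\<lambda>x. z x $ i) \<in> C1c \<Omega>" for i using w(1) by (simp add: z_def)
    have "(\<lambda>x. v x - z x) \<in> H1vec \<Omega>"
      using vH H1_diff[OF _ C1_H1[OF C1c_C1[OF z]]] by (simp add: H1vec_def)
    then have "(H1norm \<Omega> (\<lambda>x. v x - z x))\<^sup>2 = (\<Sum>i\<in>UNIV. h1sq \<Omega> (\<lambda>x. v x $ i - w i x))"
      by (simp add: H1norm_square z_def)
    also have "\<dots> < (\<Sum>i\<in>(UNIV::3 set). \<epsilon>\<^sup>2 / 3)"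
      by (intro sum_strict_mono w) auto
    finally have "(H1norm \<Omega> (\<lambda>x. v x - z x))\<^sup>2 < \<epsilon>\<^sup>2" by simp
    then have "H1norm \<Omega> (\<lambda>x. v x - z x) < \<epsilon>"
      using \<open>\<epsilon> > 0\<close> by (simp add: power2_less_imp_less)
    then show "\<exists>w. (\<forall>i. (\<lambda>x. w x $ i) \<in> C1c \<Omega>) \<and> H1norm \<Omega> (\<lambda>x. v x - w x) < \<epsilon>"
      using z by blast
  qed
qed

lemma Xsp_add: "\<lbrakk>u \<in> Xsp \<Omega>; v \<in> Xsp \<Omega>\<rbrakk> \<Longrightarrow> (\<lambda>x. u x + v x) \<in> Xsp \<Omega>"
  by (simp add: Xsp_iff H10_add)

lemma Xsp_scale: "v \<in> Xsp \<Omega> \<Longrightarrow> (\<lambda>x. c *\<^sub>R v x) \<in> Xsp \<Omega>"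
  by (simp add: Xsp_iff H10_scale)

lemma Xsp_H1vec: "v \<in> Xsp \<Omega> \<Longrightarrow> v \<in> H1vec \<Omega>" by (simp add: Xsp_def)

text \<open>
  For a test function \<open>w\<close> in place of \<open>u\<close> this is the definition of the weak derivative of \<open>v\<close>, tested
  with \<open>p w\<close>. The integral is continuous in \<open>w\<close> for the \<open>H\<^sup>1\<close> norm, so the identity extends to the
  closure of the test functions.
\<close>

lemma integration_by_parts:
  assumes u: "u \<in> H10 \<Omega>" and v: "v \<in> H1 \<Omega>" and p: "p \<in> C1"
  shows "(LINT x|lebesgue_on \<Omega>. v x * wpartial \<Omega> b u x * p x + wpartial \<Omega> b v x * u x * p x
            + u x * v x * partial b p x) = 0"
proof -
  define V where "V x = v x * p x" for x
  define W where "W x = wpartial \<Omega> b v x * p x + v x * partial b p x" for x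
  have VL2: "V \<in> L2 \<Omega>"
    unfolding V_def by (intro L2_mult_continuous H1_L2 v C1_continuous p)
  have WL2: "W \<in> L2 \<Omega>"
    unfolding W_def
    by (intro L2_add L2_mult_continuous H1_L2 wpartial_L2 v C1_continuous C1_partial_continuous p)
  have test: "ip \<Omega> V (partial b w) + ip \<Omega> W w = 0" if w: "w \<in> C1c \<Omega>" for w
  proof -
    note wC = C1c_C1[OF w] and wL = C1_L2[OF C1c_C1[OF w]]
    have i: "integrable (lebesgue_on \<Omega>) (\<lambda>x. V x * partial b w x)" "integrable (lebesgue_on \<Omega>) (\<lambda>x. (v x * partial b p x) * w x)"
       "integrable (lebesgue_on \<Omega>) (\<lambda>x. (wpartial \<Omega> b v x * p x) * w x)"
      by (intro L2_integrable_mult VL2 wL L2_mult_continuous H1_L2 v wpartial_L2 C1_continuous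
          C1_partial_continuous p)+
    have "ip \<Omega> v (partial b (\<lambda>x. p x * w x)) = - ip \<Omega> (wpartial \<Omega> b v) (\<lambda>x. p x * w x)"
      using has_wpartial_wpartial[OF v] C1c_mult[OF w p] by (simp add: has_wpartial_def)
    moreover have "ip \<Omega> v (partial b (\<lambda>x. p x * w x)) = (LINT x|lebesgue_on \<Omega>. V x * partial b w x + (v x * partial b p x) * w x)"
      unfolding ip_def
      by (intro Bochner_Integration.integral_cong) (auto simp: partial_mult[OF p wC] V_def algebra_simps)
    moreover have "ip \<Omega> (wpartial \<Omega> b v) (\<lambda>x. p x * w x) = (LINT x|lebesgue_on \<Omega>. (wpartial \<Omega> b v x * p x) * w x)"
      unfolding ip_def by (simp add: mult.assoc)
    moreover have "ip \<Omega> W w = (LINT x|lebesgue_on \<Omega>. (wpartial \<Omega> b v x * p x) * w x + (v x * partial b p x) * w x)"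
      unfolding ip_def W_def by (simp add: distrib_right)
    ultimately show ?thesis using i by (simp add: ip_def)
  qed
  \<comment> \<open>the left-hand side of the claim; it depends linearly on \<open>u\<close> and vanishes at test functions\<close>
  define B where "B = ip \<Omega> (wpartial \<Omega> b u) V + ip \<Omega> u W"
  define K where "K = sqrt (ip \<Omega> V V) + sqrt (ip \<Omega> W W)"
  have Kpos: "0 \<le> K" by (simp add: K_def ip_self_nonneg)
  have "\<bar>B\<bar> \<le> e" if "e > 0" for e
  proof -
    define \<delta> where "\<delta> = e / (K + 1)"
    have \<delta>: "0 < \<delta>" using \<open>e > 0\<close> Kpos by (simp add: \<delta>_def)
    then have "\<delta>\<^sup>2 > 0" by simp
    then obtain w where w: "w \<in> C1c \<Omega>" "h1sq \<Omega> (\<lambda>x. u x - w x) < \<delta>\<^sup>2"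
      using u unfolding H10_def by blast
    note wC = C1c_C1[OF w(1)] and wL = C1_L2[OF C1c_C1[OF w(1)]]
    note uH = H10_H1[OF u]
    have dH: "(\<lambda>x. u x - w x) \<in> H1 \<Omega>" by (intro H1_diff uH C1_H1 wC)
    have "ip \<Omega> (wpartial \<Omega> b (\<lambda>x. u x - w x)) V = ip \<Omega> (\<lambda>x. wpartial \<Omega> b u x - partial b w x) V"
    proof (rule ip_cong_AE)
      show "AE x in lebesgue_on \<Omega>. wpartial \<Omega> b (\<lambda>x. u x - w x) x = wpartial \<Omega> b u x - partial b w x"
        using wpartial_diff[OF uH C1_H1[OF wC], of b] wpartial_C1[OF wC, of b] by eventually_elim simp
    qed (auto intro!: wpartial_L2 dH VL2 L2_diff uH wL)
    then have "B = ip \<Omega> (wpartial \<Omega> b (\<lambda>x. u x - w x)) V + ip \<Omega> (\<lambda>x. u x - w x) W"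
      using test[OF w(1)] ip_diff_left[OF wpartial_L2[OF uH, of b] wL(2)[of b] VL2]
        ip_diff_left[OF H1_L2[OF uH] wL(1) WL2]
      by (simp add: B_def ip_def mult.commute)
    moreover have "\<bar>ip \<Omega> (wpartial \<Omega> b (\<lambda>x. u x - w x)) V\<bar> \<le> \<delta> * sqrt (ip \<Omega> V V)"
    proof -
      have "sqrt (ip \<Omega> (wpartial \<Omega> b (\<lambda>x. u x - w x)) (wpartial \<Omega> b (\<lambda>x. u x - w x))) \<le> sqrt (\<delta>\<^sup>2)"
        using h1sq_ge(2)[of \<Omega> b "\<lambda>x. u x - w x"] w(2) by (intro real_sqrt_le_mono) linarith
      then have "sqrt (ip \<Omega> (wpartial \<Omega> b (\<lambda>x. u x - w x)) (wpartial \<Omega> b (\<lambda>x. u x - w x))) \<le> \<delta>"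
        using \<delta> by simp
      from mult_right_mono[OF this real_sqrt_ge_zero[OF ip_self_nonneg]]
      show ?thesis by (rule order_trans[OF L2_Cauchy_Schwarz[OF wpartial_L2[OF dH] VL2]])
    qed
    moreover have "\<bar>ip \<Omega> (\<lambda>x. u x - w x) W\<bar> \<le> \<delta> * sqrt (ip \<Omega> W W)"
    proof -
      have "sqrt (ip \<Omega> (\<lambda>x. u x - w x) (\<lambda>x. u x - w x)) \<le> sqrt (\<delta>\<^sup>2)"
        using h1sq_ge(1)[of \<Omega> "\<lambda>x. u x - w x"] w(2) by (intro real_sqrt_le_mono) linarith
      then have "sqrt (ip \<Omega> (\<lambda>x. u x - w x) (\<lambda>x. u x - w x)) \<le> \<delta>"
        using \<delta> by simp
      from mult_right_mono[OF this real_sqrt_ge_zero[OF ip_self_nonneg]]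
      show ?thesis by (rule order_trans[OF L2_Cauchy_Schwarz[OF H1_L2[OF dH] WL2]])
    qed
    ultimately have "\<bar>B\<bar> \<le> \<delta> * K" by (simp add: K_def distrib_left)
    also have "\<dots> \<le> \<delta> * (K + 1)" using \<delta> by simp
    also have "\<dots> = e" using Kpos by (simp add: \<delta>_def)
    finally show ?thesis .
  qed
  then have "\<bar>B\<bar> \<le> 0" by (rule field_le_epsilon[of _ 0, simplified])
  then have "B = 0" by simp
  have "(LINT x|lebesgue_on \<Omega>. v x * wpartial \<Omega> b u x * p x + wpartial \<Omega> b v x * u x * p x
            + u x * v x * partial b p x) =
     (LINT x|lebesgue_on \<Omega>. wpartial \<Omega> b u x * V x + u x * W x)"
    by (intro Bochner_Integration.integral_cong) (auto simp: V_def W_def algebra_simps)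
  also have "\<dots> = B"
    using L2_integrable_mult[OF wpartial_L2[OF H10_H1[OF u], of b] VL2] L2_integrable_mult[OF H1_L2[OF H10_H1[OF u]] WL2]
    by (simp add: B_def ip_def)
  finally show ?thesis using \<open>B = 0\<close> by simp
qed

text \<open>
  The vanishing normal trace is integration by parts with \<open>p = 1\<close>, one component at a time.
\<close>

lemma Xsp_subset_Ysp: "Xsp \<Omega> \<subseteq> Ysp \<Omega>"
proof
  fix v assume v: "v \<in> Xsp \<Omega>"
  note vH = Xsp_H1vec[OF v]
  have H10: "(\<lambda>x. v x $ i) \<in> H10 \<Omega>" for i using v by (simp add: Xsp_iff)
  note H1i = H10_H1[OF H10]
  let ?d = "\<lambda>x. \<Sum>j\<in>UNIV. wpartial \<Omega> j (\<lambda>y. v y $ j) x"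
  have dL2: "?d \<in> L2 \<Omega>" by (intro L2_sum wpartial_L2 H1i)
  have "zero_normal_trace \<Omega> v"
    unfolding zero_normal_trace_def
  proof
    fix q assume q: "q \<in> H1 \<Omega>"
    have i: "integrable (lebesgue_on \<Omega>) (\<lambda>x. v x $ j * wpartial \<Omega> j q x)"
      "integrable (lebesgue_on \<Omega>) (\<lambda>x. wpartial \<Omega> j (\<lambda>y. v y $ j) x * q x)" for j
      by (intro L2_integrable_mult H1_L2 H1i wpartial_L2 q)+
    have "ip \<Omega> v (wgrad \<Omega> q) = (\<Sum>j\<in>UNIV. LINT x|lebesgue_on \<Omega>. v x $ j * wpartial \<Omega> j q x)"
      unfolding ip_def inner_vec_def wgrad_def using i by simp
    moreover have "ip \<Omega> (wdiv \<Omega> v) q = (\<Sum>j\<in>UNIV. LINT x|lebesgue_on \<Omega>. wpartial \<Omega> j (\<lambda>y. v y $ j) x * q x)"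
    proof -
      have "ip \<Omega> (wdiv \<Omega> v) q = ip \<Omega> ?d q"
        by (rule ip_cong_AE[OF wdiv_L2[OF vH] H1_L2[OF q] dL2 H1_L2[OF q] wdiv_trace[OF vH]]) simp
      then show ?thesis using i by (simp add: ip_def sum_distrib_right)
    qed
    moreover have "(LINT x|lebesgue_on \<Omega>. v x $ j * wpartial \<Omega> j q x)
        + (LINT x|lebesgue_on \<Omega>. wpartial \<Omega> j (\<lambda>y. v y $ j) x * q x) = 0" for j
      using integration_by_parts[OF H10 q C1_const[of 1], of j j] i[of j]
      by (simp add: partial_const mult.commute)
    ultimately show "ip \<Omega> v (wgrad \<Omega> q) + ip \<Omega> (wdiv \<Omega> v) q = 0"
      by (simp add: sum.distrib[symmetric])
  qed
  moreover have "v \<in> L2 \<Omega>" by (intro L2_vector_component H1_L2 H1i)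
  ultimately show "v \<in> Ysp \<Omega>"
    using has_wdiv_trace[OF vH] dL2 by (auto simp: Ysp_def)
qed

end

section \<open>Conservation along rotation fields\<close>

definition rot_coeff :: "3 \<Rightarrow> 3 \<Rightarrow> real^3" where
  "rot_coeff i j = cross3 (axis i 1) (axis j 1)"

lemma rot_field_component: "rot_field i x $ j = rot_coeff i j \<bullet> x"
  unfolding rot_field_def rot_coeff_def
  by (metis cross_triple inner_commute inner_axis mult.right_neutral inner_real_def)

text \<open>
  Both sides are the triple product of \<open>e\<^sub>i\<close>, \<open>e\<^sub>j\<close>, \<open>e\<^sub>b\<close>. The conservation law rests
  on this skew symmetry of the gradient of \<open>x \<times> e\<^sub>i\<close>.
\<close>

lemma rot_coeff_antisym: "rot_coeff i j $ b = - rot_coeff i b $ j"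
  unfolding rot_coeff_def
  by (metis cart_eq_inner_axis cross_skew cross_triple inner_commute inner_minus_left)

lemma rot_field_C1: "(\<lambda>x. rot_field i x $ j) \<in> C1"
  using C1_affine[of "rot_coeff i j" 0] by (simp add: rot_field_component)

lemma partial_rot_field: "partial b (\<lambda>x. rot_field i x $ j) x = rot_coeff i j $ b"
  using partial_affine[of b "rot_coeff i j" 0] by (simp add: rot_field_component)

context bounded_open begin

lemma L2_component:
  fixes v :: "real^3 \<Rightarrow> real^3"
  assumes "v \<in> L2 \<Omega>" shows "(\<lambda>x. v x $ i) \<in> L2 \<Omega>"
  unfolding L2_iff_integrable_square
proof
  show meas: "(\<lambda>x. v x $ i) \<in> borel_measurable (lebesgue_on \<Omega>)"
    using L2_measurable[OF assms] unfolding cart_eq_inner_axis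
    by (intro borel_measurable_inner borel_measurable_const)
  show "integrable (lebesgue_on \<Omega>) (\<lambda>x. v x $ i * v x $ i)"
  proof (rule Bochner_Integration.integrable_bound)
    show "integrable (lebesgue_on \<Omega>) (\<lambda>x. (norm (v x))\<^sup>2)" using assms by (simp add: L2_def)
    show "(\<lambda>x. v x $ i * v x $ i) \<in> borel_measurable (lebesgue_on \<Omega>)"
      by (intro borel_measurable_times meas)
    have "\<bar>v x $ i * v x $ i\<bar> \<le> (norm (v x))\<^sup>2" for x
      using mult_mono[OF component_le_norm_cart[of "v x" i] component_le_norm_cart[of "v x" i] norm_ge_zero abs_ge_zero]
      unfolding abs_mult power2_eq_square .
    from order_trans[OF this abs_ge_self]
    show "AE x in lebesgue_on \<Omega>. norm (v x $ i * v x $ i) \<le> norm ((norm (v x))\<^sup>2)"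
      unfolding real_norm_def by (intro AE_I2)
  qed
qed

lemma ip_components:
  fixes v w :: "real^3 \<Rightarrow> real^3"
  assumes "v \<in> L2 \<Omega>" "w \<in> L2 \<Omega>"
  shows "ip \<Omega> v w = (\<Sum>j\<in>UNIV. ip \<Omega> (\<lambda>x. v x $ j) (\<lambda>x. w x $ j))"
  unfolding ip_def inner_vec_def
  by (subst Bochner_Integration.integral_sum) (auto intro!: L2_integrable_mult L2_component assms)

lemma ip_vec_diff_left:
  fixes u v w :: "real^3 \<Rightarrow> real^3"
  assumes "u \<in> L2 \<Omega>" "v \<in> L2 \<Omega>" "w \<in> L2 \<Omega>"
  shows "ip \<Omega> (\<lambda>x. u x - v x) w = ip \<Omega> u w - ip \<Omega> v w"
proof -
  have "(\<lambda>x. u x - v x) \<in> L2 \<Omega>"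
    by (intro L2_vector_component) (auto intro!: L2_diff L2_component assms)
  then show ?thesis
    by (simp add: ip_components assms ip_diff_left L2_component sum_subtractf)
qed

lemma rot_field_L2: "rot_field i \<in> L2 \<Omega>"
  by (intro L2_vector_component C1_L2 rot_field_C1)

lemma Xsp_L2: "v \<in> Xsp \<Omega> \<Longrightarrow> v \<in> L2 \<Omega>"
  by (intro L2_vector_component H1_L2 H10_H1) (simp add: Xsp_iff)

text \<open>
  Integration by parts against the constant function \<open>1\<close>.
\<close>

lemma integral_wpartial_H10:
  assumes "u \<in> H10 \<Omega>" shows "(LINT x|lebesgue_on \<Omega>. wpartial \<Omega> b u x) = 0"
proof -
  have one: "AE x in lebesgue_on \<Omega>. wpartial \<Omega> b (\<lambda>_. 1) x = 0"
    using wpartial_C1[OF C1_const[of 1], of b] by (simp add: partial_const)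
  note L2s = wpartial_L2[OF H10_H1[OF assms], of b] wpartial_L2[OF C1_H1[OF C1_const[of 1]], of b]
    H1_L2[OF H10_H1[OF assms]]
  have "(LINT x|lebesgue_on \<Omega>. wpartial \<Omega> b u x) =
     (LINT x|lebesgue_on \<Omega>. 1 * wpartial \<Omega> b u x * 1 + wpartial \<Omega> b (\<lambda>_. 1) x * u x * 1 + u x * 1 * partial b (\<lambda>_. 1) x)"
  proof (rule integral_cong_AE)
    show "wpartial \<Omega> b u \<in> borel_measurable (lebesgue_on \<Omega>)" by (rule L2_measurable[OF L2s(1)])
    show "(\<lambda>x. 1 * wpartial \<Omega> b u x * 1 + wpartial \<Omega> b (\<lambda>_. 1) x * u x * 1 + u x * 1 * partial b (\<lambda>_. 1) x) \<in> borel_measurable (lebesgue_on \<Omega>)"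
      using L2s[THEN L2_measurable] by (simp add: partial_const)
    show "AE x in lebesgue_on \<Omega>. wpartial \<Omega> b u x = 1 * wpartial \<Omega> b u x * 1 + wpartial \<Omega> b (\<lambda>_. 1) x * u x * 1 + u x * 1 * partial b (\<lambda>_. 1) x"
      using one by eventually_elim (simp add: partial_const)
  qed
  also have "\<dots> = 0" by (rule integration_by_parts[OF assms C1_H1[OF C1_const] C1_const])
  finally show ?thesis .
qed

text \<open>
  With \<open>R = \<phi>\<^sub>i\<close> and summation over \<open>a, b\<close>, the first and third terms combine to the divergence
  \<open>\<partial>\<^sub>b (u\<^sub>a u\<^sub>b) R\<^sub>a\<close> and the second is \<open>R \<cdot> \<nabla>(\<bar>u\<bar>\<^sup>2 / 2)\<close>. After integration by parts the former leaves
  \<open>u\<^sub>a u\<^sub>b\<close> against the skew matrix \<open>\<partial>\<^sub>b R\<^sub>a\<close> and the latter \<open>\<bar>u\<bar>\<^sup>2\<close> against its trace.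
\<close>

lemma emac_rot_integral:
  assumes u: "u \<in> Xsp \<Omega>"
  shows "(LINT x|lebesgue_on \<Omega>. (\<Sum>a\<in>UNIV. \<Sum>b\<in>UNIV.
      (wpartial \<Omega> b (\<lambda>y. u y $ a) x * u x $ b + wpartial \<Omega> a (\<lambda>y. u y $ b) x * u x $ b
        + wpartial \<Omega> b (\<lambda>y. u y $ b) x * u x $ a) * rot_field i x $ a)) = 0"
proof -
  have H10: "(\<lambda>y. u y $ a) \<in> H10 \<Omega>" for a using u by (simp add: Xsp_iff)
  note H1 = H10_H1[OF H10]
  let ?W = "rot_coeff i"
  define d where "d a b x = wpartial \<Omega> b (\<lambda>y. u y $ a) x" for a b x
  define U where "U a x = u x $ a" for a x
  define R where "R a x = rot_field i x $ a" for a x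
  have intd: "integrable (lebesgue_on \<Omega>) (\<lambda>x. d a b x * U c x * R e x)" for a b c e
  proof -
    have "integrable (lebesgue_on \<Omega>) (\<lambda>x. d a b x * (U c x * R e x))"
      unfolding d_def U_def R_def
      by (intro L2_integrable_mult wpartial_L2 H1 L2_mult_continuous H1_L2 C1_continuous rot_field_C1)
    then show ?thesis by (simp add: mult.assoc)
  qed
  have intu: "integrable (lebesgue_on \<Omega>) (\<lambda>x. U a x * U b x)" for a b
    unfolding U_def by (intro L2_integrable_mult H1_L2 H1)
  define J where "J a b c e = (LINT x|lebesgue_on \<Omega>. d a b x * U c x * R e x)" for a b c e
  define m where "m a b = (LINT x|lebesgue_on \<Omega>. U a x * U b x)" for a b
  have ibp: "J b c a e + J a c b e + m a b * (?W e $ c) = 0" for a b c e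
  proof -
    have "(LINT x|lebesgue_on \<Omega>. U a x * d b c x * R e x + d a c x * U b x * R e x + U b x * U a x * (?W e $ c)) = 0"
      using integration_by_parts[OF H10[of b] H1[of a] rot_field_C1[of i e], of c]
      by (simp add: partial_rot_field d_def U_def R_def)
    moreover have "(LINT x|lebesgue_on \<Omega>. U a x * d b c x * R e x + d a c x * U b x * R e x + U b x * U a x * (?W e $ c))
       = (LINT x|lebesgue_on \<Omega>. d b c x * U a x * R e x + d a c x * U b x * R e x + U a x * U b x * (?W e $ c))"
      by (simp add: mult.commute)
    ultimately show ?thesis using intd intu by (simp add: J_def m_def)
  qed
  have m_sym: "m a b = m b a" for a b by (simp add: m_def mult.commute)
  have diag: "?W a $ a = 0" for a using rot_coeff_antisym[of i a a] by simp
  have "(LINT x|lebesgue_on \<Omega>. (\<Sum>a\<in>UNIV. \<Sum>b\<in>UNIV. (d a b x * U b x + d b a x * U b x + d b b x * U a x) * R a x))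
      = (\<Sum>a\<in>UNIV. \<Sum>b\<in>UNIV. J a b b a + J b a b a + J b b a a)"
    using intd by (simp add: distrib_right J_def)
  also have "\<dots> = (\<Sum>a\<in>UNIV. \<Sum>b\<in>UNIV. - (m a b * (?W a $ b)))"
  proof (intro sum.cong refl)
    fix a b
    have "J b a b a = 0" using ibp[of b a b a] diag[of a] by simp
    moreover have "J b b a a + J a b b a + m a b * (?W a $ b) = 0" by (rule ibp)
    ultimately show "J a b b a + J b a b a + J b b a a = - (m a b * (?W a $ b))" by simp
  qed
  also have "\<dots> = 0"
  proof -
    let ?s = "\<Sum>a\<in>UNIV. \<Sum>b\<in>UNIV. m a b * (?W a $ b)"
    have "?s = (\<Sum>b\<in>UNIV. \<Sum>a\<in>UNIV. m a b * (?W a $ b))" by (rule sum.swap)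
    also have "\<dots> = (\<Sum>b\<in>UNIV. \<Sum>a\<in>UNIV. - (m b a * (?W b $ a)))"
      using m_sym rot_coeff_antisym[of i] by (intro sum.cong refl) (metis mult_minus_right)
    also have "\<dots> = - ?s" by (simp add: sum_negf)
    finally show ?thesis by (simp add: sum_negf)
  qed
  finally show ?thesis by (simp add: d_def U_def R_def)
qed

end

section \<open>Piecewise affine functions with zero boundary values\<close>

context bounded_open begin

lemma bounded_convergence_mult:
  fixes F :: "nat \<Rightarrow> real^3 \<Rightarrow> real"
  assumes "\<And>n. F n \<in> borel_measurable (lebesgue_on \<Omega>)" "G \<in> borel_measurable (lebesgue_on \<Omega>)"
    and "\<And>n x. x \<in> \<Omega> \<Longrightarrow> \<bar>F n x\<bar> \<le> B" "AE x in lebesgue_on \<Omega>. (\<lambda>n. F n x) \<longlonglongrightarrow> G x"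
    and "h \<in> L2 \<Omega>"
  shows "(\<lambda>n. LINT x|lebesgue_on \<Omega>. F n x * h x) \<longlonglongrightarrow> (LINT x|lebesgue_on \<Omega>. G x * h x)"
proof (rule integral_dominated_convergence)
  show "integrable (lebesgue_on \<Omega>) (\<lambda>x. B * \<bar>h x\<bar>)"
    using L2_imp_integrable[OF dom_lmeasurable assms(5)] by simp
  show "(\<lambda>x. G x * h x) \<in> borel_measurable (lebesgue_on \<Omega>)"
    "(\<lambda>x. F n x * h x) \<in> borel_measurable (lebesgue_on \<Omega>)" for n
    by (intro borel_measurable_times assms L2_measurable)+
  show "AE x in lebesgue_on \<Omega>. (\<lambda>n. F n x * h x) \<longlonglongrightarrow> G x * h x"
    using assms(4) by eventually_elim (intro tendsto_mult_right)
  show "AE x in lebesgue_on \<Omega>. norm (F n x * h x) \<le> B * \<bar>h x\<bar>" for n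
    using assms(3)[of _ n] by (intro AE_I2) (auto simp: abs_mult intro: mult_right_mono)
qed

text \<open>
  The hypotheses give \<open>w \<rightarrow> u\<close> in \<open>H\<^sup>1\<close> by bounded convergence. The limit of the derivatives is the weak
  derivative of \<open>u\<close>, since the test equations for \<open>w\<close> pass to the limit as well.
\<close>

lemma H10_limit:
  assumes w: "\<And>n. w n \<in> C1c \<Omega>" and u: "continuous_on UNIV u"
    and wu: "\<And>x. (\<lambda>n. w n x) \<longlonglongrightarrow> u x" "\<And>n x. \<bar>w n x - u x\<bar> \<le> B"
    and dw: "\<And>n j x. \<bar>partial j (w n) x\<bar> \<le> B" "\<And>j. AE x in lebesgue_on \<Omega>. convergent (\<lambda>n. partial j (w n) x)"
  shows "u \<in> H10 \<Omega>"
proof -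
  note wC = C1c_C1[OF w]
  \<comment> \<open>clamped, so that it stays bounded also at points where the limit does not exist\<close>
  define G where "G j x = max (- B) (min B (lim (\<lambda>n. partial j (w n) x)))" for j x
  have pm: "partial j (w n) \<in> borel_measurable (lebesgue_on \<Omega>)" for j n
    by (intro continuous_measurable C1_partial_continuous wC)
  have Gm: "G j \<in> borel_measurable (lebesgue_on \<Omega>)" for j
    unfolding G_def by (intro borel_measurable_max borel_measurable_min borel_measurable_lim_metric pm) auto
  have B: "0 \<le> B" using dw(1)[of undefined undefined undefined] by linarith
  have Gb: "\<bar>G j x\<bar> \<le> B" for j x using B by (auto simp: G_def)
  have GL2: "G j \<in> L2 \<Omega>" for j by (rule L2_bounded[OF dom_lmeasurable Gm Gb])
  have lim: "AE x in lebesgue_on \<Omega>. (\<lambda>n. partial j (w n) x) \<longlonglongrightarrow> G j x" for j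
    using dw(2)[of j]
  proof eventually_elim
    case (elim x)
    then have l: "(\<lambda>n. partial j (w n) x) \<longlonglongrightarrow> lim (\<lambda>n. partial j (w n) x)"
      by (simp add: convergent_LIMSEQ_iff)
    have "lim (\<lambda>n. partial j (w n) x) \<le> B" "- B \<le> lim (\<lambda>n. partial j (w n) x)"
      using dw(1)[of j _ x] by (auto intro!: LIMSEQ_le_const2[OF l] LIMSEQ_le_const[OF l] simp: abs_le_iff minus_le_iff)
    then show ?case using l by (simp add: G_def)
  qed
  obtain C where C: "\<And>x. x \<in> \<Omega> \<Longrightarrow> \<bar>u x\<bar> \<le> C" using continuous_bounded[OF u] by blast
  have wb: "\<bar>w n x\<bar> \<le> B + C" if "x \<in> \<Omega>" for n x
    using wu(2)[of n x] C[OF that] by linarith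
  have um: "u \<in> borel_measurable (lebesgue_on \<Omega>)" by (rule continuous_measurable[OF u])
  have wm: "w n \<in> borel_measurable (lebesgue_on \<Omega>)" for n
    by (intro continuous_measurable C1_continuous wC)
  have weak: "has_wpartial \<Omega> j u (G j)" for j
    unfolding has_wpartial_def
  proof
    fix \<psi> assume \<psi>: "\<psi> \<in> C1c \<Omega>"
    note \<psi>L = C1_L2[OF C1c_C1[OF \<psi>]]
    have 1: "(\<lambda>n. ip \<Omega> (w n) (partial j \<psi>)) \<longlonglongrightarrow> ip \<Omega> u (partial j \<psi>)"
      unfolding ip_def inner_real_def
      by (rule bounded_convergence_mult[OF wm um wb _ \<psi>L(2)]) (auto intro!: AE_I2 wu(1))
    have 2: "(\<lambda>n. ip \<Omega> (partial j (w n)) \<psi>) \<longlonglongrightarrow> ip \<Omega> (G j) \<psi>"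
      unfolding ip_def inner_real_def
      by (rule bounded_convergence_mult[OF pm Gm dw(1) lim \<psi>L(1)])
    have "ip \<Omega> (w n) (partial j \<psi>) = - ip \<Omega> (partial j (w n)) \<psi>" for n
      using C1_has_wpartial[OF wC] \<psi> by (simp add: has_wpartial_def)
    then have "(\<lambda>n. ip \<Omega> (w n) (partial j \<psi>)) \<longlonglongrightarrow> - ip \<Omega> (G j) \<psi>"
      using tendsto_minus[OF 2] by simp
    with 1 show "ip \<Omega> u (partial j \<psi>) = - ip \<Omega> (G j) \<psi>" by (rule LIMSEQ_unique)
  qed
  have uH: "u \<in> H1 \<Omega>"
    unfolding H1_def using weak GL2 continuous_L2[OF u] by blast
  have null: "(\<lambda>n. ip \<Omega> (\<lambda>x. f x - g n x) (\<lambda>x. f x - g n x)) \<longlonglongrightarrow> 0"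
    if "f \<in> borel_measurable (lebesgue_on \<Omega>)" "\<And>n. g n \<in> borel_measurable (lebesgue_on \<Omega>)"
      "\<And>x. x \<in> \<Omega> \<Longrightarrow> \<bar>f x\<bar> \<le> M" "\<And>n x. x \<in> \<Omega> \<Longrightarrow> \<bar>g n x\<bar> \<le> M"
      "AE x in lebesgue_on \<Omega>. (\<lambda>n. g n x) \<longlonglongrightarrow> f x" for f :: "real^3 \<Rightarrow> real" and g M
  proof -
    have "(\<lambda>n. LINT x|lebesgue_on \<Omega>. ((f x - g n x) * (f x - g n x)) * 1) \<longlonglongrightarrow> (LINT x|lebesgue_on \<Omega>. 0 * 1)"
    proof (rule bounded_convergence_mult)
      show "(\<lambda>x. (f x - g n x) * (f x - g n x)) \<in> borel_measurable (lebesgue_on \<Omega>)" for n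
        by (intro borel_measurable_times borel_measurable_diff that)
      show "\<bar>(f x - g n x) * (f x - g n x)\<bar> \<le> (2 * M) * (2 * M)" if "x \<in> \<Omega>" for n x
      proof -
        have "\<bar>f x - g n x\<bar> \<le> 2 * M"
          using \<open>\<And>x. x \<in> \<Omega> \<Longrightarrow> \<bar>f x\<bar> \<le> M\<close>[OF \<open>x \<in> \<Omega>\<close>] \<open>\<And>n x. x \<in> \<Omega> \<Longrightarrow> \<bar>g n x\<bar> \<le> M\<close>[OF \<open>x \<in> \<Omega>\<close>, of n]
          by linarith
        then show ?thesis unfolding abs_mult by (intro mult_mono) auto
      qed
      show "AE x in lebesgue_on \<Omega>. (\<lambda>n. (f x - g n x) * (f x - g n x)) \<longlonglongrightarrow> 0"
        using that(5)
      proof eventually_elim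
        case (elim x)
        have "(\<lambda>n. (f x - g n x) * (f x - g n x)) \<longlonglongrightarrow> (f x - f x) * (f x - f x)"
          by (intro tendsto_intros elim)
        then show ?case by simp
      qed
      show "(\<lambda>x. 1::real) \<in> L2 \<Omega>" by (rule C1_L2(1)[OF C1_const])
    qed simp
    then show ?thesis by (simp add: ip_def)
  qed
  have "(\<lambda>n. ip \<Omega> (\<lambda>x. u x - w n x) (\<lambda>x. u x - w n x)
      + (\<Sum>j\<in>UNIV. ip \<Omega> (\<lambda>x. G j x - partial j (w n) x) (\<lambda>x. G j x - partial j (w n) x))) \<longlonglongrightarrow> 0 + (\<Sum>j\<in>(UNIV::3 set). 0)"
  proof (intro tendsto_add tendsto_sum)
    show "(\<lambda>n. ip \<Omega> (\<lambda>x. u x - w n x) (\<lambda>x. u x - w n x)) \<longlonglongrightarrow> 0"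
    proof (rule null[OF um wm _ wb])
      show "\<bar>u x\<bar> \<le> B + C" if "x \<in> \<Omega>" for x using C[OF that] B by linarith
    qed (auto intro: wu(1))
    show "(\<lambda>n. ip \<Omega> (\<lambda>x. G j x - partial j (w n) x) (\<lambda>x. G j x - partial j (w n) x)) \<longlonglongrightarrow> 0" for j
      by (rule null[OF Gm pm Gb dw(1) lim])
  qed
  moreover have "h1sq \<Omega> (\<lambda>x. u x - w n x) = ip \<Omega> (\<lambda>x. u x - w n x) (\<lambda>x. u x - w n x)
      + (\<Sum>j\<in>UNIV. ip \<Omega> (\<lambda>x. G j x - partial j (w n) x) (\<lambda>x. G j x - partial j (w n) x))" for n
  proof -
    have "ip \<Omega> (wpartial \<Omega> j (\<lambda>x. u x - w n x)) (wpartial \<Omega> j (\<lambda>x. u x - w n x))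
        = ip \<Omega> (\<lambda>x. G j x - partial j (w n) x) (\<lambda>x. G j x - partial j (w n) x)" for j
    proof -
      have "AE x in lebesgue_on \<Omega>. wpartial \<Omega> j (\<lambda>x. u x - w n x) x = G j x - partial j (w n) x"
        using wpartial_diff[OF uH C1_H1[OF wC], of j n] wpartial_C1[OF wC, of j n]
          wpartial_AE_eq[OF uH GL2 weak, of j]
        by eventually_elim simp
      then show ?thesis
        by (intro ip_cong_AE wpartial_L2 H1_diff uH C1_H1 wC L2_diff GL2 C1_L2)
    qed
    then show ?thesis by (simp add: h1sq_def)
  qed
  ultimately have "(\<lambda>n. h1sq \<Omega> (\<lambda>x. u x - w n x)) \<longlonglongrightarrow> 0" by simp
  then have "\<exists>n. h1sq \<Omega> (\<lambda>x. u x - w n x) < \<epsilon>" if "\<epsilon> > 0" for \<epsilon>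
    using order_tendstoD(2)[OF _ that] by (metis (no_types, lifting) eventually_sequentially order_refl)
  then show ?thesis using uH w unfolding H10_def by blast
qed

text \<open>
  The approximants are mollifications of \<open>max 0 (u - \<epsilon>)\<close>, with a kernel radius so small compared to \<open>\<epsilon>\<close>
  that the support stays inside \<open>{u \<ge> \<epsilon> / 2}\<close>, a closed subset of \<open>\<Omega>\<close>. At a point with an affine
  neighbourhood their gradients are eventually constant: if \<open>u > 0\<close> there, then the cut-off only
  subtracts \<open>\<epsilon>\<close> nearby once \<open>\<epsilon>\<close> is small; if \<open>u = 0\<close> there, then \<open>u\<close>, being affine and nonnegative,
  vanishes nearby.
\<close>

lemma H10_piecewise_affine:
  fixes u :: "real^3 \<Rightarrow> real"
  assumes L: "L-lipschitz_on UNIV u" and nn: "\<And>x. 0 \<le> u x" and zero: "\<And>x. x \<notin> \<Omega> \<Longrightarrow> u x = 0"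
    and aff: "AE x in lebesgue_on \<Omega>. \<exists>r>0. \<exists>g. \<forall>y\<in>ball x r. u y = u x + g \<bullet> (y - x)"
  shows "u \<in> H10 \<Omega>"
proof -
  have cont: "continuous_on UNIV u" by (rule lipschitz_on_continuous_on[OF L])
  have L0: "0 \<le> L" by (rule lipschitz_on_nonneg[OF L])
  have uL: "\<bar>u x - u y\<bar> \<le> L * dist x y" for x y
    using lipschitz_onD[OF L, of x y] by (simp add: dist_real_def)
  define \<epsilon> where "\<epsilon> n = 1 / real (Suc n)" for n
  define \<delta> where "\<delta> n = \<epsilon> n / (2 * (L + 1))" for n
  have \<epsilon>: "0 < \<epsilon> n" "\<epsilon> n \<le> 1" for n by (auto simp: \<epsilon>_def)
  have \<delta>: "0 < \<delta> n" "\<delta> n \<le> \<epsilon> n" "L * \<delta> n \<le> \<epsilon> n / 2" for n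
    using \<epsilon>(1)[of n] L0 by (auto simp: \<delta>_def field_simps)
  have \<epsilon>0: "\<epsilon> \<longlonglongrightarrow> 0"
    using LIMSEQ_inverse_real_of_nat by (simp add: \<epsilon>_def[abs_def] inverse_eq_divide)
  define q where "q n x = max 0 (u x - \<epsilon> n)" for n x
  have qL: "L-lipschitz_on UNIV (q n)" for n
  proof (rule lipschitz_onI)
    show "dist (q n x) (q n y) \<le> L * dist x y" for x y
      using uL[of x y] by (auto simp: q_def dist_real_def max_def abs_le_iff)
  qed (rule L0)
  have qsupp: "bounded {x. q n x \<noteq> 0}" for n
  proof (rule bounded_subset[OF bounded_dom], safe)
    fix x assume "q n x \<noteq> 0"
    then show "x \<in> \<Omega>" using zero[of x] \<epsilon>(1)[of n] by (cases "x \<in> \<Omega>") (auto simp: q_def)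
  qed
  have "\<exists>w. w \<in> C1 \<and> (\<forall>x. \<bar>w x - q n x\<bar> \<le> L * \<delta> n) \<and> (\<forall>x j. \<bar>partial j w x\<bar> \<le> L) \<and>
      (\<forall>x g r j. \<delta> n < r \<longrightarrow> (\<forall>y\<in>ball x r. q n y = q n x + g \<bullet> (y - x)) \<longrightarrow> partial j w x = g $ j) \<and>
      (\<forall>x. w x \<noteq> 0 \<longrightarrow> (\<exists>y\<in>ball x (\<delta> n). q n y \<noteq> 0))" for n
    by (rule mollify[OF qL qsupp \<delta>(1), of n n]) blast
  then obtain w where w: "\<And>n. w n \<in> C1" "\<And>n x. \<bar>w n x - q n x\<bar> \<le> L * \<delta> n" "\<And>n x j. \<bar>partial j (w n) x\<bar> \<le> L"
     "\<And>n x g r j. \<lbrakk>\<delta> n < r; \<forall>y\<in>ball x r. q n y = q n x + g \<bullet> (y - x)\<rbrakk> \<Longrightarrow> partial j (w n) x = g $ j"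
     "\<And>n x. w n x \<noteq> 0 \<Longrightarrow> \<exists>y\<in>ball x (\<delta> n). q n y \<noteq> 0"
    by metis
  have wu: "\<bar>w n x - u x\<bar> \<le> 2 * \<epsilon> n" for n x
  proof -
    have "\<bar>q n x - u x\<bar> \<le> \<epsilon> n" using nn[of x] \<epsilon>(1)[of n] by (auto simp: q_def)
    then show ?thesis using w(2)[of n x] \<delta>(3)[of n] \<epsilon>(1)[of n] by linarith
  qed
  show ?thesis
  proof (rule H10_limit[where w = w and B = "max 2 L"])
    show "w n \<in> C1c \<Omega>" for n
    proof -
      have pos: "\<epsilon> n / 2 \<le> u x" if "w n x \<noteq> 0" for x
      proof -
        obtain y where y: "dist x y < \<delta> n" "q n y \<noteq> 0" using w(5)[OF \<open>w n x \<noteq> 0\<close>] by auto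
        then have "u y > \<epsilon> n" by (auto simp: q_def max_def split: if_splits)
        moreover have "L * dist x y \<le> L * \<delta> n" using y(1) L0 by (intro mult_left_mono) auto
        ultimately show ?thesis using uL[of x y] \<delta>(3)[of n] by linarith
      qed
      have "closed {x. \<epsilon> n / 2 \<le> u x}" by (intro closed_Collect_le continuous_intros cont)
      then have "closure {x. w n x \<noteq> 0} \<subseteq> {x. \<epsilon> n / 2 \<le> u x}"
        using pos by (intro closure_minimal) auto
      also have "\<dots> \<subseteq> \<Omega>"
      proof safe
        fix x assume "\<epsilon> n / 2 \<le> u x"
        then show "x \<in> \<Omega>" using zero[of x] \<epsilon>(1)[of n] by (cases "x \<in> \<Omega>") auto
      qed
      finally have cl: "closure {x. w n x \<noteq> 0} \<subseteq> \<Omega>" .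
      then have "bounded {x. w n x \<noteq> 0}"
        by (rule bounded_subset[OF bounded_dom order_trans[OF closure_subset]])
      with cl show ?thesis using w(1) by (simp add: C1c_iff)
    qed
    show "continuous_on UNIV u" by (rule cont)
    show "(\<lambda>n. w n x) \<longlonglongrightarrow> u x" for x
    proof -
      have "(\<lambda>n. 2 * \<epsilon> n) \<longlonglongrightarrow> 2 * 0" by (intro tendsto_intros \<epsilon>0)
      then have "(\<lambda>n. w n x - u x) \<longlonglongrightarrow> 0"
        by (intro Lim_null_comparison[of "\<lambda>n. w n x - u x" "\<lambda>n. 2 * \<epsilon> n"]) (use wu in auto)
      then show ?thesis by (simp add: LIM_zero_iff)
    qed
    show "\<bar>w n x - u x\<bar> \<le> max 2 L" for n x using wu[of n x] \<epsilon>(2)[of n] by linarith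
    show "\<bar>partial j (w n) x\<bar> \<le> max 2 L" for n j x using w(3)[of j n x] by linarith
    show "AE x in lebesgue_on \<Omega>. convergent (\<lambda>n. partial j (w n) x)" for j
      using aff
    proof eventually_elim
      case (elim x)
      then obtain r g where r: "r > 0" and g: "\<And>y. y \<in> ball x r \<Longrightarrow> u y = u x + g \<bullet> (y - x)" by blast
      have "\<exists>r'>0. \<exists>g'. \<forall>\<^sub>F n in sequentially. \<forall>y\<in>ball x r'. q n y = q n x + g' \<bullet> (y - x)"
      proof (cases "u x = 0")
        case True
        have "g = 0"
        proof (rule ccontr)
          assume "g \<noteq> 0"
          define s where "s = r / (2 * norm g)"
          have s: "s > 0" using r \<open>g \<noteq> 0\<close> by (simp add: s_def)
          have "x - s *\<^sub>R g \<in> ball x r" using r \<open>g \<noteq> 0\<close> by (simp add: dist_norm s_def)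
          then have "u (x - s *\<^sub>R g) = - (s * (g \<bullet> g))" using g True by simp
          moreover have "0 < s * (g \<bullet> g)" using s \<open>g \<noteq> 0\<close> by simp
          ultimately show False using nn[of "x - s *\<^sub>R g"] by linarith
        qed
        then have "q n y = q n x + 0 \<bullet> (y - x)" if "y \<in> ball x r" for n y
          using g[OF that] True \<epsilon>(1)[of n] by (simp add: q_def)
        then have "\<forall>\<^sub>F n in sequentially. \<forall>y\<in>ball x r. q n y = q n x + 0 \<bullet> (y - x)"
          by (intro always_eventually) blast
        then show ?thesis using r by blast
      next
        case False
        then have ux: "u x > 0" using nn[of x] by simp
        define r' where "r' = min r (u x / (2 * (L + 1)))"
        have "r' > 0" using r ux L0 by (simp add: r'_def)
        have low: "u x / 2 \<le> u y" if "y \<in> ball x r'" for y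
        proof -
          have "L * dist x y \<le> L * (u x / (2 * (L + 1)))"
            using that L0 by (intro mult_left_mono) (auto simp: r'_def)
          also have "\<dots> \<le> u x / 2" using L0 ux by (simp add: field_simps)
          finally show ?thesis using uL[of x y] by linarith
        qed
        have "\<forall>\<^sub>F n in sequentially. \<epsilon> n < u x / 2"
          by (rule order_tendstoD(2)[OF \<epsilon>0]) (use ux in simp)
        then have "\<forall>\<^sub>F n in sequentially. \<forall>y\<in>ball x r'. q n y = q n x + g \<bullet> (y - x)"
        proof eventually_elim
          case (elim n)
          show ?case
          proof
            fix y assume y: "y \<in> ball x r'"
            then have "u y = u x + g \<bullet> (y - x)" by (intro g) (simp add: r'_def)
            then show "q n y = q n x + g \<bullet> (y - x)"
              using low[OF y] elim ux by (simp add: q_def)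
          qed
        qed
        then show ?thesis using \<open>r' > 0\<close> by blast
      qed
      then obtain r' g' where r': "r' > 0"
        and ev: "\<forall>\<^sub>F n in sequentially. \<forall>y\<in>ball x r'. q n y = q n x + g' \<bullet> (y - x)" by blast
      have "\<forall>\<^sub>F n in sequentially. \<epsilon> n < r'" by (rule order_tendstoD(2)[OF \<epsilon>0 r'])
      with ev have "\<forall>\<^sub>F n in sequentially. partial j (w n) x = g' $ j"
      proof eventually_elim
        case (elim n)
        then show ?case using \<delta>(2)[of n] by (intro w(4)[of n r']) auto
      qed
      then have "(\<lambda>n. partial j (w n) x) \<longlonglongrightarrow> g' $ j" by (rule tendsto_eventually)
      then show ?case by (rule convergentI)
    qed
  qed
qed

end

section \<open>Piecewise affine functions and barycentric coordinates\<close>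

definition affine_on :: "(real^3) set \<Rightarrow> (real^3 \<Rightarrow> real) \<Rightarrow> bool" where
  "affine_on K u \<longleftrightarrow> (\<exists>a b. \<forall>x\<in>K. u x = a \<bullet> x + b)"

lemma affine_on_const: "affine_on K (\<lambda>_. c)"
  unfolding affine_on_def by (rule exI[of _ 0], rule exI[of _ c]) simp

lemma affine_on_add:
  assumes "affine_on K u" "affine_on K v" shows "affine_on K (\<lambda>x. u x + v x)"
proof -
  obtain a b a' b' where "\<forall>x\<in>K. u x = a \<bullet> x + b" "\<forall>x\<in>K. v x = a' \<bullet> x + b'"
    using assms by (auto simp: affine_on_def)
  then have "\<forall>x\<in>K. u x + v x = (a + a') \<bullet> x + (b + b')" by (auto simp: inner_add_left)
  then show ?thesis unfolding affine_on_def by blast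
qed

lemma affine_on_scale:
  assumes "affine_on K u" shows "affine_on K (\<lambda>x. c * u x)"
proof -
  obtain a b where "\<forall>x\<in>K. u x = a \<bullet> x + b" using assms by (auto simp: affine_on_def)
  then have "\<forall>x\<in>K. c * u x = (c *\<^sub>R a) \<bullet> x + (c * b)" by (auto simp: distrib_left)
  then show ?thesis unfolding affine_on_def by blast
qed

lemma affine_on_sum: "(\<And>i. i \<in> I \<Longrightarrow> affine_on K (u i)) \<Longrightarrow> affine_on K (\<lambda>x. \<Sum>i\<in>I. u i x)"
  by (induction I rule: infinite_finite_induct) (auto intro: affine_on_add affine_on_const)

lemma affine_on_cong: "(\<And>x. x \<in> K \<Longrightarrow> u x = v x) \<Longrightarrow> affine_on K u \<longleftrightarrow> affine_on K v"
  by (simp add: affine_on_def)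

lemma affine_on_subset: "\<lbrakk>affine_on K u; K' \<subseteq> K\<rbrakk> \<Longrightarrow> affine_on K' u"
  unfolding affine_on_def by blast

lemma affine_on_combination:
  fixes C :: "(real^3) set"
  assumes "affine_on UNIV l" "sum t C = 1"
  shows "l (\<Sum>v\<in>C. t v *\<^sub>R v) = (\<Sum>v\<in>C. t v * l v)"
proof -
  obtain a b where l: "\<And>x. l x = a \<bullet> x + b" using assms by (auto simp: affine_on_def)
  have "(\<Sum>v\<in>C. t v * l v) = (\<Sum>v\<in>C. a \<bullet> (t v *\<^sub>R v)) + (\<Sum>v\<in>C. t v) * b"
    by (simp add: l distrib_left sum.distrib sum_distrib_right)
  then show ?thesis using assms(2) by (simp add: l inner_sum_right)
qed

text \<open>
  Along a segment, \<open>u\<close> is Lipschitz on each of finitely many closed sets of parameters that cover the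
  segment, with the largest slope as common constant.
\<close>

lemma lipschitz_piecewise_affine:
  fixes u :: "real^3 \<Rightarrow> real"
  assumes fin: "finite I" and closed: "\<And>i. i \<in> I \<Longrightarrow> closed (S i)" and cover: "(\<Union>i\<in>I. S i) = UNIV"
    and aff: "\<And>i. i \<in> I \<Longrightarrow> affine_on (S i) u"
  shows "\<exists>L. L-lipschitz_on UNIV u"
proof -
  have "\<forall>i. \<exists>a b. i \<in> I \<longrightarrow> (\<forall>x\<in>S i. u x = a \<bullet> x + b)"
    using aff unfolding affine_on_def by blast
  then obtain a b where ab: "\<And>i x. \<lbrakk>i \<in> I; x \<in> S i\<rbrakk> \<Longrightarrow> u x = a i \<bullet> x + b i"
    by metis
  define L where "L = (\<Sum>i\<in>I. norm (a i))"
  have L: "norm (a i) \<le> L" if "i \<in> I" for i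
    unfolding L_def using fin that by (intro member_le_sum) auto
  have L0: "0 \<le> L" unfolding L_def by (intro sum_nonneg) auto
  have "L-lipschitz_on UNIV u"
  proof (rule lipschitz_onI[OF _ L0])
    fix x y :: "real^3"
    define \<gamma> where "\<gamma> t = x + t *\<^sub>R (y - x)" for t :: real
    have "(L * norm (y - x))-lipschitz_on {0..1} (\<lambda>t. u (\<gamma> t))"
    proof (rule lipschitz_on_closed_Union[where U = "\<lambda>i. \<gamma> -` S i" and I = I])
      show "closed (\<gamma> -` S i)" if "i \<in> I" for i
        unfolding \<gamma>_def by (intro continuous_closed_vimage closed that) (auto intro!: continuous_intros)
      show "(L * norm (y - x))-lipschitz_on (\<gamma> -` S i) (\<lambda>t. u (\<gamma> t))" if i: "i \<in> I" for i
      proof (rule lipschitz_onI)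
        fix s t assume st: "s \<in> \<gamma> -` S i" "t \<in> \<gamma> -` S i"
        have "u (\<gamma> s) - u (\<gamma> t) = (s - t) * (a i \<bullet> (y - x))"
          using ab[OF i, of "\<gamma> s"] ab[OF i, of "\<gamma> t"] st
          by (simp add: \<gamma>_def inner_add_right left_diff_distrib)
        moreover have "\<bar>a i \<bullet> (y - x)\<bar> \<le> L * norm (y - x)"
          using Cauchy_Schwarz_ineq2[of "a i" "y - x"] mult_right_mono[OF L[OF i] norm_ge_zero[of "y - x"]]
          by linarith
        ultimately show "dist (u (\<gamma> s)) (u (\<gamma> t)) \<le> L * norm (y - x) * dist s t"
          by (simp add: dist_real_def abs_mult mult.commute[of "\<bar>s - t\<bar>"] mult_right_mono)
      qed (use L0 in simp)
      have "\<gamma> t \<in> (\<Union>i\<in>I. S i)" for t using cover by simp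
      then show "{0..1} \<subseteq> (\<Union>i\<in>I. \<gamma> -` S i)" by blast
    qed (use fin L0 in auto)
    from lipschitz_onD[OF this, of 0 1]
    show "dist (u x) (u y) \<le> L * dist x y" by (simp add: \<gamma>_def dist_norm norm_minus_commute)
  qed
  then show ?thesis by blast
qed

definition bary :: "(real^3) set \<Rightarrow> real^3 \<Rightarrow> real^3 \<Rightarrow> real" where
  "bary C v = (SOME l. affine_on UNIV l \<and> l v = 1 \<and> (\<forall>w\<in>C - {v}. l w = 0))"

text \<open>
  The differences \<open>w - v\<close> are linearly independent, so some linear functional takes the value \<open>-1\<close> on
  all of them; translated to \<open>v\<close> and increased by \<open>1\<close>, it is the required coordinate.
\<close>

lemma
  assumes ind: "\<not> affine_dependent C" and v: "v \<in> C"
  shows bary_affine: "affine_on UNIV (bary C v)"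
    and bary_vertex: "w \<in> C \<Longrightarrow> bary C v w = (if w = v then 1 else 0)"
proof -
  have "\<not> dependent ((\<lambda>x. - v + x) ` (C - {v}))"
    using ind affine_dependent_iff_dependent2[OF v] by simp
  from linear_independent_extend[OF this, of "\<lambda>_. -1 :: real"]
  obtain g where g1: "linear g" "\<forall>y\<in>(\<lambda>x. - v + x) ` (C - {v}). g y = (- 1 :: real)" by blast
  then have g: "linear g" "\<And>w. w \<in> C - {v} \<Longrightarrow> g (- v + w) = - 1" by blast+
  define a where "a = adjoint g 1"
  have ga: "g x = a \<bullet> x" for x
    using adjoint_works[OF g(1), of x 1] by (simp add: a_def inner_commute)
  define l where "l x = a \<bullet> x + (1 - a \<bullet> v)" for x
  have "affine_on UNIV l" unfolding affine_on_def l_def by blast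
  moreover have "l v = 1" by (simp add: l_def)
  moreover have "\<forall>w\<in>C - {v}. l w = 0"
  proof
    fix w assume "w \<in> C - {v}"
    from g(2)[OF this] show "l w = 0" by (simp add: l_def ga inner_diff_right)
  qed
  ultimately have "\<exists>l. affine_on UNIV l \<and> l v = 1 \<and> (\<forall>w\<in>C - {v}. l w = 0)" by blast
  from someI_ex[OF this]
  show "affine_on UNIV (bary C v)" "w \<in> C \<Longrightarrow> bary C v w = (if w = v then 1 else 0)"
    unfolding bary_def by auto
qed

lemma bary_combination:
  assumes ind: "\<not> affine_dependent C" and v: "v \<in> C" and t: "sum t C = 1"
  shows "bary C v (\<Sum>w\<in>C. t w *\<^sub>R w) = t v"
proof -
  have "bary C v (\<Sum>w\<in>C. t w *\<^sub>R w) = (\<Sum>w\<in>C. t w * bary C v w)"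
    by (rule affine_on_combination[OF bary_affine[OF ind v] t])
  also have "\<dots> = (\<Sum>w\<in>C. if w = v then t w else 0)"
    by (intro sum.cong) (auto simp: bary_vertex[OF ind v])
  also have "\<dots> = t v" using v aff_independent_finite[OF ind] by simp
  finally show ?thesis .
qed

lemma
  assumes ind: "\<not> affine_dependent C" and card: "card C = 4"
  shows bary_sum: "(\<Sum>v\<in>C. bary C v x) = 1"
    and bary_expansion: "(\<Sum>v\<in>C. bary C v x *\<^sub>R v) = (x :: real^3)"
    and mem_simplex_iff: "x \<in> convex hull C \<longleftrightarrow> (\<forall>v\<in>C. 0 \<le> bary C v x)"
proof -
  note fin = aff_independent_finite[OF ind]
  have "affine hull C = UNIV" using card by (intro affine_independent_span_eq ind) simp
  then obtain t where t: "sum t C = 1" "(\<Sum>v\<in>C. t v *\<^sub>R v) = x"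
    using affine_hull_finite[OF fin] by auto
  then have tb: "t v = bary C v x" if "v \<in> C" for v
    using bary_combination[OF ind that t(1)] by simp
  show sum: "(\<Sum>v\<in>C. bary C v x) = 1" using t(1) tb by simp
  show exp: "(\<Sum>v\<in>C. bary C v x *\<^sub>R v) = x" using t(2) tb by simp
  show "x \<in> convex hull C \<longleftrightarrow> (\<forall>v\<in>C. 0 \<le> bary C v x)"
  proof
    assume "x \<in> convex hull C"
    then obtain s where s: "\<forall>v\<in>C. 0 \<le> s v" "sum s C = 1" "(\<Sum>v\<in>C. s v *\<^sub>R v) = x"
      using convex_hull_finite[OF fin] by auto
    then show "\<forall>v\<in>C. 0 \<le> bary C v x"
      using bary_combination[OF ind _ s(2)] by auto
  next
    assume "\<forall>v\<in>C. 0 \<le> bary C v x"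
    then show "x \<in> convex hull C"
      unfolding convex_hull_finite[OF fin]
      by (intro CollectI exI[of _ "\<lambda>v. bary C v x"] conjI sum exp)
  qed
qed

lemma affine_on_eq_hull:
  assumes "affine_on UNIV l" "affine_on UNIV m" "finite C" "\<And>w. w \<in> C \<Longrightarrow> l w = m w" "x \<in> convex hull C"
  shows "l x = m x"
proof -
  obtain s where "sum s C = 1" "(\<Sum>v\<in>C. s v *\<^sub>R v) = x"
    using assms(5) convex_hull_finite[OF assms(3)] by auto
  then show ?thesis
    using affine_on_combination[OF assms(1), of s C] affine_on_combination[OF assms(2), of s C] assms(4)
    by auto
qed

section \<open>Hat functions of a mesh\<close>

definition verts :: "(real^3) set \<Rightarrow> (real^3) set" where
  "verts K = {v. v extreme_point_of K}"

text \<open>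
  The nodal basis function of the vertex \<open>v\<close>. Any element that contains \<open>x\<close> and has the vertex \<open>v\<close>
  may serve: they all give the same value (\<open>bary_agree\<close>).
\<close>

definition hat :: "(real^3) set set \<Rightarrow> real^3 \<Rightarrow> real^3 \<Rightarrow> real" where
  "hat \<T> v x = (if \<exists>K\<in>\<T>. x \<in> K \<and> v \<in> verts K
     then bary (verts (SOME K. K \<in> \<T> \<and> x \<in> K \<and> v \<in> verts K)) v x else 0)"

locale simplicial_domain = bounded_open +
  fixes \<T> :: "(real^3) set set"
  assumes conforming: "conforming_mesh \<Omega> \<T>" and one_sided: "interior (closure \<Omega>) = \<Omega>"
begin

lemma finite_mesh: "finite \<T>"
  using conforming by (simp add: conforming_mesh_def triangulation_def)

lemma mesh_union: "\<Union>\<T> = closure \<Omega>"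
  using conforming by (simp add: conforming_mesh_def)

lemma
  assumes "K \<in> \<T>"
  shows verts_independent: "\<not> affine_dependent (verts K)"
    and card_verts: "card (verts K) = 4"
    and simplex_eq_hull: "K = convex hull (verts K)"
proof -
  have "3 simplex K" using conforming assms by (simp add: conforming_mesh_def)
  then obtain C where C: "\<not> affine_dependent C" "card C = 4" "K = convex hull C"
    unfolding simplex_def by force
  then have "verts K = C"
    by (auto simp: verts_def extreme_point_of_convex_hull_affine_independent)
  then show "\<not> affine_dependent (verts K)" "card (verts K) = 4" "K = convex hull (verts K)"
    using C by auto
qed

lemma finite_verts: "K \<in> \<T> \<Longrightarrow> finite (verts K)"
  by (rule aff_independent_finite[OF verts_independent])

lemma compact_simplex:
  assumes "K \<in> \<T>" shows "compact K"
proof -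
  have "compact (convex hull (verts K))"
    by (intro compact_convex_hull finite_imp_compact finite_verts assms)
  then show ?thesis by (simp only: simplex_eq_hull[OF assms, symmetric])
qed

lemma convex_simplex:
  assumes "K \<in> \<T>" shows "convex K"
proof -
  have "convex (convex hull (verts K))" by (rule convex_convex_hull)
  then show ?thesis by (simp only: simplex_eq_hull[OF assms, symmetric])
qed

lemma mem_simplex:
  assumes "K \<in> \<T>"
  shows "x \<in> K \<longleftrightarrow> (\<forall>v\<in>verts K. 0 \<le> bary (verts K) v x)"
proof -
  have "x \<in> K \<longleftrightarrow> x \<in> convex hull (verts K)"
    by (rule arg_cong[where f = "\<lambda>S. x \<in> S", OF simplex_eq_hull[OF assms]])
  also have "\<dots> \<longleftrightarrow> (\<forall>v\<in>verts K. 0 \<le> bary (verts K) v x)"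
    by (rule mem_simplex_iff[OF verts_independent[OF assms] card_verts[OF assms]])
  finally show ?thesis .
qed

lemma verts_subset: "v \<in> verts K \<Longrightarrow> v \<in> K"
  by (simp add: verts_def extreme_point_of_def)

lemma face_Int: "\<lbrakk>K \<in> \<T>; K' \<in> \<T>\<rbrakk> \<Longrightarrow> (K \<inter> K') face_of K"
  using conforming by (simp add: conforming_mesh_def triangulation_def)

lemma verts_Int:
  assumes "K \<in> \<T>" "K' \<in> \<T>" "v \<in> verts K" "v \<in> K'" shows "v \<in> verts K'"
proof -
  have "v extreme_point_of (K \<inter> K')"
    using assms verts_subset extreme_point_of_face[OF face_Int[OF assms(1,2)]]
    by (auto simp: verts_def)
  then show ?thesis
    using extreme_point_of_face[OF face_Int[OF assms(2,1)]] by (auto simp: verts_def Int_commute)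
qed

text \<open>
  The intersection of the two elements is a face of both, hence the convex hull of common vertices, and
  there the two affine functions take the same nodal values.
\<close>

lemma bary_agree:
  assumes K: "K \<in> \<T>" "K' \<in> \<T>" and v: "v \<in> verts K" and x: "x \<in> K" "x \<in> K'"
  shows "bary (verts K) v x = (if v \<in> verts K' then bary (verts K') v x else 0)"
proof -
  note ind = verts_independent[OF K(1)] and ind' = verts_independent[OF K(2)]
  have "(K \<inter> K') face_of (convex hull (verts K))"
    using face_Int[OF K] by (simp only: simplex_eq_hull[OF K(1), symmetric])
  then obtain c where c: "c \<subseteq> verts K" "K \<inter> K' = convex hull c"
    using face_of_convex_hull_affine_independent[OF ind] by auto
  have cK': "c \<subseteq> verts K'"
    using c verts_Int[OF K] hull_subset[of c convex] by blast
  have fin: "finite c" using c(1) finite_verts[OF K(1)] finite_subset by blast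
  have xc: "x \<in> convex hull c" using x c(2) by auto
  show ?thesis
  proof (cases "v \<in> verts K'")
    case True
    then show ?thesis
      using affine_on_eq_hull[OF bary_affine[OF ind v] bary_affine[OF ind' True] fin _ xc]
        bary_vertex[OF ind v] bary_vertex[OF ind' True] c(1) cK'
      by (simp add: subset_iff)
  next
    case False
    then show ?thesis
      using affine_on_eq_hull[OF bary_affine[OF ind v] affine_on_const fin _ xc, of 0]
        bary_vertex[OF ind v] c(1) cK'
      by (simp add: subset_iff) metis
  qed
qed

lemma hat_on_simplex:
  assumes K: "K \<in> \<T>" "x \<in> K"
  shows "hat \<T> v x = (if v \<in> verts K then bary (verts K) v x else 0)"
proof (cases "\<exists>K\<in>\<T>. x \<in> K \<and> v \<in> verts K")
  case True
  define K' where "K' = (SOME K. K \<in> \<T> \<and> x \<in> K \<and> v \<in> verts K)"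
  have "\<exists>K. K \<in> \<T> \<and> x \<in> K \<and> v \<in> verts K" using True by blast
  from someI_ex[OF this] have K': "K' \<in> \<T>" "x \<in> K'" "v \<in> verts K'" by (auto simp: K'_def)
  have "hat \<T> v x = bary (verts K') v x" using True by (simp add: hat_def K'_def)
  then show ?thesis using bary_agree[OF K'(1) K(1) K'(3,2) K(2)] by simp
next
  case False
  then show ?thesis using K by (auto simp: hat_def)
qed

lemma hat_affine_on_simplex:
  assumes "K \<in> \<T>" shows "affine_on K (hat \<T> v)"
proof (cases "v \<in> verts K")
  case True
  have "affine_on K (bary (verts K) v)"
    by (rule affine_on_subset[OF bary_affine[OF verts_independent[OF assms] True]]) simp
  moreover have "affine_on K (hat \<T> v) \<longleftrightarrow> affine_on K (bary (verts K) v)"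
    by (rule affine_on_cong) (simp add: hat_on_simplex[OF assms] True)
  ultimately show ?thesis by simp
next
  case False
  have "affine_on K (hat \<T> v) \<longleftrightarrow> affine_on K (\<lambda>_. 0)"
    by (rule affine_on_cong) (simp add: hat_on_simplex[OF assms] False)
  then show ?thesis by (simp add: affine_on_const)
qed

lemma hat_nonneg: "0 \<le> hat \<T> v x"
proof (cases "\<exists>K\<in>\<T>. x \<in> K \<and> v \<in> verts K")
  case True
  then obtain K where K: "K \<in> \<T>" "x \<in> K" "v \<in> verts K" by blast
  then have "0 \<le> bary (verts K) v x" using mem_simplex[OF K(1)] by blast
  then show ?thesis using hat_on_simplex[OF K(1,2)] by simp
next
  case False
  then have "hat \<T> v x = 0" unfolding hat_def by (rule if_not_P)
  then show ?thesis by simp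
qed

lemma hat_continuous: "continuous_on (\<Union>\<T>) (hat \<T> v)"
proof -
  have "continuous_on K (hat \<T> v)" if "K \<in> \<T>" for K
  proof -
    obtain a b where "\<forall>x\<in>K. hat \<T> v x = a \<bullet> x + b"
      using hat_affine_on_simplex[OF \<open>K \<in> \<T>\<close>, of v] by (auto simp: affine_on_def)
    then have "continuous_on K (hat \<T> v) \<longleftrightarrow> continuous_on K (\<lambda>x. a \<bullet> x + b)"
      by (intro continuous_on_cong) auto
    then show ?thesis by (simp add: continuous_intros)
  qed
  then show ?thesis
    using continuous_on_closed_Union[OF finite_mesh, of "\<lambda>K. K" "hat \<T> v"]
      compact_imp_closed[OF compact_simplex] by simp
qed

lemma frontier_dom: "frontier \<Omega> = closure \<Omega> - \<Omega>"
  using open_dom by (simp add: frontier_def interior_open)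

text \<open>
  The homothety \<open>\<gamma>\<close> with centre \<open>v\<close> and a small ratio \<open>t\<close> moves \<open>x\<close> into a ball around \<open>v\<close> that meets only
  elements with vertex \<open>v\<close>, and there the hat function exceeds \<open>1 - t\<close> at \<open>\<gamma> x\<close>. By continuity it does so
  near \<open>\<gamma> x\<close>. A point \<open>\<gamma> y\<close> of an element at which the hat function exceeds \<open>1 - t\<close> is the image of a
  point \<open>y\<close> of the same element, so a neighbourhood of \<open>x\<close> is covered by the mesh. That \<open>\<Omega>\<close> is the
  interior of its closure finishes the proof.
\<close>

lemma hat_positive_interior:
  assumes v: "v \<in> \<Omega>" and x: "x \<in> closure \<Omega>" "hat \<T> v x > 0"
  shows "x \<in> \<Omega>"
proof -
  obtain K where K: "K \<in> \<T>" "x \<in> K" using x(1) mesh_union by blast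
  have vK: "v \<in> verts K" using hat_on_simplex[OF K, of v] x(2) by (auto split: if_splits)
  define F where "F = \<Union>{K' \<in> \<T>. v \<notin> K'}"
  have "closed F"
    unfolding F_def using finite_mesh compact_simplex compact_imp_closed by (intro closed_Union) auto
  then have "open (\<Omega> - F)" using open_dom by (intro open_Diff)
  moreover have "v \<in> \<Omega> - F" using v by (auto simp: F_def)
  ultimately obtain r where r: "r > 0" "ball v r \<subseteq> \<Omega> - F" by (auto simp: open_contains_ball)
  define t where "t = min 1 (r / (2 * (norm (x - v) + 1)))"
  have t: "0 < t" "t \<le> 1" using r(1) by (auto simp: t_def add_nonneg_pos)
  define \<gamma> where "\<gamma> y = v + t *\<^sub>R (y - v)" for y
  have "norm (x - v) * t \<le> norm (x - v) * (r / (2 * (norm (x - v) + 1)))"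
    by (intro mult_left_mono) (auto simp: t_def)
  also have "\<dots> < r"
  proof -
    have "n < 2 * (n + 1)" "0 < 2 * (n + 1)" if "0 \<le> n" for n :: real using that by simp_all
    from this[OF norm_ge_zero] have lt: "norm (x - v) < 2 * (norm (x - v) + 1)" and "0 < 2 * (norm (x - v) + 1)"
      by blast+
    moreover have "norm (x - v) * r < (2 * (norm (x - v) + 1)) * r"
      by (rule mult_strict_right_mono[OF lt r(1)])
    ultimately show ?thesis by (simp add: pos_divide_less_eq mult.commute)
  qed
  finally have \<gamma>x: "\<gamma> x \<in> ball v r" by (simp add: \<gamma>_def dist_norm abs_of_pos[OF t(1)] mult.commute)
  have scale: "bary (verts K') w (\<gamma> y) = (1 - t) * (if w = v then 1 else 0) + t * bary (verts K') w y"
    if "K' \<in> \<T>" "v \<in> verts K'" "w \<in> verts K'" for K' w y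
  proof -
    note ind = verts_independent[OF \<open>K' \<in> \<T>\<close>]
    obtain a b where ab: "\<And>y. bary (verts K') w y = a \<bullet> y + b"
      using bary_affine[OF ind \<open>w \<in> verts K'\<close>] by (auto simp: affine_on_def)
    have "a \<bullet> v + b = (if w = v then 1 else 0)"
      using bary_vertex[OF ind \<open>w \<in> verts K'\<close> \<open>v \<in> verts K'\<close>] by (auto simp: ab)
    moreover have "bary (verts K') w (\<gamma> y) = (1 - t) * (a \<bullet> v + b) + t * (a \<bullet> y + b)"
      by (simp add: ab \<gamma>_def inner_add_right inner_diff_right algebra_simps)
    ultimately show ?thesis by (simp only: ab)
  qed
  have \<gamma>K: "\<gamma> x \<in> K"
  proof -
    have "\<gamma> x = (1 - t) *\<^sub>R v + t *\<^sub>R x" by (simp add: \<gamma>_def algebra_simps)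
    then show ?thesis
      using convexD_alt[OF convex_simplex[OF K(1)] verts_subset[OF vK] K(2), of t] t by simp
  qed
  have "hat \<T> v (\<gamma> x) > 1 - t"
    using hat_on_simplex[OF K(1) \<gamma>K, of v] hat_on_simplex[OF K, of v] scale[OF K(1) vK vK, of x] vK x(2) t
    by simp
  have ballT: "ball v r \<subseteq> \<Union>\<T>" using r(2) closure_subset mesh_union by blast
  define E where "E = \<gamma> -` (hat \<T> v -` {1 - t<..} \<inter> ball v r)"
  have "open (hat \<T> v -` {1 - t<..} \<inter> ball v r)"
    using continuous_on_subset[OF hat_continuous ballT, of v]
    by (simp add: continuous_on_open_vimage[OF open_ball])
  moreover have "continuous_on UNIV \<gamma>" unfolding \<gamma>_def by (intro continuous_intros)
  ultimately have "open E" unfolding E_def by (rule open_vimage)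
  moreover have "x \<in> E" using \<gamma>x \<open>hat \<T> v (\<gamma> x) > 1 - t\<close> by (simp add: E_def)
  moreover have "E \<subseteq> \<Union>\<T>"
  proof
    fix y assume "y \<in> E"
    then have elim: "hat \<T> v (\<gamma> y) > 1 - t" "\<gamma> y \<in> ball v r" by (auto simp: E_def)
    obtain K' where K': "K' \<in> \<T>" "\<gamma> y \<in> K'" using elim(2) ballT by blast
    have "v \<in> K'" using elim r(2) K' by (auto simp: F_def)
    then have vK': "v \<in> verts K'" using verts_Int[OF K(1) K'(1) vK] by simp
    have "0 \<le> bary (verts K') w y" if w: "w \<in> verts K'" for w
    proof (cases "w = v")
      case True
      have "1 - t < (1 - t) + t * bary (verts K') v y"
        using elim hat_on_simplex[OF K', of v] vK' scale[OF K'(1) vK' vK', of y] by simp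
      then show ?thesis using t True by (simp add: zero_less_mult_iff)
    next
      case False
      have "0 \<le> bary (verts K') w (\<gamma> y)"
        using K' w mem_simplex[OF K'(1)] by blast
      then show ?thesis using scale[OF K'(1) vK' w, of y] False t by (simp add: zero_le_mult_iff)
    qed
    then have "y \<in> K'" using mem_simplex[OF K'(1)] by blast
    then show "y \<in> \<Union>\<T>" using K'(1) by blast
  qed
  ultimately have "x \<in> interior (\<Union>\<T>)" by (rule interiorI)
  then show ?thesis using mesh_union one_sided by simp
qed

lemma hat_zero_outside:
  assumes "v \<in> \<Omega>" "x \<notin> \<Omega>" shows "hat \<T> v x = 0"
proof (cases "x \<in> closure \<Omega>")
  case True
  then have "\<not> hat \<T> v x > 0" using hat_positive_interior[OF assms(1)] assms(2) by blast
  then show ?thesis using hat_nonneg[of v x] by linarith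
next
  case False
  then have "x \<notin> \<Union>\<T>" using mesh_union by simp
  then have "\<not> (\<exists>K\<in>\<T>. x \<in> K \<and> v \<in> verts K)" by blast
  then show ?thesis unfolding hat_def by (rule if_not_P)
qed

text \<open>
  The complement of \<open>\<Omega>\<close>, where the hat function vanishes, serves as one more closed piece.
\<close>

lemma hat_lipschitz:
  assumes "v \<in> \<Omega>" shows "\<exists>L. L-lipschitz_on UNIV (hat \<T> v)"
proof (rule lipschitz_piecewise_affine[of "insert (- \<Omega>) \<T>" "\<lambda>K. K"])
  show "finite (insert (- \<Omega>) \<T>)" using finite_mesh by simp
  show "closed K" if "K \<in> insert (- \<Omega>) \<T>" for K
    using that by (elim insertE) (simp_all add: closed_Compl open_dom compact_imp_closed compact_simplex)
  show "(\<Union>K\<in>insert (- \<Omega>) \<T>. K) = UNIV"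
  proof -
    have "\<Omega> \<subseteq> \<Union>\<T>" unfolding mesh_union by (rule closure_subset)
    then show ?thesis by auto
  qed
  have "affine_on (- \<Omega>) (hat \<T> v) \<longleftrightarrow> affine_on (- \<Omega>) (\<lambda>_. 0)"
    by (rule affine_on_cong) (simp add: hat_zero_outside[OF assms])
  then have "affine_on (- \<Omega>) (hat \<T> v)" by (simp add: affine_on_const)
  then show "affine_on K (hat \<T> v)" if "K \<in> insert (- \<Omega>) \<T>" for K
    using that hat_affine_on_simplex by auto
qed

lemma AE_interior_simplex: "AE x in lebesgue. \<forall>K\<in>\<T>. x \<in> K \<longrightarrow> x \<in> interior K"
proof -
  have "negligible (\<Union>(frontier ` \<T>))"
    using finite_mesh convex_simplex by (intro negligible_Union) (auto intro: negligible_convex_frontier)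
  then have "\<Union>(frontier ` \<T>) \<in> null_sets lebesgue" by (simp add: negligible_iff_null_sets)
  from AE_not_in[OF this] show ?thesis
    by eventually_elim (use closure_subset in \<open>auto simp: frontier_def\<close>)
qed

lemma hat_H10:
  assumes "v \<in> \<Omega>" shows "hat \<T> v \<in> H10 \<Omega>"
proof -
  obtain L where L: "L-lipschitz_on UNIV (hat \<T> v)" using hat_lipschitz[OF assms] by blast
  show ?thesis
  proof (rule H10_piecewise_affine[OF L hat_nonneg hat_zero_outside[OF assms]])
    show "AE x in lebesgue_on \<Omega>. \<exists>r>0. \<exists>g. \<forall>y\<in>ball x r. hat \<T> v y = hat \<T> v x + g \<bullet> (y - x)"
      unfolding AE_dom_iff using AE_interior_simplex
    proof eventually_elim
      case (elim x)
      show ?case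
      proof
        assume "x \<in> \<Omega>"
        then obtain K where K: "K \<in> \<T>" "x \<in> interior K" using elim closure_subset[of \<Omega>] mesh_union by blast
        then obtain r where r: "r > 0" "ball x r \<subseteq> K" by (auto simp: mem_interior)
        obtain a b where ab: "\<And>y. y \<in> K \<Longrightarrow> hat \<T> v y = a \<bullet> y + b"
          using hat_affine_on_simplex[OF K(1), of v] by (auto simp: affine_on_def)
        have "hat \<T> v y = hat \<T> v x + a \<bullet> (y - x)" if "y \<in> ball x r" for y
          using ab[of y] ab[of x] that r by (auto simp: inner_diff_right subset_iff)
        then show "\<exists>r>0. \<exists>g. \<forall>y\<in>ball x r. hat \<T> v y = hat \<T> v x + g \<bullet> (y - x)"
          using r(1) by blast
      qed
    qed
  qed
qed

end

section \<open>The interpolated rotation field\<close>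

lemma affine_poly_fun:
  assumes k: "k \<ge> 1"
  shows "(\<lambda>x. a \<bullet> x + b) \<in> poly_fun k"
proof -
  define A where "A = {\<alpha> :: 3 \<Rightarrow> nat. (\<Sum>i\<in>UNIV. \<alpha> i) \<le> k}"
  \<comment> \<open>the multi-index of the monomial \<open>x\<^sub>i\<close>\<close>
  define e where "e i = (\<lambda>j :: 3. if j = i then 1 else 0 :: nat)" for i
  define c where "c \<alpha> = (if \<alpha> = (\<lambda>_. 0) then b else 0) + (\<Sum>i\<in>UNIV. if \<alpha> = e i then a $ i else 0)" for \<alpha>
  have "A \<subseteq> PiE UNIV (\<lambda>_. {..k})"
  proof
    fix \<alpha> assume "\<alpha> \<in> A"
    then have "\<alpha> i \<le> k" for i
      using member_le_sum[of i UNIV \<alpha>] by (simp add: A_def)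
    then show "\<alpha> \<in> PiE UNIV (\<lambda>_. {..k})" by (auto simp: PiE_def)
  qed
  then have fin: "finite A" by (rule finite_subset) (intro finite_PiE, auto)
  have A0: "(\<lambda>_. 0) \<in> A" by (simp add: A_def)
  have Ae: "e i \<in> A" for i using k by (simp add: A_def e_def)
  have "a \<bullet> x + b = (\<Sum>\<alpha>\<in>A. c \<alpha> * (\<Prod>i\<in>UNIV. (x $ i) ^ \<alpha> i))" for x
  proof -
    have me: "(\<Prod>j\<in>UNIV. (x $ j) ^ e i j) = x $ i" for i
    proof -
      have "(\<Prod>j\<in>UNIV. (x $ j) ^ e i j) = (\<Prod>j\<in>UNIV. if j = i then x $ j else 1)"
        by (intro prod.cong) (auto simp: e_def)
      then show ?thesis by simp
    qed
    have "(\<Sum>\<alpha>\<in>A. c \<alpha> * (\<Prod>i\<in>UNIV. (x $ i) ^ \<alpha> i)) =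
       (\<Sum>\<alpha>\<in>A. if \<alpha> = (\<lambda>_. 0) then b * (\<Prod>i\<in>UNIV. (x $ i) ^ \<alpha> i) else 0)
       + (\<Sum>\<alpha>\<in>A. \<Sum>i\<in>UNIV. if \<alpha> = e i then a $ i * (\<Prod>i\<in>UNIV. (x $ i) ^ \<alpha> i) else 0)"
      unfolding sum.distrib[symmetric]
      by (intro sum.cong refl) (simp add: c_def distrib_right sum_distrib_right if_distrib[of "\<lambda>y. y * _"] cong: if_cong)
    also have "(\<Sum>\<alpha>\<in>A. if \<alpha> = (\<lambda>_. 0) then b * (\<Prod>i\<in>UNIV. (x $ i) ^ \<alpha> i) else 0) = b"
      using fin A0 by simp
    also have "(\<Sum>\<alpha>\<in>A. \<Sum>i\<in>UNIV. if \<alpha> = e i then a $ i * (\<Prod>i\<in>UNIV. (x $ i) ^ \<alpha> i) else 0) = a \<bullet> x"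
      using fin Ae by (subst sum.swap) (simp add: me inner_vec_def)
    finally show ?thesis by simp
  qed
  then show ?thesis unfolding poly_fun_def A_def by (intro image_eqI[of _ _ c]) auto
qed

lemma affine_on_Pk:
  assumes "k \<ge> 1" "\<And>K. K \<in> \<T> \<Longrightarrow> affine_on K u" shows "u \<in> Pk \<T> k"
  unfolding Pk_def
proof (intro CollectI ballI)
  fix K assume "K \<in> \<T>"
  then obtain a b where ab: "\<And>x. x \<in> K \<Longrightarrow> u x = a \<bullet> x + b"
    using assms(2)[OF \<open>K \<in> \<T>\<close>] by (auto simp: affine_on_def)
  show "\<exists>p\<in>poly_fun k. AE x in lebesgue_on K. u x = p x"
    by (rule bexI[OF _ affine_poly_fun[OF assms(1), of a b]]) (auto intro!: AE_I2 simp: ab)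
qed

lemma affine_on_rot_field: "affine_on K (\<lambda>x. rot_field i x $ j)"
  unfolding affine_on_def rot_field_component by (rule exI[of _ "rot_coeff i j"], rule exI[of _ 0]) simp

context simplicial_domain begin

abbreviation "strip \<equiv> boundary_strip \<Omega> \<T>"

text \<open>
  The nodal interpolant of \<open>x \<times> e\<^sub>i\<close> with the nodal values on the boundary replaced by zero.
\<close>

definition rot_interp :: "3 \<Rightarrow> real^3 \<Rightarrow> real^3" where
  "rot_interp i x = (\<chi> j. \<Sum>v\<in>\<Union>(verts ` \<T>) \<inter> \<Omega>. (rot_field i v $ j) * hat \<T> v x)"

lemma rot_interp_Xsp: "rot_interp i \<in> Xsp \<Omega>"
  unfolding Xsp_iff rot_interp_def by (auto intro!: H10_sum H10_scale hat_H10)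

lemma rot_interp_Xh: "k \<ge> 1 \<Longrightarrow> rot_interp i \<in> Xh \<Omega> \<T> k"
  unfolding Xh_def Pkvec_def using rot_interp_Xsp
  by (auto simp: rot_interp_def intro!: affine_on_Pk affine_on_sum affine_on_scale hat_affine_on_simplex)

lemma rot_interp_eq:
  assumes "x \<in> \<Omega> - strip" shows "rot_interp i x = rot_field i x"
proof -
  obtain K where K: "K \<in> \<T>" "x \<in> K"
    using assms mesh_union closure_subset[of \<Omega>] by blast
  then have "K \<inter> frontier \<Omega> = {}"
    using assms by (auto simp: boundary_strip_def)
  moreover have "K \<subseteq> closure \<Omega>" using K(1) mesh_union by blast
  ultimately have "K \<subseteq> \<Omega>" by (auto simp: frontier_dom)
  then have vK: "verts K \<subseteq> \<Union>(verts ` \<T>) \<inter> \<Omega>" using K(1) verts_subset by blast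
  note ind = verts_independent[OF K(1)] and card = card_verts[OF K(1)]
  have "rot_interp i x $ j = rot_field i x $ j" for j
  proof -
    have "rot_interp i x $ j = (\<Sum>v\<in>\<Union>(verts ` \<T>) \<inter> \<Omega>. rot_field i v $ j * (if v \<in> verts K then bary (verts K) v x else 0))"
      by (simp add: rot_interp_def hat_on_simplex[OF K])
    also have "\<dots> = (\<Sum>v\<in>verts K. rot_field i v $ j * bary (verts K) v x)"
      using finite_mesh finite_verts vK by (intro sum.mono_neutral_cong_right) auto
    also have "\<dots> = rot_field i (\<Sum>v\<in>verts K. bary (verts K) v x *\<^sub>R v) $ j"
      by (subst affine_on_combination[OF affine_on_rot_field bary_sum[OF ind card]]) (simp add: mult.commute)
    also have "\<dots> = rot_field i x $ j" by (simp add: bary_expansion[OF ind card])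
    finally show ?thesis .
  qed
  then show ?thesis by (simp add: vec_eq_iff)
qed

lemma closed_strip_union: "closed (\<Union>{K \<in> \<T>. K \<inter> frontier \<Omega> \<noteq> {}})"
  using finite_mesh compact_simplex by (intro closed_Union) (auto intro: compact_imp_closed)

lemma strip_complement_open: "open (\<Omega> - strip)"
proof -
  have "\<Omega> - strip = \<Omega> - \<Union>{K \<in> \<T>. K \<inter> frontier \<Omega> \<noteq> {}}" by (auto simp: boundary_strip_def)
  then show ?thesis using open_dom closed_strip_union by (simp add: open_Diff)
qed

lemma strip_sets: "strip \<in> sets lebesgue"
  unfolding boundary_strip_def using closed_strip_union open_dom
  by (intro sets.Int) (auto simp: borel_closed borel_open)

lemma AE_strip_iff: "(AE x in lebesgue_on strip. P x) \<longleftrightarrow> (AE x in lebesgue. x \<in> strip \<longrightarrow> P x)"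
  using strip_sets by (subst AE_restrict_space_iff) auto

lemma AE_off_strip_iff: "(AE x in lebesgue_on (\<Omega> - strip). P x) \<longleftrightarrow> (AE x in lebesgue. x \<in> \<Omega> - strip \<longrightarrow> P x)"
proof -
  have "\<Omega> - strip \<in> sets lebesgue" using strip_complement_open by (simp add: borel_open)
  then show ?thesis by (subst AE_restrict_space_iff) auto
qed

text \<open>
  The strip is closed relative to \<open>\<Omega>\<close>, whereas locality of weak derivatives speaks about open sets. The
  interiors of the elements of the strip form an open set that differs from it by a null set.
\<close>

lemma wpartial_strip:
  assumes "u \<in> H1 \<Omega>" "AE x in lebesgue. x \<in> strip \<longrightarrow> u x = 0"
  shows "AE x in lebesgue. x \<in> strip \<longrightarrow> wpartial \<Omega> j u x = 0"
proof -
  define U where "U = \<Omega> \<inter> \<Union>(interior ` {K \<in> \<T>. K \<inter> frontier \<Omega> \<noteq> {}})"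
  have US: "U \<subseteq> strip" using interior_subset by (fastforce simp: U_def boundary_strip_def)
  have "AE x in lebesgue. x \<in> U \<longrightarrow> wpartial \<Omega> j u x = partial j (\<lambda>_. 0) x"
  proof (rule wpartial_local[OF assms(1) C1_const])
    show "open U" unfolding U_def using open_dom by (intro open_Int) auto
    show "U \<subseteq> \<Omega>" by (auto simp: U_def)
    show "AE x in lebesgue. x \<in> U \<longrightarrow> u x = 0"
      using assms(2) by eventually_elim (use US in auto)
  qed
  with AE_interior_simplex show ?thesis
    by eventually_elim (auto simp: U_def boundary_strip_def partial_const)
qed

lemma wpartial_rot_interp:
  "AE x in lebesgue. x \<in> \<Omega> - strip \<longrightarrow> wpartial \<Omega> b (\<lambda>x. rot_interp i x $ j) x = rot_coeff i j $ b"
proof -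
  have H1: "(\<lambda>x. rot_interp i x $ j) \<in> H1 \<Omega>"
    using rot_interp_Xsp H10_H1 by (simp add: Xsp_iff)
  have "AE x in lebesgue. x \<in> \<Omega> - strip \<longrightarrow> wpartial \<Omega> b (\<lambda>x. rot_interp i x $ j) x = partial b (\<lambda>x. rot_field i x $ j) x"
    by (rule wpartial_local[OF H1 rot_field_C1 strip_complement_open]) (auto simp: rot_interp_eq)
  then show ?thesis by (simp add: partial_rot_field)
qed

lemma strip_or_interp:
  assumes "vanishes_on strip v"
  shows "AE x in lebesgue_on \<Omega>. v x = 0 \<or> rot_interp i x = rot_field i x"
  using assms unfolding vanishes_on_def AE_strip_iff AE_dom_iff
  by eventually_elim (use rot_interp_eq in blast)

text \<open>
  Each summand of the integrand contains a factor \<open>u\<close>, which vanishes where the interpolant differs from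
  the rotation field.
\<close>

lemma emac_rot_interp:
  assumes u: "u \<in> Xsp \<Omega>" and zero: "vanishes_on strip u"
  shows "emac \<Omega> u u (rot_interp i) = 0"
proof -
  have H1: "(\<lambda>y. u y $ a) \<in> H1 \<Omega>" for a using u H10_H1 by (simp add: Xsp_iff)
  define d where "d a b x = wpartial \<Omega> b (\<lambda>y. u y $ a) x" for a b x
  define U where "U a x = u x $ a" for a x
  define R where "R a x = rot_field i x $ a" for a x
  have meas: "d a b \<in> borel_measurable (lebesgue_on \<Omega>)" "U a \<in> borel_measurable (lebesgue_on \<Omega>)"
     "R a \<in> borel_measurable (lebesgue_on \<Omega>)" "(\<lambda>x. rot_interp i x $ a) \<in> borel_measurable (lebesgue_on \<Omega>)" for a b
    unfolding d_def U_def R_def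
    by (intro L2_measurable wpartial_L2 H1_L2 H1 L2_component rot_field_L2 Xsp_L2 rot_interp_Xsp)+
  have intd: "integrable (lebesgue_on \<Omega>) (\<lambda>x. d a b x * U c x * R e x)" for a b c e
  proof -
    have "integrable (lebesgue_on \<Omega>) (\<lambda>x. d a b x * (U c x * R e x))"
      unfolding d_def U_def R_def
      by (intro L2_integrable_mult wpartial_L2 H1 L2_mult_continuous H1_L2 C1_continuous rot_field_C1)
    then show ?thesis by (simp add: mult.assoc)
  qed
  have swap: "AE x in lebesgue_on \<Omega>. \<forall>a b. U a x * rot_interp i x $ b = U a x * R b x"
    using strip_or_interp[OF zero, of i] by eventually_elim (auto simp: U_def R_def)
  have 1: "ip \<Omega> (\<lambda>x. 2 *\<^sub>R (sym_grad \<Omega> u x *v u x)) (rot_interp i) =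
     (LINT x|lebesgue_on \<Omega>. (\<Sum>a\<in>UNIV. \<Sum>b\<in>UNIV. d a b x * U b x * R a x + d b a x * U b x * R a x))"
  proof -
    have "(2 *\<^sub>R (sym_grad \<Omega> u x *v u x)) \<bullet> z = (\<Sum>a\<in>UNIV. \<Sum>b\<in>UNIV. (d a b x + d b a x) * (U b x * z $ a))" for x z
      by (simp add: inner_vec_def matrix_vector_mult_def sym_grad_def wjac_def transpose_def d_def U_def
          sum_distrib_left sum_distrib_right algebra_simps)
    then have "ip \<Omega> (\<lambda>x. 2 *\<^sub>R (sym_grad \<Omega> u x *v u x)) (rot_interp i) =
      (LINT x|lebesgue_on \<Omega>. (\<Sum>a\<in>UNIV. \<Sum>b\<in>UNIV. (d a b x + d b a x) * (U b x * rot_interp i x $ a)))"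
      by (simp add: ip_def)
    also have "\<dots> = (LINT x|lebesgue_on \<Omega>. (\<Sum>a\<in>UNIV. \<Sum>b\<in>UNIV. d a b x * U b x * R a x + d b a x * U b x * R a x))"
    proof (rule integral_cong_AE)
      show "AE x in lebesgue_on \<Omega>. (\<Sum>a\<in>UNIV. \<Sum>b\<in>UNIV. (d a b x + d b a x) * (U b x * rot_interp i x $ a))
         = (\<Sum>a\<in>UNIV. \<Sum>b\<in>UNIV. d a b x * U b x * R a x + d b a x * U b x * R a x)"
        using swap
      proof eventually_elim
        case (elim x)
        then have e: "U a x * rot_interp i x $ b = U a x * R b x" for a b by blast
        show ?case by (simp only: e distrib_right mult.assoc)
      qed
    qed (intro borel_measurable_sum borel_measurable_times borel_measurable_add meas)+
    finally show ?thesis .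
  qed
  have 2: "ip \<Omega> (\<lambda>x. wdiv \<Omega> u x *\<^sub>R u x) (rot_interp i) =
     (LINT x|lebesgue_on \<Omega>. (\<Sum>a\<in>UNIV. \<Sum>b\<in>UNIV. d b b x * U a x * R a x))"
  proof -
    have "ip \<Omega> (\<lambda>x. wdiv \<Omega> u x *\<^sub>R u x) (rot_interp i) =
      (LINT x|lebesgue_on \<Omega>. (\<Sum>a\<in>UNIV. wdiv \<Omega> u x * (U a x * rot_interp i x $ a)))"
      by (simp add: ip_def inner_vec_def U_def mult.assoc)
    also have "\<dots> = (LINT x|lebesgue_on \<Omega>. (\<Sum>a\<in>UNIV. \<Sum>b\<in>UNIV. d b b x * U a x * R a x))"
    proof (rule integral_cong_AE)
      show "AE x in lebesgue_on \<Omega>. (\<Sum>a\<in>UNIV. wdiv \<Omega> u x * (U a x * rot_interp i x $ a))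
         = (\<Sum>a\<in>UNIV. \<Sum>b\<in>UNIV. d b b x * U a x * R a x)"
        using swap wdiv_trace[OF Xsp_H1vec[OF u]]
      proof eventually_elim
        case (elim x)
        then have e: "U a x * rot_interp i x $ b = U a x * R b x" for a b by blast
        show ?case
          by (simp only: e elim(2) d_def[symmetric] sum_distrib_right mult.assoc)
      qed
      show "(\<lambda>x. \<Sum>a\<in>UNIV. wdiv \<Omega> u x * (U a x * rot_interp i x $ a)) \<in> borel_measurable (lebesgue_on \<Omega>)"
        by (intro borel_measurable_sum borel_measurable_times meas L2_measurable wdiv_L2 Xsp_H1vec u)
    qed (intro borel_measurable_sum borel_measurable_times meas)
    finally show ?thesis .
  qed
  have "emac \<Omega> u u (rot_interp i) = (LINT x|lebesgue_on \<Omega>.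
      (\<Sum>a\<in>UNIV. \<Sum>b\<in>UNIV. d a b x * U b x * R a x + d b a x * U b x * R a x)
      + (\<Sum>a\<in>UNIV. \<Sum>b\<in>UNIV. d b b x * U a x * R a x))"
    unfolding emac_def 1 2
    by (rule Bochner_Integration.integral_add[symmetric])
       (intro Bochner_Integration.integrable_sum Bochner_Integration.integrable_add intd)+
  also have "\<dots> = (LINT x|lebesgue_on \<Omega>. (\<Sum>a\<in>UNIV. \<Sum>b\<in>UNIV.
      (d a b x * U b x + d b a x * U b x + d b b x * U a x) * R a x))"
    by (simp add: sum.distrib[symmetric] distrib_right)
  also have "\<dots> = 0"
    using emac_rot_integral[OF u, of i] by (simp add: d_def U_def R_def)
  finally show ?thesis .
qed

text \<open>
  The gradient of \<open>u\<close> vanishes on the strip and the gradient of the interpolant is constant off the strip,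
  so the integral is a combination of integrals of derivatives of \<open>u\<close>.
\<close>

lemma viscous_rot_interp:
  assumes u: "u \<in> Xsp \<Omega>" and zero: "vanishes_on strip u"
  shows "ip \<Omega> (wjac \<Omega> u) (wjac \<Omega> (rot_interp i)) = 0"
proof -
  have H10: "(\<lambda>y. u y $ a) \<in> H10 \<Omega>" for a using u by (simp add: Xsp_iff)
  have H1z: "(\<lambda>y. rot_interp i y $ a) \<in> H1 \<Omega>" for a using rot_interp_Xsp H10_H1 by (simp add: Xsp_iff)
  note H1 = H10_H1[OF H10]
  have int: "integrable (lebesgue_on \<Omega>) (wpartial \<Omega> b (\<lambda>y. u y $ a))" for a b
    by (intro L2_imp_integrable dom_lmeasurable wpartial_L2 H1)
  have ae: "AE x in lebesgue_on \<Omega>. wpartial \<Omega> b (\<lambda>y. u y $ a) x * wpartial \<Omega> b (\<lambda>y. rot_interp i y $ a) x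
      = rot_coeff i a $ b * wpartial \<Omega> b (\<lambda>y. u y $ a) x" for a b
  proof -
    have "AE x in lebesgue. x \<in> strip \<longrightarrow> u x $ a = 0"
      using zero unfolding vanishes_on_def AE_strip_iff by eventually_elim simp
    from wpartial_strip[OF H1 this, of b] wpartial_rot_interp[of b i a]
    show ?thesis unfolding AE_dom_iff by eventually_elim auto
  qed
  have "ip \<Omega> (wjac \<Omega> u) (wjac \<Omega> (rot_interp i)) = (LINT x|lebesgue_on \<Omega>. (\<Sum>a\<in>UNIV. \<Sum>b\<in>UNIV.
      wpartial \<Omega> b (\<lambda>y. u y $ a) x * wpartial \<Omega> b (\<lambda>y. rot_interp i y $ a) x))"
    by (simp add: ip_def inner_vec_def wjac_def)
  also have "\<dots> = (\<Sum>a\<in>UNIV. \<Sum>b\<in>UNIV. LINT x|lebesgue_on \<Omega>.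
      wpartial \<Omega> b (\<lambda>y. u y $ a) x * wpartial \<Omega> b (\<lambda>y. rot_interp i y $ a) x)"
    by (simp add: L2_integrable_mult wpartial_L2 H1 H1z)
  also have "\<dots> = (\<Sum>a\<in>UNIV. \<Sum>b\<in>UNIV. LINT x|lebesgue_on \<Omega>. rot_coeff i a $ b * wpartial \<Omega> b (\<lambda>y. u y $ a) x)"
    by (intro sum.cong refl integral_cong_AE ae borel_measurable_times borel_measurable_const L2_measurable wpartial_L2 H1 H1z)
  also have "\<dots> = 0" using integral_wpartial_H10[OF H10] by simp
  finally show ?thesis .
qed

text \<open>
  Off the strip the divergence is the trace of a skew-symmetric matrix.
\<close>

lemma pressure_rot_interp:
  assumes P: "P \<in> L2 \<Omega>" "vanishes_on strip P"
  shows "ip \<Omega> P (wdiv \<Omega> (rot_interp i)) = 0"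
proof -
  have tr: "AE x in lebesgue. \<forall>j. x \<in> \<Omega> - strip \<longrightarrow> wpartial \<Omega> j (\<lambda>y. rot_interp i y $ j) x = rot_coeff i j $ j"
    using wpartial_rot_interp by (subst AE_all_countable) blast
  have diag: "rot_coeff i j $ j = 0" for j using rot_coeff_antisym[of i j j] by simp
  have "AE x in lebesgue. x \<in> strip \<longrightarrow> P x = 0"
    using P(2) by (simp add: vanishes_on_def AE_strip_iff)
  then have "AE x in lebesgue_on \<Omega>. P x \<bullet> wdiv \<Omega> (rot_interp i) x = 0"
    using tr wdiv_trace[OF Xsp_H1vec[OF rot_interp_Xsp[of i]]] unfolding AE_dom_iff
    by eventually_elim (auto simp: diag)
  then show ?thesis
    unfolding ip_def by (simp add: integral_eq_zero_AE)
qed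

lemma ang_mom_eq_interp:
  assumes "v \<in> L2 \<Omega>" "vanishes_on strip v"
  shows "ang_mom \<Omega> v i = ip \<Omega> v (rot_interp i)"
  unfolding ang_mom_def ip_def
proof (rule integral_cong_AE)
  show "(\<lambda>x. v x \<bullet> rot_field i x) \<in> borel_measurable (lebesgue_on \<Omega>)"
    "(\<lambda>x. v x \<bullet> rot_interp i x) \<in> borel_measurable (lebesgue_on \<Omega>)"
    by (intro borel_measurable_inner L2_measurable assms rot_field_L2 Xsp_L2 rot_interp_Xsp)+
  show "AE x in lebesgue_on \<Omega>. v x \<bullet> rot_field i x = v x \<bullet> rot_interp i x"
    using strip_or_interp[OF assms(2), of i] by eventually_elim auto
qed

text \<open>
  Any two elements of the velocity space that agree with \<open>x \<times> e\<^sub>i\<close> off the strip differ by one that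
  vanishes there, and \<open>F\<close> is zero on the difference.
\<close>

lemma pairing_rot_field:
  assumes F: "F \<in> Hm1 \<Omega>" and van: "functional_vanishes_on \<Omega> strip F"
  shows "pairing_off \<Omega> strip F (rot_field i) = F (rot_interp i)"
  unfolding pairing_off_def
proof (rule the_equality)
  let ?z = "rot_interp i"
  have z: "AE x in lebesgue_on (\<Omega> - strip). ?z x = rot_field i x"
    unfolding AE_off_strip_iff by (auto simp: rot_interp_eq)
  then show "\<exists>v\<in>Xsp \<Omega>. (AE x in lebesgue_on (\<Omega> - strip). v x = rot_field i x) \<and> F v = F ?z"
    using rot_interp_Xsp by blast
  fix c assume "\<exists>v\<in>Xsp \<Omega>. (AE x in lebesgue_on (\<Omega> - strip). v x = rot_field i x) \<and> F v = c"
  then obtain v where v: "v \<in> Xsp \<Omega>" "AE x in lebesgue_on (\<Omega> - strip). v x = rot_field i x" "F v = c" by blast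
  let ?d = "\<lambda>x. v x + (-1) *\<^sub>R ?z x"
  have d: "?d \<in> Xsp \<Omega>" by (intro Xsp_add Xsp_scale v rot_interp_Xsp)
  have "vanishes_on (\<Omega> - strip) ?d"
    unfolding vanishes_on_def using v(2) z by eventually_elim simp
  then have "F ?d = 0" using van d by (simp add: functional_vanishes_on_def)
  moreover have "F (\<lambda>x. ?z x + ?d x) = F ?z + F ?d"
  proof -
    have "\<forall>v\<in>Xsp \<Omega>. \<forall>w\<in>Xsp \<Omega>. F (\<lambda>x. v x + w x) = F v + F w"
      using F by (simp add: Hm1_def)
    from bspec[OF bspec[OF this rot_interp_Xsp] d] show ?thesis .
  qed
  ultimately show "c = F ?z" using v(3) by simp
qed

end

section \<open>The angular momentum balance\<close>

theorem mainTheorem4: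
  fixes \<Omega> :: "(real^3) set" and H :: "real set" and \<T> :: "real \<Rightarrow> (real^3) set set"
    and h \<beta> \<nu> Tend dt :: real and k M :: nat
    and f :: "real \<Rightarrow> functional" and u0 :: "real^3 \<Rightarrow> real^3"
    and ut u :: "nat \<Rightarrow> real^3 \<Rightarrow> real^3" and P :: "nat \<Rightarrow> real^3 \<Rightarrow> real"
  assumes domain: "regular_domain \<Omega>"
    and mesh: "regular_mesh_family \<Omega> H \<T>"
    and degree: "k \<ge> 1"
    and beta: "\<beta> > 0" "\<forall>h\<in>H. inf_sup \<Omega> (\<T> h) k \<beta>"
    and h_in: "h \<in> H"
    and nu: "\<nu> > 0"
    and time: "Tend > 0" "M \<ge> 1" "dt = Tend / real M"
    and f: "Linf_Hm1 \<Omega> Tend f"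
    and init: "admissible_initial \<Omega> u0"
    and sol: "emac_be_proj \<Omega> (\<T> h) k \<nu> dt M f u0 ut u P"
    and f_strip: "\<forall>t\<in>{0<..Tend}. functional_vanishes_on \<Omega> (boundary_strip \<Omega> (\<T> h)) (f t)"
    and ut_strip: "\<forall>n\<le>M. vanishes_on (boundary_strip \<Omega> (\<T> h)) (ut n)"
    and u_strip: "\<forall>n\<le>M. vanishes_on (boundary_strip \<Omega> (\<T> h)) (u n)"
    and P_strip: "\<forall>n\<in>{1..M}. vanishes_on (boundary_strip \<Omega> (\<T> h)) (P n)"
  shows "\<forall>i::3. \<forall>n<M.
           ang_mom \<Omega> (ut (Suc n)) i - ang_mom \<Omega> (ut n) i
             = ang_mom \<Omega> (u (Suc n)) i - ang_mom \<Omega> (u n) i \<and>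
           ang_mom \<Omega> (u (Suc n)) i - ang_mom \<Omega> (u n) i
             = dt * pairing_off \<Omega> (boundary_strip \<Omega> (\<T> h)) (f (real (Suc n) * dt)) (rot_field i)"
proof -
  interpret simplicial_domain \<Omega> "\<T> h"
    using domain mesh h_in
    by unfold_locales (auto simp: regular_domain_def regular_mesh_family_def)
  have dt: "dt > 0" using time by simp
  have ut_Xh: "ut n \<in> Xsp \<Omega>" if "n \<le> M" for n
    using sol that by (cases n) (auto simp: emac_be_proj_def is_L2_projection_def Vh_def Xh_def)
  have u_L2: "u n \<in> L2 \<Omega>" if "n \<le> M" for n
  proof (cases n)
    case 0
    then show ?thesis using Xsp_L2[OF ut_Xh[of 0]] sol by (simp add: emac_be_proj_def)
  next
    case (Suc m)
    then show ?thesis using sol that by (auto simp: emac_be_proj_def Yh_def Ysp_def)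
  qed
  note ut_L2 = Xsp_L2[OF ut_Xh]
  have mom: "ang_mom \<Omega> (ut n) i = ip \<Omega> (ut n) (rot_interp i)"
    "ang_mom \<Omega> (u n) i = ip \<Omega> (u n) (rot_interp i)" if "n \<le> M" for n i
    using that ut_strip u_strip by (auto intro!: ang_mom_eq_interp ut_L2 u_L2)
  \<comment> \<open>the projection step preserves the angular momentum; at \<open>n = 0\<close> both velocities coincide\<close>
  have same: "ang_mom \<Omega> (ut n) i = ang_mom \<Omega> (u n) i" if "n \<le> M" for n i
  proof (cases n)
    case 0
    then show ?thesis using sol by (simp add: emac_be_proj_def)
  next
    case (Suc m)
    then have m: "m < M" using that by simp
    have "rot_interp i \<in> Yh \<Omega> (\<T> h) k"
      using rot_interp_Xh[OF degree, of i] Xsp_subset_Ysp by (auto simp: Xh_def Yh_def)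
    then have "(1 / dt) * ip \<Omega> (u n) (rot_interp i) - ip \<Omega> (P n) (wdiv \<Omega> (rot_interp i))
        = (1 / dt) * ip \<Omega> (ut n) (rot_interp i)"
      using sol m by (simp add: emac_be_proj_def Suc)
    moreover have "P n \<in> L2 \<Omega>" using sol m Suc by (simp add: emac_be_proj_def Qh_def Qsp_def)
    then have "ip \<Omega> (P n) (wdiv \<Omega> (rot_interp i)) = 0"
      using P_strip that Suc by (intro pressure_rot_interp) auto
    ultimately show ?thesis using dt mom[OF that] by simp
  qed
  show ?thesis
  proof (intro allI impI)
    fix i n assume n: "n < M"
    let ?t = "real (Suc n) * dt" and ?z = "rot_interp i"
    have "?t \<le> real M * dt" using n dt by (intro mult_right_mono) auto
    also have "real M * dt = Tend" using time by simp
    finally have t: "?t \<in> {0<..Tend}" using dt by simp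
    have "(1 / dt) * ip \<Omega> (\<lambda>x. ut (Suc n) x - u n x) ?z + emac \<Omega> (ut (Suc n)) (ut (Suc n)) ?z
        + \<nu> * ip \<Omega> (wjac \<Omega> (ut (Suc n))) (wjac \<Omega> ?z) = f ?t ?z"
      using sol n rot_interp_Xh[OF degree, of i] unfolding emac_be_proj_def by blast
    moreover have "emac \<Omega> (ut (Suc n)) (ut (Suc n)) ?z = 0"
      "ip \<Omega> (wjac \<Omega> (ut (Suc n))) (wjac \<Omega> ?z) = 0"
      using n ut_strip by (auto intro!: emac_rot_interp viscous_rot_interp ut_Xh)
    moreover have "ip \<Omega> (\<lambda>x. ut (Suc n) x - u n x) ?z = ip \<Omega> (ut (Suc n)) ?z - ip \<Omega> (u n) ?z"
      using n by (intro ip_vec_diff_left ut_L2 u_L2 Xsp_L2 rot_interp_Xsp) auto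
    ultimately have "ang_mom \<Omega> (ut (Suc n)) i - ang_mom \<Omega> (u n) i = dt * f ?t ?z"
      using dt n by (simp add: mom field_simps)
    moreover have "pairing_off \<Omega> (boundary_strip \<Omega> (\<T> h)) (f ?t) (rot_field i) = f ?t ?z"
      using f f_strip t by (intro pairing_rot_field) (auto simp: Linf_Hm1_def)
    ultimately show "ang_mom \<Omega> (ut (Suc n)) i - ang_mom \<Omega> (ut n) i
             = ang_mom \<Omega> (u (Suc n)) i - ang_mom \<Omega> (u n) i \<and>
           ang_mom \<Omega> (u (Suc n)) i - ang_mom \<Omega> (u n) i
             = dt * pairing_off \<Omega> (boundary_strip \<Omega> (\<T> h)) (f ?t) (rot_field i)"
      using same[of n i] same[of "Suc n" i] n by simp
  qed
qed

end
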